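(* Every generic zero-parameter family of pairs of complex $m\times n$ matrices has one of the following bifurcation diagrams (i.e. Kronecker types), with $r\ge 1$: (a) $\vartriangle^r\!\ldots\vartriangle^r\ \vartriangle^{r+1}\!\ldots\vartriangle^{r+1}$; (b) $\triangledown^r\ldots\triangledown^r\ \triangledown^{r+1}\ldots\triangledown^{r+1}$; (c) $\lambda\mu\ldots\tau$ (with $\lambda,\mu,\dots,\tau$ pairwise distinct). Here the parts $\vartriangle^{r+1}\!\ldots\vartriangle^{r+1}$ and $\triangledown^{r+1}\ldots\triangledown^{r+1}$ can be absent.
   Context: **Equivalence and canonical form.** Two pairs $(A_1,A_2)$, $(B_1,B_2)$ of complex $m\times n$ matrices are equivalent if $B_1=RA_1S$, $B_2=RA_2S$ for some nonsingular $R,S$. Every pair is equivalent to a direct sum (its Kronecker canonical form), unique up to permutation of summands, of pairs denoted by the symbols $\lambda^r:=(I_r,J_r(\lambda))$ ($\lambda\in\mathbb C$), $\infty^r:=(J_r(0),I_r)$, $\vartriangle^r:=(F_r,K_r)$, $\triangledown^r:=(F_r^T,K_r^T)$, where $J_r(\lambda)$ is the $r\times r$ Jordan cell with ones over the diagonal and $F_r=\begin{bmatrix} I_{r-1} \\ 0 \end{bmatrix}$, $K_r=\begin{bmatrix} 0 \\ I_{r-1} \end{bmatrix}$ are $r\times(r-1)$ matrices, $r\ge1$. A sequence of symbols denotes the direct sum of the corresponding pairs; $\lambda$ means $\lambda^1$. The eigenvalue of $(I_r,J_r(\lambda))$ is $\lambda$, and that of $(J_r(0),I_r)$ is $\infty$.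 **Kronecker type.** Two pairs of $m\times n$ matrices have the same Kronecker type if their Kronecker canonical forms differ only by the sets of distinct eigenvalues, i.e. up to a bijection between their sets of distinct eigenvalues in $\mathbb C\cup\{\infty\}$. A Kronecker type is written as an unordered sequence of symbols $\vartriangle^r,\triangledown^r,\lambda^r$, where different Greek letters (or letters with different indices) denote distinct elements of $\mathbb C\cup\{\infty\}$, determined only up to bijections of the set of eigenvalues. **Generic families.** A family of pairs of $m\times n$ matrices $\mathcal A(\alpha_1,\dots,\alpha_k)=\mathcal A_0+\sum_i\alpha_i\mathcal A_i+(\text{terms of order}>1)$ is holomorphic at $\vec 0$; $\mathcal P_{\mathcal A}$ denotes the span of $\mathcal A_1,\dots,\mathcal A_k$ and $\mathcal Q_{\mathcal A}$ the tangent space at $\mathcal A_0$ to the class of all pairs having the same Kronecker type as $\mathcal A_0$. The family is generic if it is transversal to the stratification into Kronecker types, i.e. $\mathbb C^{(m\times n,m\times n)}=\mathcal P_{\mathcal A}+\mathcal Q_{\mathcal A}$, where $\mathbb C^{(m\times n,m\times n)}$ is the space of pairs of complex $m\times n$ matrices. A zero-parameter family is just a pair $\mathcal A_0$ (so $\mathcal P_{\mathcal A}=0$), and its bifurcation diagram is the Kronecker type of that pair. *)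

theory Defs
  imports "HOL-Analysis.Complex_Analysis_Basics" "Jordan_Normal_Form.Jordan_Normal_Form"
begin

type_synonym mat_pair = "complex mat \<times> complex mat"

definition mat_pairs :: "nat \<Rightarrow> nat \<Rightarrow> mat_pair set" where
  "mat_pairs m n = carrier_mat m n \<times> carrier_mat m n"

definition pair_equivalent :: "nat \<Rightarrow> nat \<Rightarrow> mat_pair \<Rightarrow> mat_pair \<Rightarrow> bool" where
  "pair_equivalent m n A B \<longleftrightarrow> A \<in> mat_pairs m n \<and> B \<in> mat_pairs m n \<and>
     (\<exists>R \<in> carrier_mat m m. \<exists>S \<in> carrier_mat n n. invertible_mat R \<and> invertible_mat S \<and>
        fst B = R * fst A * S \<and> snd B = R * snd A * S)"

text \<open>Points of the extended complex plane.\<close>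

datatype eigval = FinEV complex | InfEV

text \<open>The symbols of Kronecker canonical summands. The parameter type makes
  \<^term>\<open>map_symbol\<close> available for renaming eigenvalues.\<close>

datatype 'e symbol = Tri nat | Nabla nat | Eig 'e nat

fun symbol_index :: "'e symbol \<Rightarrow> nat" where
  "symbol_index (Tri r) = r"
| "symbol_index (Nabla r) = r"
| "symbol_index (Eig l r) = r"

definition F_mat :: "nat \<Rightarrow> complex mat" where
  "F_mat r = 1\<^sub>m (r - 1) @\<^sub>r 0\<^sub>m 1 (r - 1)"

definition K_mat :: "nat \<Rightarrow> complex mat" where
  "K_mat r = 0\<^sub>m 1 (r - 1) @\<^sub>r 1\<^sub>m (r - 1)"

fun symbol_pair :: "eigval symbol \<Rightarrow> mat_pair" where
  "symbol_pair (Tri r) = (F_mat r, K_mat r)"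
| "symbol_pair (Nabla r) = (transpose_mat (F_mat r), transpose_mat (K_mat r))"
| "symbol_pair (Eig (FinEV l) r) = (1\<^sub>m r, jordan_block r l)"
| "symbol_pair (Eig InfEV r) = (jordan_block r 0, 1\<^sub>m r)"

definition direct_sum :: "eigval symbol list \<Rightarrow> mat_pair" where
  "direct_sum ss = (diag_block_mat (map (fst \<circ> symbol_pair) ss),
                    diag_block_mat (map (snd \<circ> symbol_pair) ss))"

text \<open>\<open>direct_sum ss\<close> is a Kronecker canonical form of \<open>A\<close>. Summands with a zero number of
  rows or of columns (\<^term>\<open>Tri 1\<close>, \<^term>\<open>Nabla 1\<close>) are allowed; the index 0 is not.\<close>

definition canonical_form :: "nat \<Rightarrow> nat \<Rightarrow> mat_pair \<Rightarrow> eigval symbol list \<Rightarrow> bool" where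
  "canonical_form m n A ss \<longleftrightarrow>
     (\<forall>s \<in> set ss. 1 \<le> symbol_index s) \<and> pair_equivalent m n A (direct_sum ss)"

definition eigvals :: "'e symbol list \<Rightarrow> 'e set" where
  "eigvals ss = {l. \<exists>r. Eig l r \<in> set ss}"

text \<open>Canonical forms are determined up to the order of summands, hence the multisets.\<close>

definition same_kronecker_type :: "nat \<Rightarrow> nat \<Rightarrow> mat_pair \<Rightarrow> mat_pair \<Rightarrow> bool" where
  "same_kronecker_type m n A B \<longleftrightarrow>
     (\<exists>ss ts f. canonical_form m n A ss \<and> canonical_form m n B ts \<and>
        bij_betw f (eigvals ss) (eigvals ts) \<and>
        mset ts = image_mset (map_symbol f) (mset ss))"

text \<open>\<open>A\<close> has the Kronecker type written as the (unordered) sequence \<open>ss\<close>; the eigenvalues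
  occurring in \<open>ss\<close> matter only up to a bijection.\<close>

definition has_kronecker_type :: "nat \<Rightarrow> nat \<Rightarrow> mat_pair \<Rightarrow> eigval symbol list \<Rightarrow> bool" where
  "has_kronecker_type m n A ss \<longleftrightarrow>
     (\<forall>s \<in> set ss. 1 \<le> symbol_index s) \<and> same_kronecker_type m n A (direct_sum ss)"

definition holomorphic_curve :: "nat \<Rightarrow> nat \<Rightarrow> complex set \<Rightarrow> (complex \<Rightarrow> mat_pair) \<Rightarrow> bool" where
  "holomorphic_curve m n U \<gamma> \<longleftrightarrow> (\<forall>t \<in> U. \<gamma> t \<in> mat_pairs m n) \<and>
     (\<forall>i < m. \<forall>j < n. (\<lambda>t. fst (\<gamma> t) $$ (i, j)) holomorphic_on U \<and>
                      (\<lambda>t. snd (\<gamma> t) $$ (i, j)) holomorphic_on U)"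

definition velocity :: "nat \<Rightarrow> nat \<Rightarrow> (complex \<Rightarrow> mat_pair) \<Rightarrow> mat_pair" where
  "velocity m n \<gamma> =
     (mat m n (\<lambda>(i, j). deriv (\<lambda>t. fst (\<gamma> t) $$ (i, j)) 0),
      mat m n (\<lambda>(i, j). deriv (\<lambda>t. snd (\<gamma> t) $$ (i, j)) 0))"

text \<open>The tangent space at \<open>A\<close> to a complex submanifold \<open>C\<close> of the space of pairs, as the set
  of velocities of holomorphic curves in \<open>C\<close> through \<open>A\<close>.\<close>

definition tangent_space :: "nat \<Rightarrow> nat \<Rightarrow> mat_pair set \<Rightarrow> mat_pair \<Rightarrow> mat_pair set" where
  "tangent_space m n C A = {velocity m n \<gamma> | \<gamma> U. open U \<and> 0 \<in> U \<and>
     holomorphic_curve m n U \<gamma> \<and> \<gamma> 0 = A \<and> (\<forall>t \<in> U. \<gamma> t \<in> C)}"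

definition pair_span :: "nat \<Rightarrow> nat \<Rightarrow> mat_pair list \<Rightarrow> mat_pair set" where
  "pair_span m n As = {(mat m n (\<lambda>ij. \<Sum>k<length As. c k * fst (As ! k) $$ ij),
                        mat m n (\<lambda>ij. \<Sum>k<length As. c k * snd (As ! k) $$ ij)) | c. True}"

text \<open>Genericity of a family depends only on its constant term \<open>A0\<close> and on the list \<open>As\<close> of
  its first-order coefficients, whose length is the number of parameters; so a zero-parameter
  family is given by \<open>A0\<close> and the empty list.\<close>

definition generic_family :: "nat \<Rightarrow> nat \<Rightarrow> mat_pair \<Rightarrow> mat_pair list \<Rightarrow> bool" where
  "generic_family m n A0 As \<longleftrightarrow> A0 \<in> mat_pairs m n \<and> set As \<subseteq> mat_pairs m n \<and>
     mat_pairs m n = {(fst P + fst Q, snd P + snd Q) | P Q.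
        P \<in> pair_span m n As \<and> Q \<in> tangent_space m n {B. same_kronecker_type m n A0 B} A0}"

end

theory Submission
  imports Defs "Jordan_Normal_Form.Schur_Decomposition"
begin

text \<open>Both halves of the argument turn the Kronecker type into the nullity of an operator and then
differentiate. If a matrix \<open>M(t)\<close> is differentiable at \<open>0\<close> and its nullity near \<open>0\<close> is at
least the nullity of \<open>M(0)\<close>, then \<open>M'(0)\<close> maps the kernel of \<open>M(0)\<close> into the image of \<open>M(0)\<close>
(\<open>constant_rank_tangent\<close>). For a generic family without parameters every direction is the velocity
of a curve that stays inside the Kronecker type (\<open>generic_flexible\<close>), so each operator whose nullity
depends only on the type restricts the summands that can occur.

Suppose first that a summand \<open>\<nabla>\<^sup>r\<close> occurs, and let \<open>s\<close> be the least such index. The operator is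
multiplication by \<open>B\<^sub>1 + x B\<^sub>2\<close> on polynomial vectors of degree less than \<open>s\<close>. Only the summands
\<open>\<nabla>\<^sup>s\<close> contribute to its kernel, one dimension each, and the kernel vector of such a summand has
linearly independent coefficients. Consequently a nonzero functional on the cokernel would pair
nontrivially with the image of that vector under some direction
(\<open>flexible_toeplitz_contradiction\<close>), so the operator is onto. But a triangle, an eigenvalue cell
of any kind, or \<open>\<nabla>\<^sup>r\<close> with \<open>r \<ge> s + 2\<close> makes the cokernel nonzero; what remains is
\<open>\<nabla>\<^sup>s\<close> and \<open>\<nabla>\<^sup>s\<^sup>+\<^sup>1\<close> (\<open>singular_summands\<close>). Transposition exchanges the two triangles and gives
the other singular case.

If only eigenvalue cells occur, the matrices are square and \<open>N = (c A\<^sub>1 + A\<^sub>2)\<^sup>-\<^sup>1 A\<^sub>1\<close> makes sense for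
almost every \<open>c\<close>. Its eigenvalues are the images of those of the pair under an injective
fractional linear map, so their number \<open>l\<close> depends only on the type. The Hankel matrix of
the power sums \<open>tr N\<^sup>i\<^sup>+\<^sup>j\<close>, with \<open>0 \<le> i, j \<le> l\<close>, has a kernel of dimension one, spanned by the
coefficients of \<open>w = \<Prod>(X - x)\<close>, the product over the distinct eigenvalues. If an eigenvalue \<open>a\<close>
has a Jordan cell of size at least two, a suitable direction turns the tangency condition into
\<open>(w\<^sup>2)''(a) = 0\<close>, whereas the left side equals \<open>2 w'(a)\<^sup>2 \<noteq> 0\<close>. Hence all cells have size one and \<open>w\<close>
annihilates \<open>N\<close> along every curve. The Hankel matrix can therefore be bordered by a row \<open>p N\<^sup>j q\<close>
without losing its kernel; if \<open>a\<close> occurred twice, left and right eigenvectors \<open>p\<close> and \<open>q\<close> of the two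
copies would give the condition \<open>w'(a) = 0\<close>, which is again impossible.

The invariants are read off from arbitrary canonical forms: the set of all canonical forms
of the pair is considered at once, and extremal choices (least index, least multiplicity) are made over
that set.\<close>

unbundle no vec_syntax
unbundle no inner_syntax
hide_const (open) SumSpaces.direct_sum
hide_fact (open) SumSpaces.direct_sum_def

section \<open>Matrices depending on a parameter\<close>

text \<open>Derivatives at the point \<open>0\<close> only, taken entrywise: a tangent vector sees nothing else of a curve.\<close>
definition mat_DERIV :: "nat \<Rightarrow> nat \<Rightarrow> (complex \<Rightarrow> complex mat) \<Rightarrow> complex mat \<Rightarrow> bool" where
  "mat_DERIV nr nc F F' \<longleftrightarrow> (\<forall>t. F t \<in> carrier_mat nr nc) \<and> F' \<in> carrier_mat nr nc \<and>
     (\<forall>i<nr. \<forall>j<nc. ((\<lambda>t. F t $$ (i, j)) has_field_derivative F' $$ (i, j)) (at 0))"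

lemma mat_DERIV_carrier:
  assumes "mat_DERIV nr nc F F'"
  shows "F t \<in> carrier_mat nr nc" "F' \<in> carrier_mat nr nc"
  using assms by (auto simp: mat_DERIV_def)

lemma mat_DERIV_dim:
  assumes "mat_DERIV nr nc F F'"
  shows "dim_row (F t) = nr" "dim_col (F t) = nc" "dim_row F' = nr" "dim_col F' = nc"
  using mat_DERIV_carrier(1)[OF assms, of t] mat_DERIV_carrier(2)[OF assms] by auto

lemma mat_DERIV_const:
  assumes "A \<in> carrier_mat nr nc"
  shows "mat_DERIV nr nc (\<lambda>t. A) (0\<^sub>m nr nc)"
  using assms by (auto simp: mat_DERIV_def)

lemma mat_DERIV_add:
  assumes "mat_DERIV nr nc F F'" "mat_DERIV nr nc G G'"
  shows "mat_DERIV nr nc (\<lambda>t. F t + G t) (F' + G')"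
  using assms unfolding mat_DERIV_def
  by (auto simp: mat_DERIV_dim[OF assms(1)] mat_DERIV_dim[OF assms(2)] intro!: DERIV_add)

lemma mat_DERIV_smult:
  assumes "mat_DERIV nr nc F F'"
  shows "mat_DERIV nr nc (\<lambda>t. c \<cdot>\<^sub>m F t) (c \<cdot>\<^sub>m F')"
  using assms unfolding mat_DERIV_def
  by (auto simp: mat_DERIV_dim[OF assms] intro!: DERIV_cmult)

lemma mat_DERIV_transpose:
  assumes "mat_DERIV nr nc F F'"
  shows "mat_DERIV nc nr (\<lambda>t. transpose_mat (F t)) (transpose_mat F')"
  using assms unfolding mat_DERIV_def by (auto simp: mat_DERIV_dim[OF assms])

lemma index_mult_mat_sum:
  assumes "A \<in> carrier_mat nr n" "B \<in> carrier_mat n nc" "i < nr" "j < nc"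
  shows "(A * B) $$ (i, j) = (\<Sum>k<n. A $$ (i, k) * B $$ (k, j))"
  using assms by (auto simp: scalar_prod_def lessThan_atLeast0 intro!: sum.cong)

lemma index_mult_mat_vec_sum:
  assumes "A \<in> carrier_mat nr n" "v \<in> carrier_vec n" "i < nr"
  shows "(A *\<^sub>v v) $ i = (\<Sum>k<n. A $$ (i, k) * v $ k)"
  using assms by (auto simp: scalar_prod_def lessThan_atLeast0 intro!: sum.cong)

lemma mat_DERIV_mult:
  assumes "mat_DERIV nr n F F'" "mat_DERIV n nc G G'"
  shows "mat_DERIV nr nc (\<lambda>t. F t * G t) (F' * G 0 + F 0 * G')"
proof -
  note c = mat_DERIV_carrier(1)[OF assms(1)] mat_DERIV_carrier(1)[OF assms(2)]
    mat_DERIV_carrier(2)[OF assms(1)] mat_DERIV_carrier(2)[OF assms(2)]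
  have "((\<lambda>t. (F t * G t) $$ (i, j)) has_field_derivative (F' * G 0 + F 0 * G') $$ (i, j)) (at 0)"
    if ij: "i < nr" "j < nc" for i j
  proof -
    have "((\<lambda>t. \<Sum>k<n. F t $$ (i, k) * G t $$ (k, j)) has_field_derivative
       (\<Sum>k<n. F' $$ (i, k) * G 0 $$ (k, j) + G' $$ (k, j) * F 0 $$ (i, k))) (at 0)"
      using assms ij by (intro DERIV_sum DERIV_mult) (auto simp: mat_DERIV_def)
    moreover have "(F' * G 0 + F 0 * G') $$ (i, j) =
       (\<Sum>k<n. F' $$ (i, k) * G 0 $$ (k, j) + G' $$ (k, j) * F 0 $$ (i, k))"
    proof -
      have "(F' * G 0 + F 0 * G') $$ (i, j) = (F' * G 0) $$ (i, j) + (F 0 * G') $$ (i, j)"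
        using c(1)[of 0] c(2)[of 0] c(3,4) ij by (intro index_add_mat(1)) auto
      then show ?thesis
        unfolding index_mult_mat_sum[OF c(3) c(2) ij] index_mult_mat_sum[OF c(1) c(4) ij] sum.distrib[symmetric]
        by (simp add: mult.commute)
    qed
    ultimately show ?thesis
      unfolding index_mult_mat_sum[OF c(1) c(2) ij] by simp
  qed
  moreover have "F' * G 0 + F 0 * G' \<in> carrier_mat nr nc" "F t * G t \<in> carrier_mat nr nc" for t
    using mult_carrier_mat[OF c(1) c(2)] mult_carrier_mat[OF c(1) c(4)] mult_carrier_mat[OF c(3) c(2)]
    by auto
  ultimately show ?thesis
    by (simp add: mat_DERIV_def)
qed

lemma det_field_differentiable:
  assumes "\<And>t. F t \<in> carrier_mat n n"
    and "\<And>i j. i < n \<Longrightarrow> j < n \<Longrightarrow> (\<lambda>t. F t $$ (i, j)) field_differentiable (at (x :: complex))"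
  shows "(\<lambda>t. det (F t)) field_differentiable (at x)"
proof -
  have "\<exists>f'. ((\<lambda>t. \<Prod>i = 0..<n. F t $$ (i, p i)) has_field_derivative f') (at x)"
    if "p permutes {0..<n}" for p
  proof -
    have "\<exists>f'. ((\<lambda>t. F t $$ (i, p i)) has_field_derivative f') (at x)" if "i < n" for i
    proof -
      have "p i < n"
        using \<open>p permutes {0..<n}\<close> that permutes_in_image[of p "{0..<n}" i] by auto
      then show ?thesis
        using assms(2)[OF that] by (auto simp: field_differentiable_def)
    qed
    then obtain f' where f': "\<And>i. i < n \<Longrightarrow> ((\<lambda>t. F t $$ (i, p i)) has_field_derivative f' i) (at x)"
      by metis
    show ?thesis
      by (rule exI, rule has_field_derivative_prod) (use f' in auto)
  qed
  then show ?thesis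
    unfolding det_def'[OF assms(1)]
    by (intro field_differentiable_sum field_differentiable_mult)
      (auto simp: field_differentiable_def)
qed

lemma adj_mat_field_differentiable:
  assumes "\<And>t. F t \<in> carrier_mat n n"
    and "\<And>i j. i < n \<Longrightarrow> j < n \<Longrightarrow> (\<lambda>t. F t $$ (i, j)) field_differentiable (at (x :: complex))"
    and "i < n" "j < n"
  shows "(\<lambda>t. adj_mat (F t) $$ (i, j)) field_differentiable (at x)"
proof -
  have dim: "dim_row (F t) = n" "dim_col (F t) = n" for t
    using assms(1)[of t] by auto
  have "(\<lambda>t. det (mat_delete (F t) j i)) field_differentiable (at x)"
  proof (rule det_field_differentiable[where n = "n - 1"])
    fix a b assume "a < n - 1" "b < n - 1"
    then have "(\<lambda>t. mat_delete (F t) j i $$ (a, b)) =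
       (\<lambda>t. F t $$ (if a < j then a else Suc a, if b < i then b else Suc b))"
      by (auto simp: mat_delete_def dim)
    with \<open>a < n - 1\<close> \<open>b < n - 1\<close> show "(\<lambda>t. mat_delete (F t) j i $$ (a, b)) field_differentiable (at x)"
      by (auto intro!: assms(2))
  qed (auto simp: mat_delete_def dim)
  then have "(\<lambda>t. (-1) ^ (j + i) * det (mat_delete (F t) j i)) field_differentiable (at x)"
    by (intro field_differentiable_mult) auto
  then show ?thesis
    using assms(3,4) by (simp add: adj_mat_def dim cofactor_def)
qed

lemma mat_DERIV_field_differentiable:
  assumes "mat_DERIV nr nc F F'" "i < nr" "j < nc"
  shows "(\<lambda>t. F t $$ (i, j)) field_differentiable (at 0)"
  using assms by (auto simp: mat_DERIV_def field_differentiable_def)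

lemma mat_DERIV_det_nonzero:
  assumes "mat_DERIV n n F F'" "det (F 0) \<noteq> 0"
  shows "\<forall>\<^sub>F t in nhds 0. det (F t) \<noteq> 0"
proof -
  have "(\<lambda>t. det (F t)) field_differentiable (at 0)"
    using assms(1) by (intro det_field_differentiable mat_DERIV_field_differentiable mat_DERIV_carrier)
  then have "((\<lambda>t. det (F t)) \<longlongrightarrow> det (F 0)) (nhds 0)"
    using field_differentiable_imp_continuous_at continuous_at tendsto_at_iff_tendsto_nhds by blast
  then show ?thesis
    using assms(2) tendsto_imp_eventually_ne by blast
qed

section \<open>Kernels of constant dimension\<close>

text \<open>\<open>p\<close> linear functionals separate the points of the kernel. Together with \<open>nullity_ge\<close> this expresses
the dimension of a kernel by explicit matrices, which behave well under block sums.\<close>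
definition nullity_le :: "complex mat \<Rightarrow> nat \<Rightarrow> bool" where
  "nullity_le M p \<longleftrightarrow> (\<exists>L \<in> carrier_mat p (dim_col M). \<forall>z \<in> carrier_vec (dim_col M).
     M *\<^sub>v z = 0\<^sub>v (dim_row M) \<longrightarrow> L *\<^sub>v z = 0\<^sub>v p \<longrightarrow> z = 0\<^sub>v (dim_col M))"

definition nullity_ge :: "complex mat \<Rightarrow> nat \<Rightarrow> bool" where
  "nullity_ge M p \<longleftrightarrow> (\<exists>K \<in> carrier_mat (dim_col M) p. M * K = 0\<^sub>m (dim_row M) p \<and>
     (\<forall>x \<in> carrier_vec p. K *\<^sub>v x = 0\<^sub>v (dim_col M) \<longrightarrow> x = 0\<^sub>v p))"

lemma mult_zero_vec: "A \<in> carrier_mat nr nc \<Longrightarrow> A *\<^sub>v 0\<^sub>v nc = (0\<^sub>v nr :: complex vec)"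
  by auto

lemma zero_mat_mult_vec: "v \<in> carrier_vec nc \<Longrightarrow> 0\<^sub>m nr nc *\<^sub>v v = (0\<^sub>v nr :: complex vec)"
  by auto

lemma smult_mat_mult_vec:
  assumes v: "(v :: complex vec) \<in> carrier_vec n"
  shows "(c \<cdot>\<^sub>m 1\<^sub>m n) *\<^sub>v v = c \<cdot>\<^sub>v v"
proof (rule eq_vecI)
  fix i assume "i < dim_vec (c \<cdot>\<^sub>v v)"
  then have i: "i < n" using v by simp
  have "((c \<cdot>\<^sub>m 1\<^sub>m n) *\<^sub>v v) $ i = (\<Sum>k<n. (c \<cdot>\<^sub>m 1\<^sub>m n) $$ (i, k) * v $ k)"
    using v i by (intro index_mult_mat_vec_sum) auto
  also have "\<dots> = (\<Sum>k<n. if k = i then c * v $ k else 0)"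
    using i by (intro sum.cong) auto
  finally show "((c \<cdot>\<^sub>m 1\<^sub>m n) *\<^sub>v v) $ i = (c \<cdot>\<^sub>v v) $ i"
    using v i by simp
qed (use v in auto)

text \<open>If \<open>E z = 0\<close> for the Gram matrix \<open>E\<close> of the stacked matrix, then
\<open>0 = z\<^sup>* E z = |M z|\<^sup>2 + |L z|\<^sup>2\<close>, so \<open>z\<close> lies in both kernels.\<close>
lemma gram_nonsingular:
  fixes M L :: "complex mat"
  assumes M: "M \<in> carrier_mat a b" and L: "L \<in> carrier_mat p b"
    and inj: "\<And>z. z \<in> carrier_vec b \<Longrightarrow> M *\<^sub>v z = 0\<^sub>v a \<Longrightarrow> L *\<^sub>v z = 0\<^sub>v p \<Longrightarrow> z = 0\<^sub>v b"
  shows "det (transpose_mat (map_mat cnj M) * M + transpose_mat (map_mat cnj L) * L) \<noteq> 0"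
proof
  define E where "E = transpose_mat (map_mat cnj M) * M + transpose_mat (map_mat cnj L) * L"
  have E: "E \<in> carrier_mat b b"
    using M L by (auto simp: E_def)
  assume "det (transpose_mat (map_mat cnj M) * M + transpose_mat (map_mat cnj L) * L) = 0"
  then obtain z where z: "z \<in> carrier_vec b" "z \<noteq> 0\<^sub>v b" "E *\<^sub>v z = 0\<^sub>v b"
    using det_0_iff_vec_prod_zero[OF E] by (auto simp: E_def)
  have norms: "map_vec cnj z \<bullet> (transpose_mat (map_mat cnj N) *\<^sub>v (N *\<^sub>v z)) =
      of_real (\<Sum>i<q. (cmod ((N *\<^sub>v z) $ i))\<^sup>2)" if N: "N \<in> carrier_mat q b" for N q
  proof -
    have cz: "map_mat cnj N *\<^sub>v map_vec cnj z = map_vec cnj (N *\<^sub>v z)"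
    proof (rule eq_vecI)
      fix i assume "i < dim_vec (map_vec cnj (N *\<^sub>v z))"
      then have i: "i < q" using N by simp
      have "(map_mat cnj N *\<^sub>v map_vec cnj z) $ i = (\<Sum>k<b. map_mat cnj N $$ (i,k) * map_vec cnj z $ k)"
        using N z i by (intro index_mult_mat_vec_sum) auto
      also have "\<dots> = cnj (\<Sum>k<b. N $$ (i,k) * z $ k)"
        using N z i by (auto intro!: sum.cong)
      also have "\<dots> = map_vec cnj (N *\<^sub>v z) $ i"
        using index_mult_mat_vec_sum[OF N z(1) i] N i by auto
      finally show "(map_mat cnj N *\<^sub>v map_vec cnj z) $ i = map_vec cnj (N *\<^sub>v z) $ i" .
    qed (use N in auto)
    have "map_vec cnj z \<bullet> (transpose_mat (map_mat cnj N) *\<^sub>v (N *\<^sub>v z)) =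
       (transpose_mat (map_mat cnj N) *\<^sub>v (N *\<^sub>v z)) \<bullet> map_vec cnj z"
      using N z by (intro comm_scalar_prod[of _ b]) auto
    also have "\<dots> = (N *\<^sub>v z) \<bullet> (map_mat cnj N *\<^sub>v map_vec cnj z)"
      using N z by (intro transpose_vec_mult_scalar) auto
    also have "\<dots> = (\<Sum>i<q. (N *\<^sub>v z) $ i * cnj ((N *\<^sub>v z) $ i))"
      using N unfolding cz by (auto simp: scalar_prod_def lessThan_atLeast0 intro!: sum.cong)
    also have "\<dots> = of_real (\<Sum>i<q. (cmod ((N *\<^sub>v z) $ i))\<^sup>2)"
      by (simp only: of_real_sum complex_norm_square)
    finally show ?thesis .
  qed
  have zero: "N *\<^sub>v z = 0\<^sub>v q" if N: "N \<in> carrier_mat q b" and "(\<Sum>i<q. (cmod ((N *\<^sub>v z) $ i))\<^sup>2) = 0" for N q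
    using that by (intro eq_vecI) (auto simp: sum_nonneg_eq_0_iff)
  have "0 = map_vec cnj z \<bullet> (E *\<^sub>v z)"
    using z by auto
  also have "E *\<^sub>v z = transpose_mat (map_mat cnj M) *\<^sub>v (M *\<^sub>v z) + transpose_mat (map_mat cnj L) *\<^sub>v (L *\<^sub>v z)"
    unfolding E_def using M L z by (subst add_mult_distrib_mat_vec[of _ b b]) auto
  also have "map_vec cnj z \<bullet> \<dots> = map_vec cnj z \<bullet> (transpose_mat (map_mat cnj M) *\<^sub>v (M *\<^sub>v z)) + 
      map_vec cnj z \<bullet> (transpose_mat (map_mat cnj L) *\<^sub>v (L *\<^sub>v z))"
    using M L z by (intro scalar_prod_add_distrib[of _ b]) auto
  also have "\<dots> = of_real ((\<Sum>i<a. (cmod ((M *\<^sub>v z) $ i))\<^sup>2) + (\<Sum>i<p. (cmod ((L *\<^sub>v z) $ i))\<^sup>2))"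
    using norms[OF M] norms[OF L] by simp
  finally have "(\<Sum>i<a. (cmod ((M *\<^sub>v z) $ i))\<^sup>2) + (\<Sum>i<p. (cmod ((L *\<^sub>v z) $ i))\<^sup>2) = 0"
    using of_real_eq_0_iff by metis
  moreover have "(\<Sum>i<a. (cmod ((M *\<^sub>v z) $ i))\<^sup>2) \<ge> 0" "(\<Sum>i<p. (cmod ((L *\<^sub>v z) $ i))\<^sup>2) \<ge> 0"
    by (auto intro: sum_nonneg)
  ultimately have "M *\<^sub>v z = 0\<^sub>v a" "L *\<^sub>v z = 0\<^sub>v p"
    using zero[OF M] zero[OF L] by auto
  with inj z show False by auto
qed

text \<open>On the kernel of \<open>M\<close> the matrix \<open>E\<close> agrees with \<open>H L\<close>. As \<open>E\<close> is injective there, so is \<open>L\<close>, and for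
dimension reasons \<open>L\<close> maps the range of \<open>K\<close> onto the whole space. Thus every \<open>H w\<close> is \<open>E y\<close> for some
\<open>y\<close> in the kernel of \<open>M\<close>, and \<open>y\<close> is recovered from \<open>H w\<close>, up to the factor \<open>det E\<close>, by the adjugate. The
point of using the adjugate is that its entries are polynomials in those of \<open>E\<close>.\<close>
lemma adjugate_kernel:
  fixes M C L K :: "complex mat"
  assumes M: "M \<in> carrier_mat a b" and C: "C \<in> carrier_mat b a"
    and H: "H \<in> carrier_mat b p" and L: "L \<in> carrier_mat p b" and K: "K \<in> carrier_mat b p"
    and E: "E = C * M + H * L" and det: "det E \<noteq> 0"
    and MK: "M * K = 0\<^sub>m a p" and K_inj: "\<And>x. x \<in> carrier_vec p \<Longrightarrow> K *\<^sub>v x = 0\<^sub>v b \<Longrightarrow> x = 0\<^sub>v p"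
    and w: "w \<in> carrier_vec p"
  shows "M *\<^sub>v (adj_mat E *\<^sub>v (H *\<^sub>v w)) = 0\<^sub>v a"
proof -
  have Ec: "E \<in> carrier_mat b b" using E C M H L by auto
  note adj = adj_mat[OF Ec]
  have Ey: "E *\<^sub>v (K *\<^sub>v x) = H *\<^sub>v (L *\<^sub>v (K *\<^sub>v x))" if x: "x \<in> carrier_vec p" for x
  proof -
    have "M *\<^sub>v (K *\<^sub>v x) = 0\<^sub>v a"
      using MK x M K by (metis assoc_mult_mat_vec zero_mat_mult_vec)
    then have "(C * M) *\<^sub>v (K *\<^sub>v x) = 0\<^sub>v b"
      using C M K x by (subst assoc_mult_mat_vec[of _ b a _ b]) auto
    then show ?thesis
      unfolding E using C M H L K x
      by (subst add_mult_distrib_mat_vec[of _ b b]) auto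
  qed
  have LK: "L * K \<in> carrier_mat p p" using L K by auto
  have cancel: "y = 0\<^sub>v b" if y: "y \<in> carrier_vec b" and "E *\<^sub>v y = 0\<^sub>v b" for y
    using that det det_0_iff_vec_prod_zero[OF Ec] by auto
  have "det (L * K) \<noteq> 0"
  proof
    assume "det (L * K) = 0"
    then obtain x where x: "x \<in> carrier_vec p" "x \<noteq> 0\<^sub>v p" "(L * K) *\<^sub>v x = 0\<^sub>v p"
      using det_0_iff_vec_prod_zero[OF LK] by auto
    then have "L *\<^sub>v (K *\<^sub>v x) = 0\<^sub>v p"
      using assoc_mult_mat_vec[OF L K] by simp
    then have "E *\<^sub>v (K *\<^sub>v x) = 0\<^sub>v b"
      using Ey[OF x(1)] mult_zero_vec[OF H] by simp
    then have "K *\<^sub>v x = 0\<^sub>v b"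
      using cancel K x by simp
    then show False using K_inj x by auto
  qed
  define d where "d = det (L * K)"
  define x where "x = (1 / d) \<cdot>\<^sub>v (adj_mat (L * K) *\<^sub>v w)"
  have d0: "d \<noteq> 0" using \<open>det (L * K) \<noteq> 0\<close> by (simp add: d_def)
  have adjLK: "adj_mat (L * K) \<in> carrier_mat p p" using adj_mat(1)[OF LK] .
  have x: "x \<in> carrier_vec p" using adjLK w by (auto simp: x_def)
  have "L *\<^sub>v (K *\<^sub>v x) = (L * K) *\<^sub>v x"
    using L K x by simp
  also have "\<dots> = (1 / d) \<cdot>\<^sub>v ((L * K) *\<^sub>v (adj_mat (L * K) *\<^sub>v w))"
    unfolding x_def using LK adjLK w by (intro mult_mat_vec[of _ p p]) auto
  also have "\<dots> = (1 / d) \<cdot>\<^sub>v ((L * K * adj_mat (L * K)) *\<^sub>v w)"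
    using LK adjLK w by (subst assoc_mult_mat_vec[of _ p p _ p]) auto
  also have "\<dots> = w"
    using adj_mat(2)[OF LK] w d0
    by (auto simp: d_def[symmetric] smult_mat_mult_vec)
  finally have "H *\<^sub>v w = E *\<^sub>v (K *\<^sub>v x)"
    using Ey[OF x] by simp
  then have "adj_mat E *\<^sub>v (H *\<^sub>v w) = (adj_mat E * E) *\<^sub>v (K *\<^sub>v x)"
    using adj Ec K x by (subst assoc_mult_mat_vec[of _ b b _ b]) auto
  also have "\<dots> = det E \<cdot>\<^sub>v (K *\<^sub>v x)"
    using adj(3) K x by auto
  finally have "M *\<^sub>v (adj_mat E *\<^sub>v (H *\<^sub>v w)) = det E \<cdot>\<^sub>v (M *\<^sub>v (K *\<^sub>v x))"
    using M K x by (simp add: mult_mat_vec[of _ a b])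
  also have "M *\<^sub>v (K *\<^sub>v x) = 0\<^sub>v a"
    using MK x M K by (metis assoc_mult_mat_vec zero_mat_mult_vec)
  finally show ?thesis by auto
qed

text \<open>A kernel vector \<open>v\<close> of \<open>M(0)\<close> extends to a differentiable family \<open>y(t)\<close> of kernel vectors of \<open>M(t)\<close>:
with \<open>L\<close> injective on the kernel of \<open>M(0)\<close>, put \<open>E(t) = M(0)\<^sup>* M(t) + L\<^sup>* L\<close>, which is
invertible at \<open>0\<close>, and \<open>y(t) = adj E(t) L\<^sup>* L v\<close>. Differentiating \<open>u \<bullet> M(t) y(t) = 0\<close> at \<open>0\<close>, the term
with \<open>y'(0)\<close> vanishes because \<open>u\<close> annihilates the image of \<open>M(0)\<close>.\<close>
lemma constant_rank_tangent:
  assumes D: "mat_DERIV a b M M'"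
    and ge: "\<forall>\<^sub>F t in nhds 0. nullity_ge (M t) p"
    and le: "nullity_le (M 0) p"
    and u: "u \<in> carrier_vec a" "transpose_mat (M 0) *\<^sub>v u = 0\<^sub>v b"
    and v: "v \<in> carrier_vec b" "M 0 *\<^sub>v v = 0\<^sub>v a"
  shows "u \<bullet> (M' *\<^sub>v v) = 0"
proof -
  note M = mat_DERIV_carrier(1)[OF D] and M' = mat_DERIV_carrier(2)[OF D]
  have dimM: "dim_row (M t) = a" "dim_col (M t) = b" for t
    using M[of t] by auto
  obtain L where L: "L \<in> carrier_mat p b"
    and inj: "\<And>z. z \<in> carrier_vec b \<Longrightarrow> M 0 *\<^sub>v z = 0\<^sub>v a \<Longrightarrow> L *\<^sub>v z = 0\<^sub>v p \<Longrightarrow> z = 0\<^sub>v b"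
    using le unfolding nullity_le_def dimM by blast
  define C where "C = transpose_mat (map_mat cnj (M 0))"
  define H where "H = transpose_mat (map_mat cnj L)"
  define E where "E t = C * M t + H * L" for t
  have C: "C \<in> carrier_mat b a" and H: "H \<in> carrier_mat b p"
    using M[of 0] L by (auto simp: C_def H_def)
  have HL: "H * L \<in> carrier_mat b b" using H L by auto
  obtain E' where ED: "mat_DERIV b b E E'"
    using mat_DERIV_add[OF mat_DERIV_mult[OF mat_DERIV_const[OF C] D] mat_DERIV_const[OF HL]]
    unfolding E_def by blast
  note Ec = mat_DERIV_carrier(1)[OF ED]
  have det0: "det (E 0) \<noteq> 0"
    unfolding E_def C_def H_def by (rule gram_nonsingular[OF M L inj])
  define w where "w = L *\<^sub>v v"
  have w: "w \<in> carrier_vec p" using L v by (auto simp: w_def)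
  define y where "y t = adj_mat (E t) *\<^sub>v (H *\<^sub>v w)" for t
  have Hw: "H *\<^sub>v w \<in> carrier_vec b" using H w by auto
  have y: "y t \<in> carrier_vec b" for t
    using adj_mat(1)[OF Ec[of t]] Hw by (auto simp: y_def)
  have My: "\<forall>\<^sub>F t in nhds 0. M t *\<^sub>v y t = 0\<^sub>v a"
    using ge mat_DERIV_det_nonzero[OF ED det0]
  proof eventually_elim
    case (elim t)
    then obtain K where "K \<in> carrier_mat b p" "M t * K = 0\<^sub>m a p"
       "\<And>x. x \<in> carrier_vec p \<Longrightarrow> K *\<^sub>v x = 0\<^sub>v b \<Longrightarrow> x = 0\<^sub>v p"
      unfolding nullity_ge_def dimM by blast
    then show ?case
      using elim unfolding y_def by (intro adjugate_kernel[OF M C H L _ _ _ _ _ w]) (auto simp: E_def)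
  qed
  have y0: "y 0 = det (E 0) \<cdot>\<^sub>v v"
  proof -
    have "E 0 *\<^sub>v v = (C * M 0) *\<^sub>v v + (H * L) *\<^sub>v v"
      unfolding E_def using C M[of 0] HL v by (intro add_mult_distrib_mat_vec[of _ b b]) auto
    also have "(C * M 0) *\<^sub>v v = 0\<^sub>v b"
      using assoc_mult_mat_vec[OF C M[of 0] v(1)] v(2) mult_zero_vec[OF C] by simp
    also have "(H * L) *\<^sub>v v = H *\<^sub>v w"
      using assoc_mult_mat_vec[OF H L v(1)] by (simp add: w_def)
    finally have "E 0 *\<^sub>v v = H *\<^sub>v w" using Hw by simp
    then have "y 0 = (adj_mat (E 0) * E 0) *\<^sub>v v"
      using assoc_mult_mat_vec[OF adj_mat(1)[OF Ec] Ec v(1)] by (simp add: y_def)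
    then show ?thesis
      using adj_mat(3)[OF Ec] v by (simp add: smult_mat_mult_vec)
  qed
  have "\<exists>y'. ((\<lambda>t. y t $ j) has_field_derivative y') (at 0)" if j: "j < b" for j
  proof -
    have "(\<lambda>t. \<Sum>k<b. adj_mat (E t) $$ (j, k) * (H *\<^sub>v w) $ k) field_differentiable (at 0)"
      using j by (intro field_differentiable_sum field_differentiable_mult
        adj_mat_field_differentiable[OF Ec] mat_DERIV_field_differentiable[OF ED]) auto
    then show ?thesis
      unfolding y_def index_mult_mat_vec_sum[OF adj_mat(1)[OF Ec] Hw j]
      by (auto simp: field_differentiable_def)
  qed
  then obtain y' where y': "\<And>j. j < b \<Longrightarrow> ((\<lambda>t. y t $ j) has_field_derivative y' j) (at 0)"
    by metis
  define g where "g t = (\<Sum>i<a. \<Sum>j<b. u $ i * (M t $$ (i, j) * y t $ j))" for t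
  have g_eq: "g t = u \<bullet> (M t *\<^sub>v y t)" for t
  proof -
    have "u \<bullet> (M t *\<^sub>v y t) = (\<Sum>i<a. u $ i * (M t *\<^sub>v y t) $ i)"
      using M[of t] by (auto simp: scalar_prod_def lessThan_atLeast0)
    also have "\<dots> = g t"
      using index_mult_mat_vec_sum[OF M y, of _ t t] by (simp add: g_def sum_distrib_left)
    finally show ?thesis ..
  qed
  have "(g has_field_derivative (\<Sum>i<a. \<Sum>j<b. u $ i * (M' $$ (i, j) * y 0 $ j + y' j * M 0 $$ (i, j)))) (at 0)"
    unfolding g_def using D y'
    by (intro DERIV_sum DERIV_cmult DERIV_mult) (auto simp: mat_DERIV_def)
  moreover have "(g has_field_derivative 0) (at 0)"
  proof -
    have "\<forall>\<^sub>F t in nhds 0. g t = 0"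
      using My by eventually_elim (use u in \<open>auto simp: g_eq\<close>)
    then show ?thesis
      by (subst DERIV_cong_ev[OF refl _ refl]) auto
  qed
  ultimately have "0 = (\<Sum>i<a. \<Sum>j<b. u $ i * (M' $$ (i, j) * y 0 $ j + y' j * M 0 $$ (i, j)))"
    using DERIV_unique by blast
  also have "\<dots> = (\<Sum>i<a. \<Sum>j<b. u $ i * (M' $$ (i, j) * y 0 $ j)) + (\<Sum>i<a. \<Sum>j<b. y' j * (M 0 $$ (i, j) * u $ i))"
    by (simp add: sum.distrib algebra_simps)
  also have "(\<Sum>i<a. \<Sum>j<b. y' j * (M 0 $$ (i, j) * u $ i)) = (\<Sum>j<b. y' j * (\<Sum>i<a. M 0 $$ (i, j) * u $ i))"
    by (subst sum.swap) (simp add: sum_distrib_left)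
  also have "\<dots> = (\<Sum>j<b. y' j * (transpose_mat (M 0) *\<^sub>v u) $ j)"
  proof (rule sum.cong[OF refl])
    fix j assume "j \<in> {..<b}"
    then show "y' j * (\<Sum>i<a. M 0 $$ (i, j) * u $ i) = y' j * (transpose_mat (M 0) *\<^sub>v u) $ j"
      using index_mult_mat_vec_sum[of "transpose_mat (M 0)" b a u j] M[of 0] u by simp
  qed
  also have "\<dots> = 0" using u by simp
  also have "(\<Sum>i<a. \<Sum>j<b. u $ i * (M' $$ (i, j) * y 0 $ j)) = det (E 0) * (u \<bullet> (M' *\<^sub>v v))"
  proof -
    have "u \<bullet> (M' *\<^sub>v v) = (\<Sum>i<a. u $ i * (M' *\<^sub>v v) $ i)"
      using M' by (auto simp: scalar_prod_def lessThan_atLeast0)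
    also have "\<dots> = (\<Sum>i<a. \<Sum>j<b. u $ i * (M' $$ (i, j) * v $ j))"
      using index_mult_mat_vec_sum[OF M' v(1)] by (simp add: sum_distrib_left)
    finally show ?thesis
      using v by (simp add: y0 sum_distrib_left mult_ac)
  qed
  finally show ?thesis using det0 by simp
qed

section \<open>The nullity under block sums and changes of coordinates\<close>

lemma nullity_geI:
  assumes "M \<in> carrier_mat a b" "K \<in> carrier_mat b p" "M * K = 0\<^sub>m a p"
    and "\<And>x. x \<in> carrier_vec p \<Longrightarrow> K *\<^sub>v x = 0\<^sub>v b \<Longrightarrow> x = 0\<^sub>v p"
  shows "nullity_ge M p"
  using assms unfolding nullity_ge_def by auto

lemma nullity_geE:
  assumes "nullity_ge M p" "M \<in> carrier_mat a b"
  obtains K where "K \<in> carrier_mat b p" "M * K = 0\<^sub>m a p"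
    "\<And>x. x \<in> carrier_vec p \<Longrightarrow> K *\<^sub>v x = 0\<^sub>v b \<Longrightarrow> x = 0\<^sub>v p"
  using assms unfolding nullity_ge_def by auto

lemma nullity_leI:
  assumes "M \<in> carrier_mat a b" "L \<in> carrier_mat p b"
    and "\<And>z. z \<in> carrier_vec b \<Longrightarrow> M *\<^sub>v z = 0\<^sub>v a \<Longrightarrow> L *\<^sub>v z = 0\<^sub>v p \<Longrightarrow> z = 0\<^sub>v b"
  shows "nullity_le M p"
  using assms unfolding nullity_le_def by auto

lemma nullity_leE:
  assumes "nullity_le M p" "M \<in> carrier_mat a b"
  obtains L where "L \<in> carrier_mat p b"
    "\<And>z. z \<in> carrier_vec b \<Longrightarrow> M *\<^sub>v z = 0\<^sub>v a \<Longrightarrow> L *\<^sub>v z = 0\<^sub>v p \<Longrightarrow> z = 0\<^sub>v b"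
  using assms unfolding nullity_le_def by auto

lemma nullity_ge_0: "nullity_ge M 0"
  by (rule nullity_geI[where K = "0\<^sub>m (dim_col M) 0"]) auto

lemma nullity_ge_mono:
  assumes "nullity_ge M p" "q \<le> p"
  shows "nullity_ge M q"
proof -
  define a b where "a = dim_row M" and "b = dim_col M"
  have M: "M \<in> carrier_mat a b" by (auto simp: a_def b_def)
  obtain K where K: "K \<in> carrier_mat b p" "M * K = 0\<^sub>m a p"
    and inj: "\<And>x. x \<in> carrier_vec p \<Longrightarrow> K *\<^sub>v x = 0\<^sub>v b \<Longrightarrow> x = 0\<^sub>v p"
    using nullity_geE[OF assms(1) M] by blast
  define K' where "K' = mat b q (\<lambda>(i, j). K $$ (i, j))"
  have K': "K' \<in> carrier_mat b q" by (simp add: K'_def)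
  have "M * K' = 0\<^sub>m a q"
  proof (rule eq_matI)
    fix i j assume ij: "i < dim_row (0\<^sub>m a q)" "j < dim_col (0\<^sub>m a q)"
    then have "(M * K') $$ (i, j) = (\<Sum>k<b. M $$ (i, k) * K $$ (k, j))"
      using index_mult_mat_sum[OF M K'] by (simp add: K'_def)
    also have "\<dots> = (M * K) $$ (i, j)"
      using index_mult_mat_sum[OF M K(1), of i j] ij assms(2) by simp
    finally show "(M * K') $$ (i, j) = 0\<^sub>m a q $$ (i, j)"
      using ij assms(2) by (simp add: K(2))
  qed (use M K' in auto)
  moreover have "x = 0\<^sub>v q" if x: "x \<in> carrier_vec q" and Kx: "K' *\<^sub>v x = 0\<^sub>v b" for x
  proof -
    define y where "y = vec p (\<lambda>i. if i < q then x $ i else 0)"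
    have "K *\<^sub>v y = 0\<^sub>v b"
    proof (rule eq_vecI)
      fix i assume i: "i < dim_vec (0\<^sub>v b)"
      then have "(K *\<^sub>v y) $ i = (\<Sum>k<p. K $$ (i, k) * y $ k)"
        using K by (intro index_mult_mat_vec_sum) (auto simp: y_def)
      also have "\<dots> = (\<Sum>k<q. K $$ (i, k) * x $ k)"
        using assms(2) by (intro sum.mono_neutral_cong_right) (auto simp: y_def)
      also have "\<dots> = (K' *\<^sub>v x) $ i"
        using index_mult_mat_vec_sum[OF K' x, of i] i by (simp add: K'_def)
      finally show "(K *\<^sub>v y) $ i = 0\<^sub>v b $ i"
        using Kx by simp
    qed (use K in auto)
    then have "y = 0\<^sub>v p"
      by (intro inj) (auto simp: y_def)
    then have "y $ i = 0" if "i < q" for i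
      using that assms(2) by simp
    then show ?thesis
      using x assms(2) by (intro eq_vecI) (auto simp: y_def)
  qed
  ultimately show ?thesis
    using nullity_geI[OF M K'] by blast
qed

lemma append_zero_vec: "0\<^sub>v n @\<^sub>v 0\<^sub>v m = (0\<^sub>v (n + m) :: complex vec)"
  by (intro eq_vecI) auto

lemma append_vec_eq_zero:
  assumes "(v :: complex vec) \<in> carrier_vec n" "w \<in> carrier_vec m"
  shows "v @\<^sub>v w = 0\<^sub>v (n + m) \<longleftrightarrow> v = 0\<^sub>v n \<and> w = 0\<^sub>v m"
  using append_vec_eq[of v n "0\<^sub>v n" w "0\<^sub>v m"] assms by (simp add: append_zero_vec)

lemma block_diag_mult_vec:
  assumes "(A :: complex mat) \<in> carrier_mat a b" "D \<in> carrier_mat c d" "v \<in> carrier_vec b" "w \<in> carrier_vec d"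
  shows "four_block_mat A (0\<^sub>m a d) (0\<^sub>m c b) D *\<^sub>v (v @\<^sub>v w) = (A *\<^sub>v v) @\<^sub>v (D *\<^sub>v w)"
  using assms by (subst four_block_mat_mult_vec[of _ a b _ d _ c]) auto

lemma block_diag_mult_vec_eq_zero:
  assumes "(A :: complex mat) \<in> carrier_mat a b" "D \<in> carrier_mat c d" "v \<in> carrier_vec b" "w \<in> carrier_vec d"
  shows "four_block_mat A (0\<^sub>m a d) (0\<^sub>m c b) D *\<^sub>v (v @\<^sub>v w) = 0\<^sub>v (a + c) \<longleftrightarrow>
    A *\<^sub>v v = 0\<^sub>v a \<and> D *\<^sub>v w = 0\<^sub>v c"
  unfolding block_diag_mult_vec[OF assms] using assms by (intro append_vec_eq_zero) auto

lemma vec_split: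
  assumes "(z :: complex vec) \<in> carrier_vec (b + d)"
  obtains v w where "v \<in> carrier_vec b" "w \<in> carrier_vec d" "z = v @\<^sub>v w"
proof
  show "z = vec_first z b @\<^sub>v vec_last z d"
    using assms by simp
qed auto

lemma nullity_le_block_diag:
  assumes "M \<in> carrier_mat a b" "N \<in> carrier_mat c d" "nullity_le M p" "nullity_le N q"
  shows "nullity_le (four_block_mat M (0\<^sub>m a d) (0\<^sub>m c b) N) (p + q)"
proof -
  obtain L where L: "L \<in> carrier_mat p b"
    "\<And>z. z \<in> carrier_vec b \<Longrightarrow> M *\<^sub>v z = 0\<^sub>v a \<Longrightarrow> L *\<^sub>v z = 0\<^sub>v p \<Longrightarrow> z = 0\<^sub>v b"
    using nullity_leE[OF assms(3,1)] by blast
  obtain L' where L': "L' \<in> carrier_mat q d"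
    "\<And>z. z \<in> carrier_vec d \<Longrightarrow> N *\<^sub>v z = 0\<^sub>v c \<Longrightarrow> L' *\<^sub>v z = 0\<^sub>v q \<Longrightarrow> z = 0\<^sub>v d"
    using nullity_leE[OF assms(4,2)] by blast
  show ?thesis
  proof (rule nullity_leI[of _ "a + c" "b + d"])
    fix z :: "complex vec" assume "z \<in> carrier_vec (b + d)"
    then obtain v w where z: "v \<in> carrier_vec b" "w \<in> carrier_vec d" "z = v @\<^sub>v w"
      by (rule vec_split)
    assume "four_block_mat M (0\<^sub>m a d) (0\<^sub>m c b) N *\<^sub>v z = 0\<^sub>v (a + c)"
    moreover assume "four_block_mat L (0\<^sub>m p d) (0\<^sub>m q b) L' *\<^sub>v z = 0\<^sub>v (p + q)"
    ultimately show "z = 0\<^sub>v (b + d)"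
      using L(2) L'(2) assms(1,2) L(1) L'(1) z
      by (simp add: block_diag_mult_vec_eq_zero append_vec_eq_zero)
  qed (use assms L L' in auto)
qed

lemma block_diag_mult:
  assumes "(A :: complex mat) \<in> carrier_mat a b" "D \<in> carrier_mat c d" "A' \<in> carrier_mat b e" "D' \<in> carrier_mat d f"
  shows "four_block_mat A (0\<^sub>m a d) (0\<^sub>m c b) D * four_block_mat A' (0\<^sub>m b f) (0\<^sub>m d e) D' =
    four_block_mat (A * A') (0\<^sub>m a f) (0\<^sub>m c e) (D * D')"
  using assms by (subst mult_four_block_mat[of _ a b _ d _ c _ _ e _ f]) auto

lemma nullity_ge_block_diag:
  assumes "M \<in> carrier_mat a b" "N \<in> carrier_mat c d" "nullity_ge M p" "nullity_ge N q"
  shows "nullity_ge (four_block_mat M (0\<^sub>m a d) (0\<^sub>m c b) N) (p + q)"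
proof -
  obtain K where K: "K \<in> carrier_mat b p" "M * K = 0\<^sub>m a p"
    "\<And>x. x \<in> carrier_vec p \<Longrightarrow> K *\<^sub>v x = 0\<^sub>v b \<Longrightarrow> x = 0\<^sub>v p"
    using nullity_geE[OF assms(3,1)] by blast
  obtain K' where K': "K' \<in> carrier_mat d q" "N * K' = 0\<^sub>m c q"
    "\<And>x. x \<in> carrier_vec q \<Longrightarrow> K' *\<^sub>v x = 0\<^sub>v d \<Longrightarrow> x = 0\<^sub>v q"
    using nullity_geE[OF assms(4,2)] by blast
  show ?thesis
  proof (rule nullity_geI[of _ "a + c" "b + d"])
    show "four_block_mat M (0\<^sub>m a d) (0\<^sub>m c b) N * four_block_mat K (0\<^sub>m b q) (0\<^sub>m d p) K' = 0\<^sub>m (a + c) (p + q)"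
      using assms K K' by (simp add: block_diag_mult)
    fix z :: "complex vec" assume "z \<in> carrier_vec (p + q)"
    then obtain v w where z: "v \<in> carrier_vec p" "w \<in> carrier_vec q" "z = v @\<^sub>v w"
      by (rule vec_split)
    assume "four_block_mat K (0\<^sub>m b q) (0\<^sub>m d p) K' *\<^sub>v z = 0\<^sub>v (b + d)"
    then show "z = 0\<^sub>v (p + q)"
      using K K' z by (simp add: block_diag_mult_vec_eq_zero append_vec_eq_zero)
  qed (use assms K K' in auto)
qed

lemma nullity_le_transform:
  assumes M: "M \<in> carrier_mat a b" and P: "P \<in> carrier_mat a a"
    and Q: "Q \<in> carrier_mat b b" "Q' \<in> carrier_mat b b" "Q * Q' = 1\<^sub>m b"
    and le: "nullity_le (P * M * Q) p"
  shows "nullity_le M p"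
proof -
  have PMQ: "P * M * Q \<in> carrier_mat a b" using M P Q by auto
  obtain L where L: "L \<in> carrier_mat p b"
    and inj: "\<And>z. z \<in> carrier_vec b \<Longrightarrow> (P * M * Q) *\<^sub>v z = 0\<^sub>v a \<Longrightarrow> L *\<^sub>v z = 0\<^sub>v p \<Longrightarrow> z = 0\<^sub>v b"
    using nullity_leE[OF le PMQ] by blast
  show ?thesis
  proof (rule nullity_leI[OF M, of "L * Q'" p])
    fix z assume z: "z \<in> carrier_vec b" "M *\<^sub>v z = 0\<^sub>v a" "(L * Q') *\<^sub>v z = 0\<^sub>v p"
    have Qz: "Q' *\<^sub>v z \<in> carrier_vec b" using Q z by auto
    have QQz: "Q *\<^sub>v (Q' *\<^sub>v z) = z"
      using assoc_mult_mat_vec[OF Q(1,2) z(1)] Q(3) z(1) by simp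
    have PM: "P * M \<in> carrier_mat a b" using P M by auto
    have "(P * M * Q) *\<^sub>v (Q' *\<^sub>v z) = (P * M) *\<^sub>v z"
      using assoc_mult_mat_vec[OF PM Q(1) Qz] QQz by simp
    also have "\<dots> = 0\<^sub>v a"
      using assoc_mult_mat_vec[OF P M z(1)] z(2) mult_zero_vec[OF P] by simp
    finally have "Q' *\<^sub>v z = 0\<^sub>v b"
      using inj[OF Qz] assoc_mult_mat_vec[OF L Q(2) z(1)] z(3) by simp
    then show "z = 0\<^sub>v b"
      using QQz mult_zero_vec[OF Q(1)] by simp
  qed (use L Q in auto)
qed

lemma nullity_ge_transform:
  assumes M: "M \<in> carrier_mat a b" and P: "P \<in> carrier_mat a a" "P' \<in> carrier_mat a a" "P' * P = 1\<^sub>m a"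
    and Q: "Q \<in> carrier_mat b b" "Q' \<in> carrier_mat b b" "Q' * Q = 1\<^sub>m b"
    and ge: "nullity_ge (P * M * Q) p"
  shows "nullity_ge M p"
proof -
  have PMQ: "P * M * Q \<in> carrier_mat a b" using M P Q by auto
  obtain K where K: "K \<in> carrier_mat b p" "P * M * Q * K = 0\<^sub>m a p"
    and inj: "\<And>x. x \<in> carrier_vec p \<Longrightarrow> K *\<^sub>v x = 0\<^sub>v b \<Longrightarrow> x = 0\<^sub>v p"
    using nullity_geE[OF ge PMQ] by blast
  have MQK: "M * (Q * K) \<in> carrier_mat a p" using M Q K by auto
  show ?thesis
  proof (rule nullity_geI[OF M, of "Q * K" p])
    have "P * (M * (Q * K)) = 0\<^sub>m a p"
      using K(2) assoc_mult_mat[OF P(1) M Q(1)] assoc_mult_mat[OF M Q(1) K(1)]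
        assoc_mult_mat[OF P(1) mult_carrier_mat[OF M Q(1)] K(1)] by simp
    then have "P' * P * (M * (Q * K)) = 0\<^sub>m a p"
      using assoc_mult_mat[OF P(2,1) MQK] P by simp
    then show "M * (Q * K) = 0\<^sub>m a p"
      unfolding P(3) left_mult_one_mat[OF MQK] .
    fix x assume x: "x \<in> carrier_vec p" "(Q * K) *\<^sub>v x = 0\<^sub>v b"
    have Kx: "K *\<^sub>v x \<in> carrier_vec b" using K x by auto
    have "Q *\<^sub>v (K *\<^sub>v x) = 0\<^sub>v b"
      using assoc_mult_mat_vec[OF Q(1) K(1) x(1)] x(2) by simp
    then have "K *\<^sub>v x = 0\<^sub>v b"
      using assoc_mult_mat_vec[OF Q(2,1) Kx] Q(3) Kx mult_zero_vec[OF Q(2)] by simp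
    then show "x = 0\<^sub>v p" using inj x by simp
  qed (use K Q in auto)
qed

section \<open>Kronecker products\<close>

text \<open>The index pair \<open>(i, j)\<close> is coded as \<open>i * s + j\<close>, so that a block decomposition of the first factor is a
block decomposition of the product, with no reordering.\<close>
definition kron :: "complex mat \<Rightarrow> complex mat \<Rightarrow> complex mat" where
  "kron A B = mat (dim_row A * dim_row B) (dim_col A * dim_col B)
     (\<lambda>(i, j). A $$ (i div dim_row B, j div dim_col B) * B $$ (i mod dim_row B, j mod dim_col B))"

lemma kron_carrier [simp]:
  "A \<in> carrier_mat a b \<Longrightarrow> B \<in> carrier_mat c d \<Longrightarrow> kron A B \<in> carrier_mat (a * c) (b * d)"
  by (simp add: kron_def)

lemma div_less_of_less_mult: "i div s < n" if "i < n * s" for i n s :: nat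
  using that by (simp add: less_mult_imp_div_less)

lemma mod_less_of_less_mult: "i mod s < s" if "i < n * s" for i n s :: nat
  using that by (cases s) auto

lemma mult_add_less: "k * s + l < n * s" if "k < n" "l < s" for k l n s :: nat
proof -
  have "k * s + l < Suc k * s" using that by simp
  also have "\<dots> \<le> n * s" using that by (intro mult_right_mono) auto
  finally show ?thesis .
qed

lemma sum_div_mod:
  fixes f :: "nat \<Rightarrow> nat \<Rightarrow> complex"
  shows "(\<Sum>k<n * s. f (k div s) (k mod s)) = (\<Sum>i<n. \<Sum>j<s. f i j)"
proof -
  have "(\<Sum>k<n * s. f (k div s) (k mod s)) = (\<Sum>i<n. \<Sum>k = i * s..<i * s + s. f (k div s) (k mod s))"
    by (simp add: sum.nat_group)
  also have "\<dots> = (\<Sum>i<n. \<Sum>j<s. f i j)"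
  proof (rule sum.cong[OF refl])
    fix i
    show "(\<Sum>k = i * s..<i * s + s. f (k div s) (k mod s)) = (\<Sum>j<s. f i j)"
      using sum.shift_bounds_nat_ivl[of "\<lambda>k. f (k div s) (k mod s)" 0 "i * s" s]
      by (simp add: lessThan_atLeast0 add.commute)
  qed
  finally show ?thesis .
qed

lemma kron_mult:
  assumes A: "A \<in> carrier_mat a b" and B: "B \<in> carrier_mat c d"
    and A': "A' \<in> carrier_mat b e" and B': "B' \<in> carrier_mat d f"
  shows "kron A B * kron A' B' = kron (A * A') (B * B')"
proof (rule eq_matI)
  fix i j assume "i < dim_row (kron (A * A') (B * B'))" "j < dim_col (kron (A * A') (B * B'))"
  then have ij: "i < a * c" "j < e * f" using assms by (auto simp: kron_def)
  note b = div_less_of_less_mult[OF ij(1)] div_less_of_less_mult[OF ij(2)]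
    mod_less_of_less_mult[OF ij(1)] mod_less_of_less_mult[OF ij(2)]
  have "(kron A B * kron A' B') $$ (i, j) = (\<Sum>k<b * d. kron A B $$ (i, k) * kron A' B' $$ (k, j))"
    using ij assms by (intro index_mult_mat_sum) auto
  also have "\<dots> = (\<Sum>k<b * d. (A $$ (i div c, k div d) * A' $$ (k div d, j div f)) *
      (B $$ (i mod c, k mod d) * B' $$ (k mod d, j mod f)))"
    using ij assms by (intro sum.cong) (auto simp: kron_def)
  also have "\<dots> = (\<Sum>k<b. \<Sum>l<d. (A $$ (i div c, k) * A' $$ (k, j div f)) *
      (B $$ (i mod c, l) * B' $$ (l, j mod f)))"
    by (rule sum_div_mod)
  also have "\<dots> = (A * A') $$ (i div c, j div f) * (B * B') $$ (i mod c, j mod f)"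
    unfolding index_mult_mat_sum[OF A A' b(1,2)] index_mult_mat_sum[OF B B' b(3,4)] by (rule sum_product[symmetric])
  also have "\<dots> = kron (A * A') (B * B') $$ (i, j)"
    using ij assms by (auto simp: kron_def)
  finally show "(kron A B * kron A' B') $$ (i, j) = kron (A * A') (B * B') $$ (i, j)" .
qed (use assms in \<open>auto simp: kron_def\<close>)

lemma kron_one: "kron (1\<^sub>m n) (1\<^sub>m s) = 1\<^sub>m (n * s)"
proof (rule eq_matI)
  fix i j assume ij: "i < dim_row (1\<^sub>m (n * s))" "j < dim_col (1\<^sub>m (n * s))"
  then have "i = j \<longleftrightarrow> i div s = j div s \<and> i mod s = j mod s"
    by (metis div_mult_mod_eq)
  with ij show "kron (1\<^sub>m n) (1\<^sub>m s) $$ (i, j) = 1\<^sub>m (n * s) $$ (i, j)"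
    by (auto simp: kron_def div_less_of_less_mult mod_less_of_less_mult)
qed (auto simp: kron_def)

lemma kron_block_diag:
  assumes "A \<in> carrier_mat a b" "D \<in> carrier_mat c d" and B: "B \<in> carrier_mat r s"
  shows "kron (four_block_mat A (0\<^sub>m a d) (0\<^sub>m c b) D) B =
    four_block_mat (kron A B) (0\<^sub>m (a * r) (d * s)) (0\<^sub>m (c * r) (b * s)) (kron D B)"
proof (rule eq_matI)
  fix i j
  assume "i < dim_row (four_block_mat (kron A B) (0\<^sub>m (a * r) (d * s)) (0\<^sub>m (c * r) (b * s)) (kron D B))"
    "j < dim_col (four_block_mat (kron A B) (0\<^sub>m (a * r) (d * s)) (0\<^sub>m (c * r) (b * s)) (kron D B))"
  then have i: "i < (a + c) * r" and j: "j < (b + d) * s"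
    using assms by (auto simp: kron_def algebra_simps)
  have split: "(k div t < x \<longleftrightarrow> k < x * t) \<and> (\<not> k < x * t \<longrightarrow> (k - x * t) div t = k div t - x \<and> (k - x * t) mod t = k mod t)"
    if "k < (x + y) * t" for k t x y :: nat
  proof -
    have t: "t > 0" using that by (cases t) auto
    have "k = x * t + (k - x * t)" if "\<not> k < x * t" using that by simp
    then have "\<not> k < x * t \<Longrightarrow> k div t = x + (k - x * t) div t \<and> k mod t = (k - x * t) mod t"
      using t by (metis div_mult_self3 mod_mult_self3 add.commute less_irrefl)
    then show ?thesis
      using t by (auto simp: div_less_iff_less_mult)
  qed
  show "kron (four_block_mat A (0\<^sub>m a d) (0\<^sub>m c b) D) B $$ (i, j) =
    four_block_mat (kron A B) (0\<^sub>m (a * r) (d * s)) (0\<^sub>m (c * r) (b * s)) (kron D B) $$ (i, j)"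
  proof -
    have dims: "dim_row A = a" "dim_col A = b" "dim_row D = c" "dim_col D = d" "dim_row B = r" "dim_col B = s"
      using assms by auto
    have "i div r < a + c" "j div s < b + d" "i < a * r + c * r" "j < b * s + d * s"
      using div_less_of_less_mult[OF i] div_less_of_less_mult[OF j] i j by (simp_all add: distrib_right)
    moreover from this have "\<not> i div r < a \<Longrightarrow> i div r - a < c" "\<not> j div s < b \<Longrightarrow> j div s - b < d"
      by linarith+
    ultimately show ?thesis
      using i j split[OF i] split[OF j] unfolding kron_def four_block_mat_def Let_def
      by (cases "i < a * r"; cases "j < b * s") (auto simp: dims)
  qed
qed (use assms in \<open>auto simp: kron_def algebra_simps\<close>)

section \<open>The minimal index operator\<close>

lemma F_mat_carrier: "F_mat (Suc s) \<in> carrier_mat (Suc s) s"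
  unfolding F_mat_def by (rule carrier_matI) (auto simp: append_rows_def)

lemma K_mat_carrier: "K_mat (Suc s) \<in> carrier_mat (Suc s) s"
  unfolding K_mat_def by (rule carrier_matI) (auto simp: append_rows_def)

lemma F_mat_index: "i < Suc s \<Longrightarrow> j < s \<Longrightarrow> F_mat (Suc s) $$ (i, j) = (if i = j then 1 else 0)"
  by (auto simp: F_mat_def append_rows_def)

lemma K_mat_index: "i < Suc s \<Longrightarrow> j < s \<Longrightarrow> K_mat (Suc s) $$ (i, j) = (if i = Suc j then 1 else 0)"
  by (auto simp: K_mat_def append_rows_def)

text \<open>A vector indexed by pairs \<open>(k, l)\<close> with \<open>l < s\<close> stands for the polynomial vector
\<open>\<Sum>\<^sub>l v\<^sub>l x\<^sup>l\<close>; since \<open>F\<close> and \<open>K\<close> are the coefficient maps of the multiplications by \<open>1\<close> and by \<open>x\<close>, the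
matrix is that of \<open>v \<mapsto> (B\<^sub>1 + x B\<^sub>2) v\<close> from degree less than \<open>s\<close> to degree at most \<open>s\<close>.\<close>
definition toeplitz :: "nat \<Rightarrow> mat_pair \<Rightarrow> complex mat" where
  "toeplitz s B = kron (fst B) (F_mat (Suc s)) + kron (snd B) (K_mat (Suc s))"

lemma mat_pairsD:
  assumes "B \<in> mat_pairs m n"
  shows "fst B \<in> carrier_mat m n" "snd B \<in> carrier_mat m n"
  using assms by (auto simp: mat_pairs_def)

lemma toeplitz_carrier:
  assumes "B \<in> mat_pairs m n"
  shows "toeplitz s B \<in> carrier_mat (m * Suc s) (n * s)"
  unfolding toeplitz_def
  by (intro add_carrier_mat kron_carrier[OF mat_pairsD(2)[OF assms] K_mat_carrier])

lemma toeplitz_index: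
  assumes B: "B \<in> mat_pairs m n" and "i < m" "j < Suc s" "k < n" "l < s"
  shows "toeplitz s B $$ (i * Suc s + j, k * s + l) =
    (if j = l then fst B $$ (i, k) else 0) + (if j = Suc l then snd B $$ (i, k) else 0)"
proof -
  have dims: "dim_row (fst B) = m" "dim_col (fst B) = n" "dim_row (snd B) = m" "dim_col (snd B) = n"
    "dim_row (F_mat (Suc s)) = Suc s" "dim_col (F_mat (Suc s)) = s"
    "dim_row (K_mat (Suc s)) = Suc s" "dim_col (K_mat (Suc s)) = s"
    using mat_pairsD[OF B] F_mat_carrier[of s] K_mat_carrier[of s] by auto
  have less: "i * Suc s + j < m * Suc s" "k * s + l < n * s"
    by (rule mult_add_less[OF assms(2,3)], rule mult_add_less[OF assms(4,5)])
  have divs: "(i * Suc s + j) div Suc s = i" "(i * Suc s + j) mod Suc s = j"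
    "(k * s + l) div s = k" "(k * s + l) mod s = l"
    using assms by (simp_all add: div_nat_eqI del: mult_Suc_right)
  show ?thesis
    using assms less unfolding toeplitz_def kron_def
    by (simp add: dims divs F_mat_index K_mat_index del: mult_Suc_right)
qed

definition vec_of_fun :: "nat \<Rightarrow> nat \<Rightarrow> (nat \<Rightarrow> nat \<Rightarrow> complex) \<Rightarrow> complex vec" where
  "vec_of_fun n s g = vec (n * s) (\<lambda>a. g (a div s) (a mod s))"

lemma vec_of_fun_carrier [simp]: "vec_of_fun n s g \<in> carrier_vec (n * s)"
  by (simp add: vec_of_fun_def)

lemma vec_of_fun_index: "k < n \<Longrightarrow> l < s \<Longrightarrow> vec_of_fun n s g $ (k * s + l) = g k l"
  using mult_add_less[of k n l s] by (simp add: vec_of_fun_def div_nat_eqI)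

lemma double_index_vec_eqI:
  assumes "v \<in> carrier_vec (n * s)" "w \<in> carrier_vec (n * s)"
    and "\<And>k l. k < n \<Longrightarrow> l < s \<Longrightarrow> v $ (k * s + l) = w $ (k * s + l)"
  shows "v = w"
proof (rule eq_vecI)
  fix a assume "a < dim_vec w"
  then have "a < n * s" using assms by simp
  then show "v $ a = w $ a"
    using assms(3)[of "a div s" "a mod s"] div_less_of_less_mult[of a n s] mod_less_of_less_mult[of a n s]
    by (simp only: div_mult_mod_eq)
qed (use assms in auto)

lemma sum_double_index:
  "(\<Sum>a<n * s. f a) = (\<Sum>k<n. \<Sum>l<s. f (k * s + l))" for f :: "nat \<Rightarrow> complex"
  using sum_div_mod[of "\<lambda>k l. f (k * s + l)" s n] by simp

lemma toeplitz_mult_vec: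
  assumes B: "B \<in> mat_pairs m n" and z: "z \<in> carrier_vec (n * s)" and ij: "i < m" "j < Suc s"
  shows "(toeplitz s B *\<^sub>v z) $ (i * Suc s + j) =
    (if j < s then \<Sum>k<n. fst B $$ (i, k) * z $ (k * s + j) else 0) +
    (if 0 < j then \<Sum>k<n. snd B $$ (i, k) * z $ (k * s + (j - 1)) else 0)"
proof -
  have "(toeplitz s B *\<^sub>v z) $ (i * Suc s + j) =
      (\<Sum>k<n. \<Sum>l<s. toeplitz s B $$ (i * Suc s + j, k * s + l) * z $ (k * s + l))"
    unfolding index_mult_mat_vec_sum[OF toeplitz_carrier[OF B] z mult_add_less[OF ij]] sum_double_index ..
  also have "\<dots> = (\<Sum>k<n. (\<Sum>l<s. if j = l then fst B $$ (i, k) * z $ (k * s + l) else 0) +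
      (\<Sum>l<s. if j = Suc l then snd B $$ (i, k) * z $ (k * s + l) else 0))"
    unfolding sum.distrib[symmetric]
    by (intro sum.cong refl) (simp add: toeplitz_index[OF B ij] del: mult_Suc_right)
  also have "\<dots> = (\<Sum>k<n. (if j < s then fst B $$ (i, k) * z $ (k * s + j) else 0) +
      (if 0 < j then snd B $$ (i, k) * z $ (k * s + (j - 1)) else 0))"
  proof (intro sum.cong refl arg_cong2[where f = "(+)"])
    fix k
    have "(\<Sum>l<s. if j = Suc l then snd B $$ (i, k) * z $ (k * s + l) else 0) =
      (\<Sum>l<s. if l = j - 1 then if 0 < j then snd B $$ (i, k) * z $ (k * s + l) else 0 else 0)"
      by (intro sum.cong) auto
    then show "(\<Sum>l<s. if j = Suc l then snd B $$ (i, k) * z $ (k * s + l) else 0) =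
      (if 0 < j then snd B $$ (i, k) * z $ (k * s + (j - 1)) else 0)"
      using ij by auto
  qed auto
  finally show ?thesis by (simp add: sum.distrib)
qed

lemma toeplitz_transpose_mult_vec:
  assumes B: "B \<in> mat_pairs m n" and u: "u \<in> carrier_vec (m * Suc s)" and kl: "k < n" "l < s"
  shows "(transpose_mat (toeplitz s B) *\<^sub>v u) $ (k * s + l) =
    (\<Sum>i<m. fst B $$ (i, k) * u $ (i * Suc s + l) + snd B $$ (i, k) * u $ (i * Suc s + Suc l))"
proof -
  note T = toeplitz_carrier[OF B, of s]
  have "(transpose_mat (toeplitz s B) *\<^sub>v u) $ (k * s + l) =
      (\<Sum>a<m * Suc s. toeplitz s B $$ (a, k * s + l) * u $ a)"
    using index_mult_mat_vec_sum[OF _ u mult_add_less[OF kl], of "transpose_mat (toeplitz s B)"] T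
      mult_add_less[OF kl] by (simp del: mult_Suc_right)
  also have "\<dots> = (\<Sum>i<m. \<Sum>j<Suc s. toeplitz s B $$ (i * Suc s + j, k * s + l) * u $ (i * Suc s + j))"
    by (rule sum_double_index)
  also have "\<dots> = (\<Sum>i<m. (\<Sum>j<Suc s. if j = l then fst B $$ (i, k) * u $ (i * Suc s + j) else 0) +
      (\<Sum>j<Suc s. if j = Suc l then snd B $$ (i, k) * u $ (i * Suc s + j) else 0))"
    unfolding sum.distrib[symmetric]
    by (intro sum.cong refl) (simp add: toeplitz_index[OF B _ _ kl] del: mult_Suc_right)
  finally show ?thesis
    using kl by (simp add: sum.distrib del: mult_Suc_right sum.lessThan_Suc)
qed

lemma toeplitz_transform:
  assumes B: "B \<in> mat_pairs m n" and R: "R \<in> carrier_mat m m" and S: "S \<in> carrier_mat n n"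
  shows "toeplitz s (R * fst B * S, R * snd B * S) =
    kron R (1\<^sub>m (Suc s)) * toeplitz s B * kron S (1\<^sub>m s)"
proof -
  have one: "kron (R * X * S) Y = kron R (1\<^sub>m (Suc s)) * kron X Y * kron S (1\<^sub>m s)"
    if "X \<in> carrier_mat m n" "Y \<in> carrier_mat (Suc s) s" for X Y
    using that R S kron_mult[of R m m "1\<^sub>m (Suc s)" "Suc s" "Suc s" X n Y s]
      kron_mult[of "R * X" m n Y "Suc s" s S n "1\<^sub>m s" s] by simp
  note c = mat_pairsD[OF B] F_mat_carrier[of s] K_mat_carrier[of s]
  have X: "kron (fst B) (F_mat (Suc s)) \<in> carrier_mat (m * Suc s) (n * s)"
    "kron (snd B) (K_mat (Suc s)) \<in> carrier_mat (m * Suc s) (n * s)"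
    by (rule kron_carrier[OF c(1,3)], rule kron_carrier[OF c(2,4)])
  have P: "kron R (1\<^sub>m (Suc s)) \<in> carrier_mat (m * Suc s) (m * Suc s)"
    by (rule kron_carrier[OF R one_carrier_mat])
  have Q: "kron S (1\<^sub>m s) \<in> carrier_mat (n * s) (n * s)"
    by (rule kron_carrier[OF S one_carrier_mat])
  show ?thesis
    unfolding toeplitz_def fst_conv snd_conv one[OF c(1,3)] one[OF c(2,4)]
      mult_add_distrib_mat[OF P X]
      add_mult_distrib_mat[OF mult_carrier_mat[OF P X(1)] mult_carrier_mat[OF P X(2)] Q] ..
qed

lemma invertible_matE:
  assumes "invertible_mat R" "R \<in> carrier_mat n n"
  obtains R' where "R' \<in> carrier_mat n n" "R * R' = 1\<^sub>m n" "R' * R = 1\<^sub>m n"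
proof -
  obtain R' where R': "R * R' = 1\<^sub>m (dim_row R)" "R' * R = 1\<^sub>m (dim_row R')"
    using assms(1) by (auto simp: invertible_mat_def inverts_mat_def)
  have "dim_row R' = n" "dim_col R' = n"
    using R' assms(2) by (metis carrier_matD index_mult_mat(2,3) index_one_mat(2,3))+
  then show ?thesis
    using that[of R'] R' assms(2) by auto
qed

lemma toeplitz_nullity_equivalent:
  assumes "pair_equivalent m n A B"
  shows "nullity_le (toeplitz s B) p \<Longrightarrow> nullity_le (toeplitz s A) p"
    and "nullity_ge (toeplitz s B) p \<Longrightarrow> nullity_ge (toeplitz s A) p"
proof -
  obtain R S where RS: "R \<in> carrier_mat m m" "S \<in> carrier_mat n n" "invertible_mat R" "invertible_mat S"
    and B: "B = (R * fst A * S, R * snd A * S)" and A: "A \<in> mat_pairs m n"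
    using assms by (auto simp: pair_equivalent_def prod_eq_iff)
  obtain R' where R': "R' \<in> carrier_mat m m" "R' * R = 1\<^sub>m m"
    using invertible_matE[OF RS(3,1)] by blast
  obtain S' where S': "S' \<in> carrier_mat n n" "S * S' = 1\<^sub>m n" "S' * S = 1\<^sub>m n"
    using invertible_matE[OF RS(4,2)] by blast
  note c = toeplitz_carrier[OF A, of s] kron_carrier[OF RS(1) one_carrier_mat[of "Suc s"]]
    kron_carrier[OF R'(1) one_carrier_mat[of "Suc s"]]
    kron_carrier[OF RS(2) one_carrier_mat[of s]] kron_carrier[OF S'(1) one_carrier_mat[of s]]
  have inv: "kron R' (1\<^sub>m (Suc s)) * kron R (1\<^sub>m (Suc s)) = 1\<^sub>m (m * Suc s)"
    "kron S (1\<^sub>m s) * kron S' (1\<^sub>m s) = 1\<^sub>m (n * s)" "kron S' (1\<^sub>m s) * kron S (1\<^sub>m s) = 1\<^sub>m (n * s)"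
    using kron_mult[OF R'(1) one_carrier_mat RS(1) one_carrier_mat[of "Suc s"]]
      kron_mult[OF RS(2) one_carrier_mat S'(1) one_carrier_mat[of s]]
      kron_mult[OF S'(1) one_carrier_mat RS(2) one_carrier_mat[of s]]
    by (simp_all add: R' S' kron_one del: mult_Suc_right)
  note T = toeplitz_transform[OF A RS(1,2), of s, folded B]
  show "nullity_le (toeplitz s B) p \<Longrightarrow> nullity_le (toeplitz s A) p"
    unfolding T by (rule nullity_le_transform[OF c(1,2,4,5) inv(2)])
  show "nullity_ge (toeplitz s B) p \<Longrightarrow> nullity_ge (toeplitz s A) p"
    unfolding T by (rule nullity_ge_transform[OF c(1,2,3) inv(1) c(4,5) inv(3)])
qed

subsection \<open>Kernels of the operator\<close>

lemma nullity_le_0I: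
  assumes "M \<in> carrier_mat a b" "\<And>z. z \<in> carrier_vec b \<Longrightarrow> M *\<^sub>v z = 0\<^sub>v a \<Longrightarrow> z = 0\<^sub>v b"
  shows "nullity_le M 0"
  by (rule nullity_leI[OF assms(1), of "0\<^sub>m 0 b"]) (auto intro: assms(2))

lemma toeplitz_kernel_eqs:
  assumes B: "B \<in> mat_pairs m n" and z: "z \<in> carrier_vec (n * s)"
    and Tz: "toeplitz s B *\<^sub>v z = 0\<^sub>v (m * Suc s)" and ij: "i < m" "j < Suc s"
  shows "(if j < s then \<Sum>k<n. fst B $$ (i, k) * z $ (k * s + j) else 0) +
    (if 0 < j then \<Sum>k<n. snd B $$ (i, k) * z $ (k * s + (j - 1)) else 0) = 0"
  unfolding toeplitz_mult_vec[OF B z ij, symmetric] Tz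
  using mult_add_less[OF ij] by (simp del: mult_Suc_right)

text \<open>The coefficients vanish one after the other, from the lowest degree upwards.\<close>
lemma toeplitz_injective_fst:
  assumes B: "B \<in> mat_pairs m n"
    and inj: "\<And>x. x \<in> carrier_vec n \<Longrightarrow> fst B *\<^sub>v x = 0\<^sub>v m \<Longrightarrow> x = 0\<^sub>v n"
  shows "nullity_le (toeplitz s B) 0"
proof (rule nullity_le_0I[OF toeplitz_carrier[OF B]])
  fix z assume z: "z \<in> carrier_vec (n * s)" and Tz: "toeplitz s B *\<^sub>v z = 0\<^sub>v (m * Suc s)"
  have "\<forall>k<n. z $ (k * s + j) = 0" if "j < s" for j
    using that
  proof (induction j rule: less_induct)
    case (less j)
    define x where "x = vec n (\<lambda>k. z $ (k * s + j))"
    have "fst B *\<^sub>v x = 0\<^sub>v m"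
    proof (rule eq_vecI)
      fix i assume "i < dim_vec (0\<^sub>v m)"
      then have i: "i < m" by simp
      have "(fst B *\<^sub>v x) $ i = (\<Sum>k<n. fst B $$ (i, k) * z $ (k * s + j))"
        using index_mult_mat_vec_sum[OF mat_pairsD(1)[OF B] _ i, of x] by (simp add: x_def)
      also have "\<dots> = 0"
        using toeplitz_kernel_eqs[OF B z Tz i, of j] less.prems less.IH[of "j - 1"] by (cases "0 < j") auto
      finally show "(fst B *\<^sub>v x) $ i = 0\<^sub>v m $ i" using i by simp
    qed (use mat_pairsD[OF B] in auto)
    then have "x = 0\<^sub>v n" by (intro inj) (auto simp: x_def)
    then have "x $ k = 0" if "k < n" for k using that by simp
    then show ?case by (simp add: x_def)
  qed
  then show "z = 0\<^sub>v (n * s)"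
    using z mult_add_less by (intro double_index_vec_eqI) auto
qed

text \<open>The coefficients vanish one after the other, from the highest degree downwards.\<close>
lemma toeplitz_injective_snd:
  assumes B: "B \<in> mat_pairs m n"
    and inj: "\<And>x. x \<in> carrier_vec n \<Longrightarrow> snd B *\<^sub>v x = 0\<^sub>v m \<Longrightarrow> x = 0\<^sub>v n"
  shows "nullity_le (toeplitz s B) 0"
proof (rule nullity_le_0I[OF toeplitz_carrier[OF B]])
  fix z assume z: "z \<in> carrier_vec (n * s)" and Tz: "toeplitz s B *\<^sub>v z = 0\<^sub>v (m * Suc s)"
  have "\<forall>k<n. z $ (k * s + (s - Suc j)) = 0" if "j < s" for j
    using that
  proof (induction j rule: less_induct)
    case (less j)
    define x where "x = vec n (\<lambda>k. z $ (k * s + (s - Suc j)))"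
    have "snd B *\<^sub>v x = 0\<^sub>v m"
    proof (rule eq_vecI)
      fix i assume "i < dim_vec (0\<^sub>v m)"
      then have i: "i < m" by simp
      have "(snd B *\<^sub>v x) $ i = (\<Sum>k<n. snd B $$ (i, k) * z $ (k * s + (s - Suc j)))"
        using index_mult_mat_vec_sum[OF mat_pairsD(2)[OF B] _ i, of x] by (simp add: x_def)
      also have "\<dots> = 0"
      proof (cases j)
        case 0
        then show ?thesis
          using toeplitz_kernel_eqs[OF B z Tz i, of s] less.prems by simp
      next
        case (Suc j')
        then have "\<forall>k<n. z $ (k * s + (s - Suc j')) = 0"
          using less by simp
        moreover have "s - j - 1 = s - Suc j" "s - j = s - Suc j'" "s - j < s" "0 < s - j"
          using Suc less.prems by auto
        ultimately show ?thesis
          using toeplitz_kernel_eqs[OF B z Tz i, of "s - j"] by simp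
      qed
      finally show "(snd B *\<^sub>v x) $ i = 0\<^sub>v m $ i" using i by simp
    qed (use mat_pairsD[OF B] in auto)
    then have "x = 0\<^sub>v n" by (intro inj) (auto simp: x_def)
    then have "x $ k = 0" if "k < n" for k using that by simp
    then show ?case by (simp add: x_def)
  qed
  from this[of "s - Suc l" for l] have "z $ (k * s + l) = 0" if "k < n" "l < s" for k l
    using that by (metis Suc_diff_Suc diff_Suc_less diff_diff_cancel less_imp_le less_nat_zero_code not_gr_zero Suc_leI)
  then show "z = 0\<^sub>v (n * s)"
    using z mult_add_less by (intro double_index_vec_eqI) auto
qed

section \<open>Perturbing a pair inside its class\<close>

text \<open>Every direction is the velocity at \<open>A\<close> of a curve inside \<open>P\<close>. The curves are total and lie in \<open>P\<close> at every
parameter; for a curve given only near \<open>0\<close> this costs nothing, as it may be continued by the constant \<open>A\<close>.\<close>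
definition flexible :: "nat \<Rightarrow> nat \<Rightarrow> mat_pair \<Rightarrow> (mat_pair \<Rightarrow> bool) \<Rightarrow> bool" where
  "flexible m n A P \<longleftrightarrow> (\<forall>D1 \<in> carrier_mat m n. \<forall>D2 \<in> carrier_mat m n. \<exists>\<gamma>1 \<gamma>2.
     mat_DERIV m n \<gamma>1 D1 \<and> mat_DERIV m n \<gamma>2 D2 \<and> (\<gamma>1 0, \<gamma>2 0) = A \<and> (\<forall>t. P (\<gamma>1 t, \<gamma>2 t)))"

text \<open>A kernel vector whose \<open>s\<close> coefficient vectors are linearly independent; \<open>X\<close> is a left inverse of the
matrix that they form.\<close>
definition kernel_frame :: "nat \<Rightarrow> nat \<Rightarrow> nat \<Rightarrow> mat_pair \<Rightarrow> bool" where
  "kernel_frame s m n B \<longleftrightarrow> (\<exists>v \<in> carrier_vec (n * s). \<exists>X \<in> carrier_mat s n.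
     toeplitz s B *\<^sub>v v = 0\<^sub>v (m * Suc s) \<and>
     (\<forall>j<s. \<forall>l<s. (\<Sum>k<n. X $$ (j, k) * v $ (k * s + l)) = (if j = l then 1 else 0)))"

definition nonzero_cokernel :: "nat \<Rightarrow> nat \<Rightarrow> nat \<Rightarrow> mat_pair \<Rightarrow> bool" where
  "nonzero_cokernel s m n B \<longleftrightarrow> (\<exists>u \<in> carrier_vec (m * Suc s). u \<noteq> 0\<^sub>v (m * Suc s) \<and>
     transpose_mat (toeplitz s B) *\<^sub>v u = 0\<^sub>v (n * s))"

lemma mat_DERIV_kron:
  assumes F: "mat_DERIV a b F F'" and B: "B \<in> carrier_mat c d"
  shows "mat_DERIV (a * c) (b * d) (\<lambda>t. kron (F t) B) (kron F' B)"
proof -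
  have "((\<lambda>t. kron (F t) B $$ (i, j)) has_field_derivative kron F' B $$ (i, j)) (at 0)"
    if ij: "i < a * c" "j < b * d" for i j
  proof -
    have "dim_row B = c" "dim_col B = d" using B by auto
    then show ?thesis
      using ij F div_less_of_less_mult[OF ij(1)] div_less_of_less_mult[OF ij(2)]
      by (auto simp: kron_def mat_DERIV_dim[OF F] mat_DERIV_def intro!: DERIV_cmult_right)
  qed
  then show ?thesis
    unfolding mat_DERIV_def using kron_carrier[OF mat_DERIV_carrier(1)[OF F] B] kron_carrier[OF mat_DERIV_carrier(2)[OF F] B]
    by auto
qed

lemma mat_DERIV_toeplitz:
  assumes "mat_DERIV m n F F'" "mat_DERIV m n G G'"
  shows "mat_DERIV (m * Suc s) (n * s) (\<lambda>t. toeplitz s (F t, G t)) (toeplitz s (F', G'))"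
  unfolding toeplitz_def fst_conv snd_conv
  by (intro mat_DERIV_add mat_DERIV_kron assms F_mat_carrier K_mat_carrier)

text \<open>Because the coefficients of \<open>v\<close> are independent, a pair whose single nonzero row is a row of the
left inverse \<open>X\<close> selects one coefficient of \<open>v\<close> and places it in a prescribed row. The first
component reaches the degrees below \<open>s\<close>, the second one the degree \<open>s\<close>.\<close>
lemma toeplitz_hits_unit_vec:
  assumes s: "1 \<le> s" and v: "v \<in> carrier_vec (n * s)" and X: "X \<in> carrier_mat s n"
    and Xv: "\<And>j l. j < s \<Longrightarrow> l < s \<Longrightarrow> (\<Sum>k<n. X $$ (j, k) * v $ (k * s + l)) = (if j = l then 1 else 0)"
    and a: "a < m * Suc s"
  shows "\<exists>D \<in> mat_pairs m n. toeplitz s D *\<^sub>v v = unit_vec (m * Suc s) a"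
proof -
  define i0 j0 where "i0 = a div Suc s" and "j0 = a mod Suc s"
  have a_eq: "a = i0 * Suc s + j0" by (simp add: i0_def j0_def del: mult_Suc_right)
  have i0: "i0 < m" and j0: "j0 < Suc s"
    using div_less_of_less_mult[OF a] by (auto simp: i0_def j0_def)
  define Z where "Z j = mat m n (\<lambda>(i, k). if i = i0 then X $$ (j, k) else 0)" for j
  have Z: "(\<Sum>k<n. Z j $$ (i, k) * v $ (k * s + l)) = (if i = i0 \<and> j = l then 1 else 0)"
    if "i < m" "j < s" "l < s" for i j l
  proof -
    have "(\<Sum>k<n. Z j $$ (i, k) * v $ (k * s + l)) =
      (if i = i0 then \<Sum>k<n. X $$ (j, k) * v $ (k * s + l) else 0)"
      using that by (simp add: Z_def)
    then show ?thesis using Xv that by simp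
  qed
  have Zc: "Z j \<in> carrier_mat m n" for j by (simp add: Z_def)
  define D where "D = (if j0 < s then (Z j0, 0\<^sub>m m n) else (0\<^sub>m m n, Z (s - 1)))"
  have D: "D \<in> mat_pairs m n" using Zc by (simp add: D_def mat_pairs_def)
  have "toeplitz s D *\<^sub>v v = unit_vec (m * Suc s) a"
  proof (rule double_index_vec_eqI)
    fix i j assume ij: "i < m" "j < Suc s"
    have "(toeplitz s D *\<^sub>v v) $ (i * Suc s + j) = (if i = i0 \<and> j = j0 then 1 else 0)"
    proof (cases "j0 < s")
      case True
      have "(\<Sum>k<n. snd D $$ (i, k) * x k) = 0" for x
        using True ij by (simp add: D_def)
      moreover have "fst D = Z j0" using True by (simp add: D_def)
      ultimately show ?thesis
        unfolding toeplitz_mult_vec[OF D v ij] using Z[OF ij(1) True, of j] True by auto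
    next
      case False
      have "(\<Sum>k<n. fst D $$ (i, k) * x k) = 0" for x
        using False ij by (simp add: D_def)
      moreover have "snd D = Z (s - 1)" using False by (simp add: D_def)
      moreover have "0 < j \<Longrightarrow> s - 1 = j - 1 \<longleftrightarrow> j = s" using s by auto
      ultimately show ?thesis
        unfolding toeplitz_mult_vec[OF D v ij] using Z[OF ij(1), of "s - 1" "j - 1"] ij j0 s False
        by (cases "0 < j") auto
    qed
    moreover have "i * Suc s + j = a \<longleftrightarrow> i = i0 \<and> j = j0"
    proof
      assume "i * Suc s + j = a"
      then have "(i * Suc s + j) div Suc s = i0" "(i * Suc s + j) mod Suc s = j0"
        by (simp_all add: i0_def j0_def del: mult_Suc_right)
      then show "i = i0 \<and> j = j0" using ij by (simp add: div_nat_eqI del: mult_Suc_right)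
    qed (simp add: a_eq)
    ultimately show "(toeplitz s D *\<^sub>v v) $ (i * Suc s + j) = unit_vec (m * Suc s) a $ (i * Suc s + j)"
      using mult_add_less[OF ij] a by (simp add: unit_vec_def del: mult_Suc_right)
  qed (use mult_mat_vec_carrier[OF toeplitz_carrier[OF D] v] in auto)
  then show ?thesis using D by blast
qed

text \<open>A functional \<open>u\<close> that vanishes on the image of \<open>toeplitz s A\<close> has a nonzero entry, and some direction \<open>D\<close> sends
the kernel vector to the unit vector at this entry. Then \<open>u \<bullet> toeplitz s D v \<noteq> 0\<close>, against
\<open>constant_rank_tangent\<close>.\<close>
lemma flexible_toeplitz_contradiction:
  assumes s: "1 \<le> s" and flex: "flexible m n A P"
    and ge: "\<And>B. P B \<Longrightarrow> nullity_ge (toeplitz s B) p"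
    and le: "nullity_le (toeplitz s A) p"
    and frame: "kernel_frame s m n A" and coker: "nonzero_cokernel s m n A"
  shows False
proof -
  obtain v X where v: "v \<in> carrier_vec (n * s)" "toeplitz s A *\<^sub>v v = 0\<^sub>v (m * Suc s)"
    and X: "X \<in> carrier_mat s n"
    and Xv: "\<And>j l. j < s \<Longrightarrow> l < s \<Longrightarrow> (\<Sum>k<n. X $$ (j, k) * v $ (k * s + l)) = (if j = l then 1 else 0)"
    using frame unfolding kernel_frame_def by blast
  obtain u where u: "u \<in> carrier_vec (m * Suc s)" "u \<noteq> 0\<^sub>v (m * Suc s)"
    "transpose_mat (toeplitz s A) *\<^sub>v u = 0\<^sub>v (n * s)"
    using coker unfolding nonzero_cokernel_def by blast
  obtain a where a: "a < m * Suc s" "u $ a \<noteq> 0"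
    using u(1,2) by (metis carrier_vecD eq_vecI index_zero_vec)
  obtain D where D: "D \<in> mat_pairs m n" "toeplitz s D *\<^sub>v v = unit_vec (m * Suc s) a"
    using toeplitz_hits_unit_vec[OF s v(1) X Xv a(1)] by blast
  obtain \<gamma>1 \<gamma>2 where \<gamma>: "mat_DERIV m n \<gamma>1 (fst D)" "mat_DERIV m n \<gamma>2 (snd D)"
    "(\<gamma>1 0, \<gamma>2 0) = A" "\<And>t. P (\<gamma>1 t, \<gamma>2 t)"
    using flex mat_pairsD[OF D(1)] unfolding flexible_def by blast
  have "u \<bullet> (toeplitz s (fst D, snd D) *\<^sub>v v) = 0"
    using constant_rank_tangent[OF mat_DERIV_toeplitz[OF \<gamma>(1,2)], of s p u v] ge[OF \<gamma>(4)] le u v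
    unfolding \<gamma>(3) by (simp del: mult_Suc_right)
  then have "u \<bullet> unit_vec (m * Suc s) a = 0"
    using D(2) by simp
  then show False
    using scalar_prod_right_unit[OF a(1)] a by simp
qed

section \<open>Block sums of pairs\<close>

definition pair_sum :: "mat_pair list \<Rightarrow> mat_pair" where
  "pair_sum bs = (diag_block_mat (map fst bs), diag_block_mat (map snd bs))"

text \<open>With the sizes as arguments the off-diagonal zero blocks have the shape that the lemmas on block
matrices expect.\<close>
definition pair_oplus :: "nat \<Rightarrow> nat \<Rightarrow> nat \<Rightarrow> nat \<Rightarrow> mat_pair \<Rightarrow> mat_pair \<Rightarrow> mat_pair" where
  "pair_oplus a b c d B C = (four_block_mat (fst B) (0\<^sub>m a d) (0\<^sub>m c b) (fst C),
     four_block_mat (snd B) (0\<^sub>m a d) (0\<^sub>m c b) (snd C))"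

lemma pair_oplus_carrier:
  assumes "B \<in> mat_pairs a b" "C \<in> mat_pairs c d"
  shows "pair_oplus a b c d B C \<in> mat_pairs (a + c) (b + d)"
  using assms by (auto simp: pair_oplus_def mat_pairs_def)

lemma pair_sum_Nil: "pair_sum [] = (0\<^sub>m 0 0, 0\<^sub>m 0 0)"
  by (simp add: pair_sum_def)

lemma pair_sum_Cons:
  assumes "B \<in> mat_pairs a b" "pair_sum bs \<in> mat_pairs c d"
  shows "pair_sum (B # bs) = pair_oplus a b c d B (pair_sum bs)"
  using assms by (auto simp: pair_oplus_def mat_pairs_def pair_sum_def Let_def)

lemma toeplitz_oplus:
  assumes "B \<in> mat_pairs a b" "C \<in> mat_pairs c d"
  shows "toeplitz s (pair_oplus a b c d B C) = four_block_mat (toeplitz s B)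
    (0\<^sub>m (a * Suc s) (d * s)) (0\<^sub>m (c * Suc s) (b * s)) (toeplitz s C)"
proof -
  note c = mat_pairsD[OF assms(1)] mat_pairsD[OF assms(2)]
  have "kron X (F_mat (Suc s)) \<in> carrier_mat (p * Suc s) (q * s)" "kron X (K_mat (Suc s)) \<in> carrier_mat (p * Suc s) (q * s)"
    if "X \<in> carrier_mat p q" for X p q
    using that by (auto intro!: kron_carrier F_mat_carrier K_mat_carrier simp del: mult_Suc_right)
  note k = this
  show ?thesis
    unfolding toeplitz_def pair_oplus_def fst_conv snd_conv
      kron_block_diag[OF c(1,3) F_mat_carrier] kron_block_diag[OF c(2,4) K_mat_carrier]
    by (subst add_four_block_mat[OF k(1)[OF c(1)] zero_carrier_mat zero_carrier_mat k(1)[OF c(3)]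
      k(2)[OF c(2)] zero_carrier_mat zero_carrier_mat k(2)[OF c(4)]]) simp
qed

lemma kernel_frame_oplus:
  assumes B: "B \<in> mat_pairs a b" and C: "C \<in> mat_pairs c d"
    and "kernel_frame s a b B \<or> kernel_frame s c d C"
  shows "kernel_frame s (a + c) (b + d) (pair_oplus a b c d B C)"
  using assms(3)
proof
  have idx: "(k * s + l < b * s) = (k < b)" if "l < s" for k l :: nat
  proof
    assume "k * s + l < b * s" 
    then show "k < b" using div_less_of_less_mult[of "k * s + l" b s] that by (simp add: div_nat_eqI)
  qed (use mult_add_less that in auto)
  {
    assume "kernel_frame s a b B"
    then obtain v X where v: "v \<in> carrier_vec (b * s)" "toeplitz s B *\<^sub>v v = 0\<^sub>v (a * Suc s)"
      and X: "X \<in> carrier_mat s b"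
      and Xv: "\<And>j l. j < s \<Longrightarrow> l < s \<Longrightarrow> (\<Sum>k<b. X $$ (j, k) * v $ (k * s + l)) = (if j = l then 1 else 0)"
      unfolding kernel_frame_def by blast
    define w where "w = v @\<^sub>v 0\<^sub>v (d * s)"
    define Y where "Y = mat s (b + d) (\<lambda>(j, k). if k < b then X $$ (j, k) else 0)"
    have "w \<in> carrier_vec ((b + d) * s)" using v by (auto simp: w_def distrib_right)
    moreover have "Y \<in> carrier_mat s (b + d)" by (simp add: Y_def)
    moreover have "toeplitz s (pair_oplus a b c d B C) *\<^sub>v w = 0\<^sub>v ((a + c) * Suc s)"
      unfolding toeplitz_oplus[OF B C] w_def distrib_right
        block_diag_mult_vec_eq_zero[OF toeplitz_carrier[OF B] toeplitz_carrier[OF C] v(1) zero_carrier_vec]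
      using v mult_zero_vec[OF toeplitz_carrier[OF C, of s]] by simp
    moreover have "(\<Sum>k<b + d. Y $$ (j, k) * w $ (k * s + l)) = (if j = l then 1 else 0)"
      if "j < s" "l < s" for j l
    proof -
      have "(\<Sum>k<b + d. Y $$ (j, k) * w $ (k * s + l)) = (\<Sum>k<b. X $$ (j, k) * v $ (k * s + l))"
      proof (rule sum.mono_neutral_cong_right)
        fix k assume "k \<in> {..<b}"
        then show "Y $$ (j, k) * w $ (k * s + l) = X $$ (j, k) * v $ (k * s + l)"
          using that v mult_add_less[of k b l s] by (simp add: Y_def w_def)
      qed (use that in \<open>auto simp: Y_def\<close>)
      then show ?thesis using Xv that by simp
    qed
    ultimately show ?thesis unfolding kernel_frame_def by blast
  next
    assume "kernel_frame s c d C"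
    then obtain v X where v: "v \<in> carrier_vec (d * s)" "toeplitz s C *\<^sub>v v = 0\<^sub>v (c * Suc s)"
      and X: "X \<in> carrier_mat s d"
      and Xv: "\<And>j l. j < s \<Longrightarrow> l < s \<Longrightarrow> (\<Sum>k<d. X $$ (j, k) * v $ (k * s + l)) = (if j = l then 1 else 0)"
      unfolding kernel_frame_def by blast
    define w where "w = 0\<^sub>v (b * s) @\<^sub>v v"
    define Y where "Y = mat s (b + d) (\<lambda>(j, k). if k < b then 0 else X $$ (j, k - b))"
    have "w \<in> carrier_vec ((b + d) * s)" using v by (auto simp: w_def distrib_right)
    moreover have "Y \<in> carrier_mat s (b + d)" by (simp add: Y_def)
    moreover have "toeplitz s (pair_oplus a b c d B C) *\<^sub>v w = 0\<^sub>v ((a + c) * Suc s)"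
      unfolding toeplitz_oplus[OF B C] w_def distrib_right
        block_diag_mult_vec_eq_zero[OF toeplitz_carrier[OF B] toeplitz_carrier[OF C] zero_carrier_vec v(1)]
      using v mult_zero_vec[OF toeplitz_carrier[OF B, of s]] by simp
    moreover have "(\<Sum>k<b + d. Y $$ (j, k) * w $ (k * s + l)) = (if j = l then 1 else 0)"
      if "j < s" "l < s" for j l
    proof -
      have "(\<Sum>k<b + d. Y $$ (j, k) * w $ (k * s + l)) = (\<Sum>k = b..<b + d. Y $$ (j, k) * w $ (k * s + l))"
        by (rule sum.mono_neutral_right) (use that in \<open>auto simp: Y_def\<close>)
      also have "\<dots> = (\<Sum>k<d. Y $$ (j, b + k) * w $ ((b + k) * s + l))"
        using sum.shift_bounds_nat_ivl[of "\<lambda>k. Y $$ (j, k) * w $ (k * s + l)" 0 b d]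
        by (simp add: lessThan_atLeast0 add.commute)
      also have "\<dots> = (\<Sum>k<d. X $$ (j, k) * v $ (k * s + l))"
        using that v mult_add_less[of _ d l s] by (intro sum.cong) (auto simp: Y_def w_def distrib_right)
      finally show ?thesis using Xv that by simp
    qed
    ultimately show ?thesis unfolding kernel_frame_def by blast
  }
qed

lemma nonzero_cokernel_oplus:
  assumes B: "B \<in> mat_pairs a b" and C: "C \<in> mat_pairs c d"
    and "nonzero_cokernel s a b B \<or> nonzero_cokernel s c d C"
  shows "nonzero_cokernel s (a + c) (b + d) (pair_oplus a b c d B C)"
proof -
  note TB = toeplitz_carrier[OF B, of s] and TC = toeplitz_carrier[OF C, of s]
  have tB: "transpose_mat (toeplitz s B) \<in> carrier_mat (b * s) (a * Suc s)"
    and tC: "transpose_mat (toeplitz s C) \<in> carrier_mat (d * s) (c * Suc s)"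
    using TB TC by auto
  have T: "transpose_mat (toeplitz s (pair_oplus a b c d B C)) = four_block_mat (transpose_mat (toeplitz s B))
    (0\<^sub>m (b * s) (c * Suc s)) (0\<^sub>m (d * s) (a * Suc s)) (transpose_mat (toeplitz s C))"
    unfolding toeplitz_oplus[OF B C]
    by (subst transpose_four_block_mat[OF TB zero_carrier_mat zero_carrier_mat TC]) simp
  have *: "nonzero_cokernel s (a + c) (b + d) (pair_oplus a b c d B C)"
    if "u \<in> carrier_vec (a * Suc s)" "w \<in> carrier_vec (c * Suc s)"
      "transpose_mat (toeplitz s B) *\<^sub>v u = 0\<^sub>v (b * s)" "transpose_mat (toeplitz s C) *\<^sub>v w = 0\<^sub>v (d * s)"
      "u \<noteq> 0\<^sub>v (a * Suc s) \<or> w \<noteq> 0\<^sub>v (c * Suc s)" for u w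
  proof -
    have "u @\<^sub>v w \<in> carrier_vec ((a + c) * Suc s)"
      using that unfolding distrib_right by (intro append_carrier_vec)
    moreover have "u @\<^sub>v w \<noteq> 0\<^sub>v ((a + c) * Suc s)"
      unfolding distrib_right append_vec_eq_zero[OF that(1,2)] using that by auto
    moreover have "transpose_mat (toeplitz s (pair_oplus a b c d B C)) *\<^sub>v (u @\<^sub>v w) = 0\<^sub>v ((b + d) * s)"
      unfolding T distrib_right block_diag_mult_vec_eq_zero[OF tB tC that(1,2)] using that by auto
    ultimately show ?thesis unfolding nonzero_cokernel_def by blast
  qed
  from assms(3) show ?thesis
  proof
    assume "nonzero_cokernel s a b B"
    then show ?thesis
      unfolding nonzero_cokernel_def[of s a b] using *[OF _ zero_carrier_vec _ mult_zero_vec[OF tC]] by blast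
  next
    assume "nonzero_cokernel s c d C"
    then show ?thesis
      unfolding nonzero_cokernel_def[of s c d] using *[OF zero_carrier_vec _ mult_zero_vec[OF tB]] by blast
  qed
qed

lemma pair_sum_carrier:
  assumes "\<And>y. y \<in> set ys \<Longrightarrow> g y \<in> mat_pairs (r y) (c y)"
  shows "pair_sum (map g ys) \<in> mat_pairs (sum_list (map r ys)) (sum_list (map c ys))"
  using assms
proof (induction ys)
  case Nil
  then show ?case by (simp add: pair_sum_Nil mat_pairs_def)
next
  case (Cons y ys)
  then have y: "g y \<in> mat_pairs (r y) (c y)"
    and ys: "pair_sum (map g ys) \<in> mat_pairs (sum_list (map r ys)) (sum_list (map c ys))" by auto
  show ?case
    using pair_oplus_carrier[OF y ys] by (simp add: pair_sum_Cons[OF y ys])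
qed

lemma nullity_le_pair_sum:
  assumes "\<And>y. y \<in> set ys \<Longrightarrow> g y \<in> mat_pairs (r y) (c y)"
    and "\<And>y. y \<in> set ys \<Longrightarrow> nullity_le (toeplitz s (g y)) (w y)"
  shows "nullity_le (toeplitz s (pair_sum (map g ys))) (sum_list (map w ys))"
  using assms
proof (induction ys)
  case Nil
  have "toeplitz s (pair_sum []) \<in> carrier_mat 0 0"
    using toeplitz_carrier[of "pair_sum []" 0 0 s] by (simp add: pair_sum_Nil mat_pairs_def)
  then show ?case by (auto intro!: nullity_le_0I)
next
  case (Cons y ys)
  then have y: "g y \<in> mat_pairs (r y) (c y)" by simp
  have ys: "pair_sum (map g ys) \<in> mat_pairs (sum_list (map r ys)) (sum_list (map c ys))"
    using Cons.prems by (intro pair_sum_carrier) auto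
  show ?case
    using nullity_le_block_diag[OF toeplitz_carrier[OF y, of s] toeplitz_carrier[OF ys, of s]] Cons
    by (simp add: pair_sum_Cons[OF y ys] toeplitz_oplus[OF y ys] del: mult_Suc_right)
qed

lemma nullity_ge_pair_sum:
  assumes "\<And>y. y \<in> set ys \<Longrightarrow> g y \<in> mat_pairs (r y) (c y)"
    and "\<And>y. y \<in> set ys \<Longrightarrow> nullity_ge (toeplitz s (g y)) (w y)"
  shows "nullity_ge (toeplitz s (pair_sum (map g ys))) (sum_list (map w ys))"
  using assms
proof (induction ys)
  case Nil
  then show ?case by (simp add: nullity_ge_0)
next
  case (Cons y ys)
  then have y: "g y \<in> mat_pairs (r y) (c y)" by simp
  have ys: "pair_sum (map g ys) \<in> mat_pairs (sum_list (map r ys)) (sum_list (map c ys))"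
    using Cons.prems by (intro pair_sum_carrier) auto
  show ?case
    using nullity_ge_block_diag[OF toeplitz_carrier[OF y, of s] toeplitz_carrier[OF ys, of s]] Cons
    by (simp add: pair_sum_Cons[OF y ys] toeplitz_oplus[OF y ys] del: mult_Suc_right)
qed

text \<open>A property that passes from either summand to the sum of two pairs passes from one member of a
list to the sum over the list.\<close>
lemma pair_sum_inherit:
  assumes "\<And>y. y \<in> set ys \<Longrightarrow> g y \<in> mat_pairs (r y) (c y)"
    and "x \<in> set ys" "Q (r x) (c x) (g x)"
    and step: "\<And>a b c d B C. B \<in> mat_pairs a b \<Longrightarrow> C \<in> mat_pairs c d \<Longrightarrow> Q a b B \<or> Q c d C \<Longrightarrow>
      Q (a + c) (b + d) (pair_oplus a b c d B C)"
  shows "Q (sum_list (map r ys)) (sum_list (map c ys)) (pair_sum (map g ys))"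
  using assms(1-3)
proof (induction ys)
  case (Cons y ys)
  then have y: "g y \<in> mat_pairs (r y) (c y)" by simp
  have ys: "pair_sum (map g ys) \<in> mat_pairs (sum_list (map r ys)) (sum_list (map c ys))"
    using Cons.prems by (intro pair_sum_carrier) auto
  show ?case
    using step[OF y ys] Cons by (auto simp: pair_sum_Cons[OF y ys])
qed simp

section \<open>Equivalence of pairs\<close>

lemma pair_equivalentI:
  assumes "A \<in> mat_pairs m n" "R \<in> carrier_mat m m" "S \<in> carrier_mat n n" "invertible_mat R" "invertible_mat S"
  shows "pair_equivalent m n A (R * fst A * S, R * snd A * S)"
  using assms mat_pairsD[OF assms(1)] unfolding pair_equivalent_def by (auto simp: mat_pairs_def)

lemma invertible_matI:
  assumes "R \<in> carrier_mat n n" "R' \<in> carrier_mat n n" "R * R' = 1\<^sub>m n" "R' * R = 1\<^sub>m n"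
  shows "invertible_mat R"
  using assms unfolding invertible_mat_def inverts_mat_def by auto

lemma mat_sandwich_cancel:
  fixes X :: "complex mat"
  assumes "X \<in> carrier_mat m n" "R \<in> carrier_mat m m" "R' \<in> carrier_mat m m" "R * R' = 1\<^sub>m m"
    "S \<in> carrier_mat n n" "S' \<in> carrier_mat n n" "S' * S = 1\<^sub>m n"
  shows "R * (R' * X * S') * S = X"
proof -
  have "R * (R' * X * S') * S = R * (R' * X * S' * S)"
    using assms by (intro assoc_mult_mat[of _ m m _ n _ n]) auto
  also have "R' * X * S' * S = R' * X * (S' * S)"
    using assms by (intro assoc_mult_mat[of _ m n _ n _ n]) auto
  also have "\<dots> = R' * X" using assms by simp
  also have "R * (R' * X) = R * R' * X"
    using assms by (intro assoc_mult_mat[symmetric, of _ m m _ m _ n]) auto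
  finally show ?thesis using assms by simp
qed

lemma pair_equivalent_sym:
  assumes "pair_equivalent m n A B"
  shows "pair_equivalent m n B A"
proof -
  obtain R S where RS: "R \<in> carrier_mat m m" "S \<in> carrier_mat n n" "invertible_mat R" "invertible_mat S"
    and B: "B = (R * fst A * S, R * snd A * S)" "B \<in> mat_pairs m n" and A: "A \<in> mat_pairs m n"
    using assms by (auto simp: pair_equivalent_def prod_eq_iff)
  obtain R' where R': "R' \<in> carrier_mat m m" "R * R' = 1\<^sub>m m" "R' * R = 1\<^sub>m m"
    using invertible_matE[OF RS(3,1)] by blast
  obtain S' where S': "S' \<in> carrier_mat n n" "S * S' = 1\<^sub>m n" "S' * S = 1\<^sub>m n"
    using invertible_matE[OF RS(4,2)] by blast
  have "(R' * fst B * S', R' * snd B * S') = A"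
    using mat_sandwich_cancel[OF _ R'(1) RS(1) R'(3) S'(1) RS(2) S'(2)] mat_pairsD[OF A]
    by (simp add: B prod_eq_iff)
  then show ?thesis
    using pair_equivalentI[OF B(2) R'(1) S'(1) invertible_matI[OF R'(1) RS(1) R'(3,2)]
      invertible_matI[OF S'(1) RS(2) S'(3,2)]] by simp
qed

lemma invertible_mat_mult:
  fixes R P :: "complex mat"
  assumes "invertible_mat R" "invertible_mat P" and R: "R \<in> carrier_mat n n" and P: "P \<in> carrier_mat n n"
  shows "invertible_mat (R * P)"
proof -
  obtain R' where R': "R' \<in> carrier_mat n n" "R * R' = 1\<^sub>m n" "R' * R = 1\<^sub>m n"
    using invertible_matE[OF assms(1,3)] by blast
  obtain P' where P': "P' \<in> carrier_mat n n" "P * P' = 1\<^sub>m n" "P' * P = 1\<^sub>m n"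
    using invertible_matE[OF assms(2,4)] by blast
  have cancel: "A * B * (B' * A') = 1\<^sub>m n"
    if "A \<in> carrier_mat n n" "A' \<in> carrier_mat n n" "B \<in> carrier_mat n n" "B' \<in> carrier_mat n n"
      "A * A' = 1\<^sub>m n" "B * B' = 1\<^sub>m n" for A A' B B' :: "complex mat"
  proof -
    have "A * B * (B' * A') = A * (B * (B' * A'))"
      using that by (intro assoc_mult_mat[of _ n n _ n _ n]) auto
    also have "B * (B' * A') = B * B' * A'"
      using that by (intro assoc_mult_mat[symmetric, of _ n n _ n _ n]) auto
    finally show ?thesis using that by simp
  qed
  have "R * P * (P' * R') = 1\<^sub>m n" "P' * R' * (R * P) = 1\<^sub>m n"
    using cancel R R' P P' by auto
  then show ?thesis
    using R R' P P' by (intro invertible_matI[of _ n "P' * R'"]) auto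
qed

lemma pair_equivalent_trans:
  assumes "pair_equivalent m n A B" "pair_equivalent m n B C"
  shows "pair_equivalent m n A C"
proof -
  obtain R S where RS: "R \<in> carrier_mat m m" "S \<in> carrier_mat n n" "invertible_mat R" "invertible_mat S"
    and B: "B = (R * fst A * S, R * snd A * S)" and A: "A \<in> mat_pairs m n"
    using assms(1) by (auto simp: pair_equivalent_def prod_eq_iff)
  obtain P Q where PQ: "P \<in> carrier_mat m m" "Q \<in> carrier_mat n n" "invertible_mat P" "invertible_mat Q"
    and C: "C = (P * fst B * Q, P * snd B * Q)"
    using assms(2) by (auto simp: pair_equivalent_def prod_eq_iff)
  have "P * (R * X * S) * Q = (P * R) * X * (S * Q)" if "X \<in> carrier_mat m n" for X
  proof -
    have "P * (R * X * S) * Q = P * (R * X * S * Q)"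
      using that RS PQ by (intro assoc_mult_mat[of _ m m _ n _ n]) auto
    also have "R * X * S * Q = R * X * (S * Q)"
      using that RS PQ by (intro assoc_mult_mat[of _ m n _ n _ n]) auto
    also have "\<dots> = R * (X * (S * Q))"
      using that RS PQ by (intro assoc_mult_mat[of _ m m _ n _ n]) auto
    also have "P * \<dots> = P * R * (X * (S * Q))"
      using that RS PQ by (intro assoc_mult_mat[symmetric, of _ m m _ m _ n]) auto
    also have "\<dots> = (P * R) * X * (S * Q)"
      using that RS PQ by (intro assoc_mult_mat[symmetric, of _ m m _ n _ n]) auto
    finally show ?thesis .
  qed
  then have "C = ((P * R) * fst A * (S * Q), (P * R) * snd A * (S * Q))"
    using mat_pairsD[OF A] by (simp add: C B)
  then show ?thesis
    using pair_equivalentI[OF A, of "P * R" "S * Q"] invertible_mat_mult[OF PQ(3) RS(3) PQ(1) RS(1)]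
      invertible_mat_mult[OF RS(4) PQ(4) RS(2) PQ(2)] RS PQ by auto
qed

lemma mat_DERIV_sandwich:
  assumes F: "mat_DERIV m n F F'" and R: "R \<in> carrier_mat m m" and S: "S \<in> carrier_mat n n"
  shows "mat_DERIV m n (\<lambda>t. R * F t * S) (R * F' * S)"
proof -
  note c = mat_DERIV_carrier[OF F]
  have "mat_DERIV m n (\<lambda>t. R * F t) (R * F')"
    using mat_DERIV_mult[OF mat_DERIV_const[OF R] F] c(1)[of 0] c(2) R by simp
  from mat_DERIV_mult[OF this mat_DERIV_const[OF S]] show ?thesis
    using c(1)[of 0] c(2) R S by simp
qed

text \<open>Transport the curves by \<open>X \<mapsto> R X S\<close>.\<close>
lemma flexible_equivalent:
  assumes flex: "flexible m n A P" and AB: "pair_equivalent m n A B"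
    and P: "\<And>X Y. P X \<Longrightarrow> pair_equivalent m n X Y \<Longrightarrow> P Y"
  shows "flexible m n B P"
  unfolding flexible_def
proof (intro ballI)
  fix D1 D2 :: "complex mat" assume D: "D1 \<in> carrier_mat m n" "D2 \<in> carrier_mat m n"
  obtain R S where RS: "R \<in> carrier_mat m m" "S \<in> carrier_mat n n" "invertible_mat R" "invertible_mat S"
    and B: "B = (R * fst A * S, R * snd A * S)" and A: "A \<in> mat_pairs m n"
    using AB by (auto simp: pair_equivalent_def prod_eq_iff)
  obtain R' where R': "R' \<in> carrier_mat m m" "R * R' = 1\<^sub>m m"
    using invertible_matE[OF RS(3,1)] by blast
  obtain S' where S': "S' \<in> carrier_mat n n" "S' * S = 1\<^sub>m n"
    using invertible_matE[OF RS(4,2)] by blast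
  have "R' * D1 * S' \<in> carrier_mat m n" "R' * D2 * S' \<in> carrier_mat m n"
    using R' S' D by auto
  then obtain \<gamma>1 \<gamma>2 where \<gamma>: "mat_DERIV m n \<gamma>1 (R' * D1 * S')" "mat_DERIV m n \<gamma>2 (R' * D2 * S')"
    "(\<gamma>1 0, \<gamma>2 0) = A" "\<And>t. P (\<gamma>1 t, \<gamma>2 t)"
    using flex unfolding flexible_def by blast
  have "mat_DERIV m n (\<lambda>t. R * \<gamma>1 t * S) D1" "mat_DERIV m n (\<lambda>t. R * \<gamma>2 t * S) D2"
    using mat_DERIV_sandwich[OF \<gamma>(1) RS(1,2)] mat_DERIV_sandwich[OF \<gamma>(2) RS(1,2)]
      mat_sandwich_cancel[OF _ RS(1) R' RS(2) S'] D by simp_all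
  moreover have "(R * \<gamma>1 0 * S, R * \<gamma>2 0 * S) = B"
    using \<gamma>(3) B by auto
  moreover have "P (R * \<gamma>1 t * S, R * \<gamma>2 t * S)" for t
  proof (rule P[OF \<gamma>(4)])
    have "(\<gamma>1 t, \<gamma>2 t) \<in> mat_pairs m n"
      using mat_DERIV_carrier(1)[OF \<gamma>(1)] mat_DERIV_carrier(1)[OF \<gamma>(2)] by (simp add: mat_pairs_def)
    from pair_equivalentI[OF this RS]
    show "pair_equivalent m n (\<gamma>1 t, \<gamma>2 t) (R * \<gamma>1 t * S, R * \<gamma>2 t * S)" by simp
  qed
  ultimately show "\<exists>\<gamma>1 \<gamma>2. mat_DERIV m n \<gamma>1 D1 \<and> mat_DERIV m n \<gamma>2 D2 \<and> (\<gamma>1 0, \<gamma>2 0) = B \<and> (\<forall>t. P (\<gamma>1 t, \<gamma>2 t))"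
    by blast
qed

section \<open>The summands\<close>

lemma nabla_carrier: "1 \<le> r \<Longrightarrow> symbol_pair (Nabla r) \<in> mat_pairs (r - 1) r"
  using F_mat_carrier[of "r - 1"] K_mat_carrier[of "r - 1"] by (simp add: mat_pairs_def)

lemma tri_carrier: "1 \<le> r \<Longrightarrow> symbol_pair (Tri r) \<in> mat_pairs r (r - 1)"
  using F_mat_carrier[of "r - 1"] K_mat_carrier[of "r - 1"] by (simp add: mat_pairs_def)

lemma nabla_sums:
  assumes "i < q"
  shows "(\<Sum>k<Suc q. fst (symbol_pair (Nabla (Suc q))) $$ (i, k) * x k) = x i"
    and "(\<Sum>k<Suc q. snd (symbol_pair (Nabla (Suc q))) $$ (i, k) * x k) = x (Suc i)"
proof -
  have "(\<Sum>k<Suc q. fst (symbol_pair (Nabla (Suc q))) $$ (i, k) * x k) = (\<Sum>k<Suc q. if k = i then x k else 0)"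
    using assms F_mat_carrier[of q] by (intro sum.cong) (auto simp: F_mat_index)
  then show "(\<Sum>k<Suc q. fst (symbol_pair (Nabla (Suc q))) $$ (i, k) * x k) = x i"
    using assms by (simp del: sum.lessThan_Suc)
  have "(\<Sum>k<Suc q. snd (symbol_pair (Nabla (Suc q))) $$ (i, k) * x k) = (\<Sum>k<Suc q. if k = Suc i then x k else 0)"
    using assms K_mat_carrier[of q] by (intro sum.cong) (auto simp: K_mat_index)
  then show "(\<Sum>k<Suc q. snd (symbol_pair (Nabla (Suc q))) $$ (i, k) * x k) = x (Suc i)"
    using assms by (simp del: sum.lessThan_Suc)
qed

text \<open>The equations say that \<open>V i j + V (i + 1) (j - 1) = 0\<close>, so up to sign \<open>V\<close> is constant on the
antidiagonals \<open>i + j = const\<close>, and the boundary equations force it to vanish on the antidiagonals that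
meet the first column above the last row or the last column below the first row. The only
antidiagonal that can escape both is \<open>i + j = s - 1\<close>, when \<open>r = s\<close>.\<close>
lemma nullity_le_nabla:
  assumes s: "1 \<le> s" "s \<le> r"
  shows "nullity_le (toeplitz s (symbol_pair (Nabla r))) (if r = s then 1 else 0)"
proof -
  define q where "q = r - 1"
  have r: "r = Suc q" using s by (simp add: q_def)
  have B: "symbol_pair (Nabla r) \<in> mat_pairs q r"
    using nabla_carrier[of r] s by (simp add: q_def)
  note T = toeplitz_carrier[OF B, of s]
  have zero: "z = 0\<^sub>v (r * s)" if z: "z \<in> carrier_vec (r * s)" "toeplitz s (symbol_pair (Nabla r)) *\<^sub>v z = 0\<^sub>v (q * Suc s)"
    and corner: "r = s \<Longrightarrow> z $ (q * s) = 0" for z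
  proof -
    define V where "V k l = z $ (k * s + l)" for k l
    have eqs: "(if j < s then V i j else 0) + (if 0 < j then V (Suc i) (j - 1) else 0) = 0"
      if "i < q" "j < Suc s" for i j
      using toeplitz_kernel_eqs[OF B z that]
      unfolding r nabla_sums[OF that(1), of "\<lambda>k. z $ (k * s + j)"]
        nabla_sums[OF that(1), of "\<lambda>k. z $ (k * s + (j - 1))"]
      by (simp only: V_def)
    have low: "V i j = 0" if "i + j < q" "j < s" for i j
      using that
    proof (induction j arbitrary: i)
      case 0
      then show ?case using eqs[of i 0] by simp
    next
      case (Suc j)
      then show ?case using eqs[of i "Suc j"] by simp
    qed
    have high: "V i j = 0" if "s \<le> i + j" "j < s" "i \<le> q" for i j
      using that
    proof (induction "s - j" arbitrary: i j rule: less_induct)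
      case less
      then obtain i' where i: "i = Suc i'" by (cases i) auto
      show ?case
      proof (cases "Suc j < s")
        case True
        then have "V i' (Suc j) = 0"
          using less.prems by (intro less.hyps) (auto simp: i)
        then show ?thesis using eqs[of i' "Suc j"] True less.prems by (simp add: i)
      next
        case False
        then show ?thesis using eqs[of i' "Suc j"] less.prems by (simp add: i)
      qed
    qed
    have antidiagonal: "V (q - j) j = 0" if "r = s" "j < s" for j
      using that(2)
    proof (induction j)
      case 0
      then show ?case using corner[OF that(1)] by (simp add: V_def)
    next
      case (Suc j)
      then have "Suc (q - Suc j) = q - j" using that r by auto
      then show ?case using eqs[of "q - Suc j" "Suc j"] Suc that r by simp
    qed
    have "V i j = 0" if "i < r" "j < s" for i j
    proof -
      consider "i + j < q" | "s \<le> i + j" | "r = s" "i = q - j" "j \<le> q"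
        using that r s by linarith
      then show ?thesis
        using low high antidiagonal that r by cases auto
    qed
    then show ?thesis
      using z mult_add_less by (intro double_index_vec_eqI) (auto simp: V_def)
  qed
  show ?thesis
  proof (cases "r = s")
    case True
    have "nullity_le (toeplitz s (symbol_pair (Nabla r))) 1"
    proof (rule nullity_leI[OF T])
      fix z assume z: "z \<in> carrier_vec (r * s)" "toeplitz s (symbol_pair (Nabla r)) *\<^sub>v z = 0\<^sub>v (q * Suc s)"
      define L where "L = mat 1 (r * s) (\<lambda>(i, j). if j = q * s then 1 else 0 :: complex)"
      assume "mat 1 (r * s) (\<lambda>(i, j). if j = q * s then 1 else 0 :: complex) *\<^sub>v z = 0\<^sub>v 1"
      then have "(L *\<^sub>v z) $ 0 = 0" by (simp add: L_def)
      moreover have "(L *\<^sub>v z) $ 0 = (\<Sum>k<r * s. L $$ (0, k) * z $ k)"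
        using z by (intro index_mult_mat_vec_sum) (auto simp: L_def)
      moreover have "\<dots> = (\<Sum>k<r * s. if k = q * s then z $ k else 0)"
        by (intro sum.cong) (auto simp: L_def)
      moreover have "q * s < r * s" using s r by simp
      ultimately show "z = 0\<^sub>v (r * s)"
        by (intro zero z) simp
    qed simp
    then show ?thesis using True by simp
  next
    case False
    then show ?thesis
      using nullity_le_0I[OF T zero] by simp
  qed
qed

lemma nullity_ge_1I:
  assumes M: "M \<in> carrier_mat a b" and v: "v \<in> carrier_vec b" "M *\<^sub>v v = 0\<^sub>v a" "v \<noteq> 0\<^sub>v b"
  shows "nullity_ge M 1"
proof (rule nullity_geI[OF M, of "mat b 1 (\<lambda>(i, j). v $ i)"])
  define K where "K = mat b 1 (\<lambda>(i, j). v $ i)"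
  have K: "K \<in> carrier_mat b 1" by (simp add: K_def)
  then show "mat b 1 (\<lambda>(i, j). v $ i) \<in> carrier_mat b 1" by (simp add: K_def)
  have "M * K = 0\<^sub>m a 1"
  proof (rule eq_matI)
    fix i j assume ij: "i < dim_row (0\<^sub>m a 1)" "j < dim_col (0\<^sub>m a 1)"
    have "(M * K) $$ (i, j) = (\<Sum>k<b. M $$ (i, k) * v $ k)"
      using index_mult_mat_sum[OF M K, of i j] ij by (simp add: K_def)
    also have "\<dots> = (M *\<^sub>v v) $ i"
      using index_mult_mat_vec_sum[OF M v(1), of i] ij by simp
    finally show "(M * K) $$ (i, j) = 0\<^sub>m a 1 $$ (i, j)"
      using ij by (simp add: v)
  qed (use M K in auto)
  then show "M * mat b 1 (\<lambda>(i, j). v $ i) = 0\<^sub>m a 1" by (simp add: K_def)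
  fix x :: "complex vec" assume x: "x \<in> carrier_vec 1"
  assume "mat b 1 (\<lambda>(i, j). v $ i) *\<^sub>v x = 0\<^sub>v b"
  then have Kx: "K *\<^sub>v x = 0\<^sub>v b" by (simp add: K_def)
  obtain a where a: "a < b" "v $ a \<noteq> 0"
    using v(1,3) by (metis carrier_vecD eq_vecI index_zero_vec)
  have "(K *\<^sub>v x) $ a = v $ a * x $ 0"
    using index_mult_mat_vec_sum[OF K x a(1)] a by (simp add: K_def)
  then have "x $ 0 = 0" using Kx a by simp
  then show "x = 0\<^sub>v 1" using x by (intro eq_vecI) auto
qed

text \<open>The alternating antidiagonal, that is the polynomial solution \<open>(\<plusminus>x\<^sup>s\<^sup>-\<^sup>1, \<dots>, -x, 1)\<close>.\<close>
definition nabla_kernel_vec :: "nat \<Rightarrow> complex vec" where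
  "nabla_kernel_vec s = vec_of_fun s s (\<lambda>k l. if k + l = s - 1 then (-1) ^ l else 0)"

lemma nabla_kernel_vec_in_kernel:
  assumes s: "1 \<le> s"
  shows "toeplitz s (symbol_pair (Nabla s)) *\<^sub>v nabla_kernel_vec s = 0\<^sub>v ((s - 1) * Suc s)"
proof -
  define q where "q = s - 1"
  have sq: "s = Suc q" using s by (simp add: q_def)
  have B: "symbol_pair (Nabla s) \<in> mat_pairs q s"
    using nabla_carrier[of s] s by (simp add: q_def)
  have v: "nabla_kernel_vec s \<in> carrier_vec (s * s)" by (simp add: nabla_kernel_vec_def)
  have idx: "nabla_kernel_vec s $ (k * s + l) = (if k + l = q then (-1) ^ l else 0)" if "k < s" "l < s" for k l
    using vec_of_fun_index[OF that] by (simp add: nabla_kernel_vec_def q_def)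
  show ?thesis
    unfolding q_def[symmetric]
  proof (rule double_index_vec_eqI)
    fix i j assume ij: "i < q" "j < Suc s"
    have "(toeplitz s (symbol_pair (Nabla s)) *\<^sub>v nabla_kernel_vec s) $ (i * Suc s + j) =
      (if j < s then nabla_kernel_vec s $ (i * s + j) else 0) +
      (if 0 < j then nabla_kernel_vec s $ (Suc i * s + (j - 1)) else 0)"
      unfolding toeplitz_mult_vec[OF B v ij] unfolding sq
        nabla_sums[OF ij(1), of "\<lambda>k. nabla_kernel_vec (Suc q) $ (k * Suc q + j)"]
        nabla_sums[OF ij(1), of "\<lambda>k. nabla_kernel_vec (Suc q) $ (k * Suc q + (j - 1))"] ..
    also have "\<dots> = 0"
    proof (cases j)
      case 0
      then show ?thesis using idx[of i 0] ij s by (simp add: sq)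
    next
      case (Suc j')
      then have "nabla_kernel_vec s $ (Suc i * s + j') = (if Suc i + j' = q then (-1) ^ j' else 0)"
        using ij by (intro idx) (auto simp: sq)
      moreover have "nabla_kernel_vec s $ (i * s + j) = (if i + j = q then (-1) ^ j else 0)" if "j < s"
        using ij that by (intro idx) (auto simp: sq)
      ultimately show ?thesis using Suc ij by (auto simp: sq simp del: mult_Suc_right mult_Suc)
    qed
    finally show "(toeplitz s (symbol_pair (Nabla s)) *\<^sub>v nabla_kernel_vec s) $ (i * Suc s + j) = 0\<^sub>v (q * Suc s) $ (i * Suc s + j)"
      using mult_add_less[OF ij] by (simp del: mult_Suc_right)
  qed (use mult_mat_vec_carrier[OF toeplitz_carrier[OF B] v] in auto)
qed

lemma nabla_kernel_frame:
  assumes s: "1 \<le> s"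
  shows "kernel_frame s (s - 1) s (symbol_pair (Nabla s))"
  unfolding kernel_frame_def
proof (intro bexI conjI allI impI)
  show "toeplitz s (symbol_pair (Nabla s)) *\<^sub>v nabla_kernel_vec s = 0\<^sub>v ((s - 1) * Suc s)"
    by (rule nabla_kernel_vec_in_kernel[OF s])
  define X where "X = mat s s (\<lambda>(j, k). if k + j = s - 1 then (-1) ^ j else 0 :: complex)"
  fix j l assume jl: "j < s" "l < s"
  have "(\<Sum>k<s. X $$ (j, k) * nabla_kernel_vec s $ (k * s + l)) =
    (\<Sum>k<s. if k = s - 1 - j then if j = l then 1 else 0 else 0)"
    using jl by (intro sum.cong) (auto simp: X_def nabla_kernel_vec_def vec_of_fun_index power_add[symmetric])
  also have "\<dots> = (if j = l then 1 else 0)"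
    using jl by simp
  finally show "(\<Sum>k<s. mat s s (\<lambda>(j, k). if k + j = s - 1 then (-1) ^ j else 0) $$ (j, k) *
      nabla_kernel_vec s $ (k * s + l)) = (if j = l then 1 else 0)"
    unfolding X_def .
qed (auto simp: nabla_kernel_vec_def)

lemma nullity_ge_nabla:
  assumes s: "1 \<le> s"
  shows "nullity_ge (toeplitz s (symbol_pair (Nabla s))) 1"
proof (rule nullity_ge_1I[OF toeplitz_carrier[OF nabla_carrier[OF s]] _ nabla_kernel_vec_in_kernel[OF s]])
  have "nabla_kernel_vec s $ (0 * s + (s - 1)) \<noteq> 0"
    using s unfolding nabla_kernel_vec_def by (subst vec_of_fun_index) auto
  moreover have "0 * s + (s - 1) < s * s"
    using s by (intro mult_add_less) auto
  ultimately show "nabla_kernel_vec s \<noteq> 0\<^sub>v (s * s)" by auto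
qed (simp add: nabla_kernel_vec_def)

lemma nonzero_cokernelI:
  assumes B: "B \<in> mat_pairs m n"
    and eqs: "\<And>k l. k < n \<Longrightarrow> l < s \<Longrightarrow>
      (\<Sum>i<m. fst B $$ (i, k) * U i l) + (\<Sum>i<m. snd B $$ (i, k) * U i (Suc l)) = 0"
    and nz: "a < m" "b < Suc s" "U a b \<noteq> 0"
  shows "nonzero_cokernel s m n B"
  unfolding nonzero_cokernel_def
proof (intro bexI conjI)
  define u where "u = vec_of_fun m (Suc s) U"
  have u: "u \<in> carrier_vec (m * Suc s)" unfolding u_def by (rule vec_of_fun_carrier)
  then show "vec_of_fun m (Suc s) U \<in> carrier_vec (m * Suc s)" by (simp add: u_def del: mult_Suc_right)
  have "u $ (a * Suc s + b) \<noteq> 0"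
    using vec_of_fun_index[OF nz(1,2)] nz by (simp add: u_def del: mult_Suc_right)
  then show "vec_of_fun m (Suc s) U \<noteq> 0\<^sub>v (m * Suc s)"
    using mult_add_less[OF nz(1,2)] unfolding u_def by auto
  have "transpose_mat (toeplitz s B) *\<^sub>v u = 0\<^sub>v (n * s)"
  proof (rule double_index_vec_eqI)
    fix k l assume kl: "k < n" "l < s"
    have "(transpose_mat (toeplitz s B) *\<^sub>v u) $ (k * s + l) =
      (\<Sum>i<m. fst B $$ (i, k) * U i l) + (\<Sum>i<m. snd B $$ (i, k) * U i (Suc l))"
      unfolding toeplitz_transpose_mult_vec[OF B u kl] sum.distrib
      using kl by (simp add: u_def vec_of_fun_index del: mult_Suc_right add_Suc_right)
    then show "(transpose_mat (toeplitz s B) *\<^sub>v u) $ (k * s + l) = 0\<^sub>v (n * s) $ (k * s + l)"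
      using eqs[OF kl] mult_add_less[OF kl] by simp
  qed (use toeplitz_carrier[OF B, of s] mult_mat_vec_carrier[OF _ u] in auto)
  then show "transpose_mat (toeplitz s B) *\<^sub>v vec_of_fun m (Suc s) U = 0\<^sub>v (n * s)" by (simp add: u_def)
qed

text \<open>The last row of \<open>F\<close> vanishes, so the unit row vector there annihilates \<open>F\<close>; placed at degree \<open>0\<close> it
is not seen by \<open>K\<close>.\<close>
lemma nonzero_cokernel_tri:
  assumes r: "1 \<le> r"
  shows "nonzero_cokernel s r (r - 1) (symbol_pair (Tri r))"
proof (rule nonzero_cokernelI[OF tri_carrier[OF r], where a = "r - 1" and b = 0
    and U = "\<lambda>i j. if i = r - 1 \<and> j = 0 then 1 else 0"])
  fix k l assume kl: "k < r - 1" "l < s"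
  have "F_mat r $$ (r - 1, k) = 0"
    using F_mat_index[of "r - 1" "r - 1" k] kl r by simp
  moreover have "(\<Sum>i<r. fst (symbol_pair (Tri r)) $$ (i, k) * (if i = r - 1 \<and> l = 0 then 1 else 0)) =
    (\<Sum>i<r. if i = r - 1 then if l = 0 then F_mat r $$ (r - 1, k) else 0 else 0)"
    by (intro sum.cong) auto
  ultimately show "(\<Sum>i<r. fst (symbol_pair (Tri r)) $$ (i, k) * (if i = r - 1 \<and> l = 0 then 1 else 0)) +
      (\<Sum>i<r. snd (symbol_pair (Tri r)) $$ (i, k) * (if i = r - 1 \<and> Suc l = 0 then 1 else 0)) = 0"
    using r by simp
qed (use r in auto)

text \<open>The alternating antidiagonal \<open>i + j = s\<close> fits into the \<open>r - 1\<close> rows without touching the boundary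
equations because \<open>s \<le> r - 2\<close>.\<close>
lemma nonzero_cokernel_nabla:
  assumes r: "s + 2 \<le> r"
  shows "nonzero_cokernel s (r - 1) r (symbol_pair (Nabla r))"
proof -
  define q where "q = r - 1"
  have rq: "r = Suc q" using r by (simp add: q_def)
  have B: "symbol_pair (Nabla r) \<in> mat_pairs q r"
    using nabla_carrier[of r] r by (simp add: q_def)
  define U where "U i j = (if i + j = s then (-1) ^ j else 0 :: complex)" for i j
  have "nonzero_cokernel s q r (symbol_pair (Nabla r))"
  proof (rule nonzero_cokernelI[OF B, where U = U and a = s and b = 0])
    fix k l assume kl: "k < r" "l < s"
    have "(\<Sum>i<q. fst (symbol_pair (Nabla r)) $$ (i, k) * U i l) = (\<Sum>i<q. if i = k then U i l else 0)"
      using kl F_mat_carrier[of q] by (intro sum.cong) (auto simp: F_mat_index rq)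
    moreover have "(\<Sum>i<q. snd (symbol_pair (Nabla r)) $$ (i, k) * U i (Suc l)) =
        (\<Sum>i<q. if i = k - 1 then if 0 < k then U i (Suc l) else 0 else 0)"
      using kl K_mat_carrier[of q] by (intro sum.cong) (auto simp: K_mat_index rq)
    moreover have "q > s" using r by (simp add: q_def)
    ultimately show "(\<Sum>i<q. fst (symbol_pair (Nabla r)) $$ (i, k) * U i l) +
        (\<Sum>i<q. snd (symbol_pair (Nabla r)) $$ (i, k) * U i (Suc l)) = 0"
      using kl rq by (cases k) (auto simp: U_def)
  qed (use r in \<open>auto simp: q_def U_def\<close>)
  then show ?thesis by (simp add: q_def)
qed

text \<open>What the cells of finite and infinite eigenvalues and their transposes have in common.\<close>
definition identity_block :: "nat \<Rightarrow> mat_pair \<Rightarrow> bool" where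
  "identity_block r B \<longleftrightarrow> 1 \<le> r \<and> (\<exists>J \<in> carrier_mat r r. B = (1\<^sub>m r, J) \<or> B = (J, 1\<^sub>m r))"

lemma identity_block_carrier: "identity_block r B \<Longrightarrow> B \<in> mat_pairs r r"
  by (auto simp: identity_block_def mat_pairs_def)

lemma nullity_le_identity_block:
  assumes "identity_block r B"
  shows "nullity_le (toeplitz s B) 0"
proof -
  obtain J where "B = (1\<^sub>m r, J) \<or> B = (J, 1\<^sub>m r)"
    using assms by (auto simp: identity_block_def)
  then show ?thesis
    using toeplitz_injective_fst[OF identity_block_carrier[OF assms]]
      toeplitz_injective_snd[OF identity_block_carrier[OF assms]] by auto
qed

text \<open>The rows \<open>e\<^sub>0 (-J)\<^sup>d\<close>, with which an identity block is solved degree by degree.\<close>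
primrec left_chain :: "nat \<Rightarrow> complex mat \<Rightarrow> nat \<Rightarrow> nat \<Rightarrow> complex" where
  "left_chain r J 0 = (\<lambda>k. if k = 0 then 1 else 0)"
| "left_chain r J (Suc d) = (\<lambda>k. - (\<Sum>i<r. J $$ (i, k) * left_chain r J d i))"

lemma nonzero_cokernel_identity_block:
  assumes "identity_block r B"
  shows "nonzero_cokernel s r r B"
proof -
  note B = identity_block_carrier[OF assms]
  have one: "(\<Sum>i<r. 1\<^sub>m r $$ (i, k) * x i) = x k" if "k < r" for k and x :: "nat \<Rightarrow> complex"
  proof -
    have "(\<Sum>i<r. 1\<^sub>m r $$ (i, k) * x i) = (\<Sum>i<r. if i = k then x i else 0)"
      using that by (intro sum.cong) auto
    then show ?thesis using that by simp
  qed
  obtain J where r: "1 \<le> r" and "B = (1\<^sub>m r, J) \<or> B = (J, 1\<^sub>m r)"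
    using assms by (auto simp: identity_block_def)
  then show ?thesis
  proof (elim disjE)
    assume BJ: "B = (1\<^sub>m r, J)"
    show ?thesis
    proof (rule nonzero_cokernelI[OF B, where U = "\<lambda>i j. left_chain r J (s - j) i" and a = 0 and b = s])
      fix k l assume kl: "k < r" "l < s"
      then have "s - l = Suc (s - Suc l)" by simp
      then show "(\<Sum>i<r. fst B $$ (i, k) * left_chain r J (s - l) i) +
          (\<Sum>i<r. snd B $$ (i, k) * left_chain r J (s - Suc l) i) = 0"
        unfolding BJ fst_conv snd_conv one[OF kl(1)] by simp
    qed (use r in auto)
  next
    assume BJ: "B = (J, 1\<^sub>m r)"
    show ?thesis
    proof (rule nonzero_cokernelI[OF B, where U = "\<lambda>i j. left_chain r J j i" and a = 0 and b = 0])
      fix k l assume kl: "k < r" "l < s"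
      then show "(\<Sum>i<r. fst B $$ (i, k) * left_chain r J l i) +
          (\<Sum>i<r. snd B $$ (i, k) * left_chain r J (Suc l) i) = 0"
        unfolding BJ fst_conv snd_conv one[OF kl(1)] by simp
    qed (use r in auto)
  qed
qed

lemma nullity_le_tri:
  assumes r: "1 \<le> r"
  shows "nullity_le (toeplitz s (symbol_pair (Tri r))) 0"
proof (rule toeplitz_injective_fst[OF tri_carrier[OF r]])
  fix x assume x: "x \<in> carrier_vec (r - 1)" "fst (symbol_pair (Tri r)) *\<^sub>v x = 0\<^sub>v r"
  have F: "F_mat r \<in> carrier_mat r (r - 1)" using F_mat_carrier[of "r - 1"] r by simp
  have "x $ i = 0" if i: "i < r - 1" for i
  proof -
    have "(F_mat r *\<^sub>v x) $ i = (\<Sum>k<r - 1. F_mat r $$ (i, k) * x $ k)"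
      using i by (intro index_mult_mat_vec_sum[OF F x(1)]) simp
    also have "\<dots> = (\<Sum>k<r - 1. if k = i then x $ k else 0)"
      using i F_mat_index[of i "r - 1"] by (intro sum.cong) auto
    finally show ?thesis using x(2) i by simp
  qed
  then show "x = 0\<^sub>v (r - 1)" using x(1) by (intro eq_vecI) auto
qed

lemma sum_list_indicator:
  "sum_list (map (\<lambda>y. if y = x then 1 else 0) ys) = (count (mset ys) x :: nat)"
  by (induction ys) auto

lemma mat_pairs_unique:
  assumes "B \<in> mat_pairs a b" "B \<in> mat_pairs c d"
  shows "a = c" "b = d"
  using assms by (auto simp: mat_pairs_def)

text \<open>The summands are given through a map \<open>g\<close> so that the statement covers a pair and its
transpose alike: in the transpose the roles of \<open>Tri\<close> and \<open>Nabla\<close> are exchanged. \<open>\<S>\<close> is the set of all canonical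
forms of the pair. After passing to the direct sum itself, a summand other than \<open>nab s\<close> and
\<open>nab (s + 1)\<close> would make the cokernel of the operator of index \<open>s\<close> nonzero.\<close>
lemma singular_summands:
  fixes g :: "eigval symbol \<Rightarrow> mat_pair" and nab tri :: "nat \<Rightarrow> eigval symbol"
  assumes kinds: "nab = Nabla \<and> tri = Tri \<or> nab = Tri \<and> tri = Nabla"
    and g: "\<And>r. g (nab r) = symbol_pair (Nabla r)" "\<And>r. g (tri r) = symbol_pair (Tri r)"
      "\<And>e r. 1 \<le> r \<Longrightarrow> identity_block r (g (Eig e r))"
    and forms: "\<And>ss y. ss \<in> \<S> \<Longrightarrow> y \<in> set ss \<Longrightarrow> 1 \<le> symbol_index y"
      "\<And>ss. ss \<in> \<S> \<Longrightarrow> pair_equivalent m n A (pair_sum (map g ss))"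
    and flex: "flexible m n A (\<lambda>B. \<exists>ts. (\<forall>y \<in> set ts. 1 \<le> symbol_index y) \<and>
      pair_equivalent m n B (pair_sum (map g ts)) \<and>
      (\<exists>ss \<in> \<S>. \<forall>r. count (mset ts) (nab r) = count (mset ss) (nab r)))"
    and ss: "ss \<in> \<S>" "nab s \<in> set ss"
    and minimal: "\<And>ss r. ss \<in> \<S> \<Longrightarrow> nab r \<in> set ss \<Longrightarrow> s \<le> r"
    and y: "y \<in> set ss"
  shows "y = nab s \<or> y = nab (Suc s)"
proof -
  define rows cols where "rows y = dim_row (fst (g y))" and "cols y = dim_col (fst (g y))" for y
  define w where "w y = (if y = nab s then 1 else 0 :: nat)" for y
  have s: "1 \<le> s" using forms(1)[OF ss] kinds by auto
  have kind_cases: "(\<exists>r. y = nab r) \<or> (\<exists>r. y = tri r) \<or> (\<exists>e r. y = Eig e r)" for y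
    using kinds by (cases y) auto
  have nab_eq: "nab r = nab s \<longleftrightarrow> r = s" "tri r \<noteq> nab s" "Eig e r \<noteq> nab s" for r e
    using kinds by auto
  have index: "symbol_index (nab r) = r" "symbol_index (tri r) = r" for r
    using kinds by auto
  have dims: "B \<in> mat_pairs a b \<Longrightarrow> dim_row (fst B) = a \<and> dim_col (fst B) = b" for B a b
    by (auto simp: mat_pairs_def)
  have sizes: "rows (nab r) = r - 1" "cols (nab r) = r" "rows (tri r) = r" "cols (tri r) = r - 1"
    "rows (Eig e r) = r" "cols (Eig e r) = r" if "1 \<le> r" for r e
    using dims[OF nabla_carrier[OF that]] dims[OF tri_carrier[OF that]]
      dims[OF identity_block_carrier[OF g(3)[OF that, of e]]] by (simp_all only: rows_def cols_def g)
  have carrier: "g y \<in> mat_pairs (rows y) (cols y)" if "1 \<le> symbol_index y" for y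
    using kind_cases[of y] that nabla_carrier tri_carrier identity_block_carrier[OF g(3)]
    by (auto simp: index sizes g simp del: symbol_pair.simps)
  have carrier_ss: "\<And>y. y \<in> set ss \<Longrightarrow> g y \<in> mat_pairs (rows y) (cols y)"
    by (intro carrier forms(1)[OF ss(1)])
  have le: "nullity_le (toeplitz s (g y)) (w y)" if "1 \<le> symbol_index y" "\<And>r. y = nab r \<Longrightarrow> s \<le> r" for y
    using kind_cases[of y]
  proof (elim disjE exE)
    fix r assume y: "y = nab r"
    show ?thesis
      using nullity_le_nabla[OF s that(2)[OF y]] unfolding y w_def g nab_eq .
  next
    fix r assume y: "y = tri r"
    show ?thesis
      using nullity_le_tri[of r s] that(1) nab_eq by (simp add: y w_def g index del: symbol_pair.simps)
  next
    fix e r assume y: "y = Eig e r"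
    show ?thesis
      using nullity_le_identity_block[OF g(3)] that(1) nab_eq by (simp add: y w_def)
  qed
  have ge: "nullity_ge (toeplitz s (g y)) (w y)" for y
    using nullity_ge_nabla[OF s] by (auto simp: w_def g nullity_ge_0 simp del: symbol_pair.simps)
  \<comment> \<open>With the least multiplicity of \<open>nab s\<close>, the form \<open>ss0\<close> bounds the nullity at the base point from
    above, and every other form bounds it from below along the curves.\<close>
  obtain ss0 where ss0: "ss0 \<in> \<S>"
    and least: "\<And>ss'. ss' \<in> \<S> \<Longrightarrow> count (mset ss0) (nab s) \<le> count (mset ss') (nab s)"
    using ex_has_least_nat[of "\<lambda>ss. ss \<in> \<S>" ss "\<lambda>ss. count (mset ss) (nab s)"] ss(1) by blast
  define p where "p = count (mset ss0) (nab s)"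
  have w_sum: "sum_list (map w ts) = count (mset ts) (nab s)" for ts
    unfolding w_def by (rule sum_list_indicator)
  define \<Lambda> where "\<Lambda> = pair_sum (map g ss)"
  have A\<Lambda>: "pair_equivalent m n A \<Lambda>" using forms(2)[OF ss(1)] by (simp add: \<Lambda>_def)
  have "\<Lambda> \<in> mat_pairs (sum_list (map rows ss)) (sum_list (map cols ss))"
    unfolding \<Lambda>_def by (intro pair_sum_carrier carrier forms(1)[OF ss(1)])
  moreover have "\<Lambda> \<in> mat_pairs m n" using A\<Lambda> by (simp add: pair_equivalent_def)
  ultimately have mn: "m = sum_list (map rows ss)" "n = sum_list (map cols ss)"
    using mat_pairs_unique by blast+
  have cok: "nonzero_cokernel s (rows y) (cols y) (g y) \<Longrightarrow> False"
  proof -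
    assume nc: "nonzero_cokernel s (rows y) (cols y) (g y)"
    have "nonzero_cokernel s m n \<Lambda>"
      unfolding \<Lambda>_def mn
      by (rule pair_sum_inherit[where Q = "nonzero_cokernel s" and r = rows and c = cols,
          OF carrier_ss y nc nonzero_cokernel_oplus])
    moreover have frame: "kernel_frame s (rows (nab s)) (cols (nab s)) (g (nab s))"
      using nabla_kernel_frame[OF s] by (simp only: g sizes[OF s])
    have "kernel_frame s m n \<Lambda>"
      unfolding \<Lambda>_def mn
      by (rule pair_sum_inherit[where Q = "kernel_frame s" and r = rows and c = cols,
          OF carrier_ss ss(2) frame kernel_frame_oplus])
    moreover have "nullity_le (toeplitz s \<Lambda>) p"
    proof -
      have "nullity_le (toeplitz s (pair_sum (map g ss0))) (sum_list (map w ss0))"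
        by (rule nullity_le_pair_sum[OF carrier le]) (use forms(1)[OF ss0] minimal[OF ss0] in auto)
      then have "nullity_le (toeplitz s A) p"
        using toeplitz_nullity_equivalent(1)[OF forms(2)[OF ss0]] by (simp add: w_sum p_def)
      then show ?thesis
        by (rule toeplitz_nullity_equivalent(1)[OF pair_equivalent_sym[OF A\<Lambda>]])
    qed
    moreover define P where "P B \<longleftrightarrow> (\<exists>ts. (\<forall>y \<in> set ts. 1 \<le> symbol_index y) \<and>
      pair_equivalent m n B (pair_sum (map g ts)) \<and>
      (\<exists>ss \<in> \<S>. \<forall>r. count (mset ts) (nab r) = count (mset ss) (nab r)))" for B
    have "flexible m n \<Lambda> P"
    proof (rule flexible_equivalent[OF _ A\<Lambda>])
      show "flexible m n A P" using flex unfolding P_def .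
      show "P Y" if "P X" "pair_equivalent m n X Y" for X Y
        using that pair_equivalent_trans[OF pair_equivalent_sym[OF that(2)]] unfolding P_def by blast
    qed
    moreover have "nullity_ge (toeplitz s B) p" if "P B" for B
    proof -
      obtain ts ss' where ts: "\<And>y. y \<in> set ts \<Longrightarrow> 1 \<le> symbol_index y"
        "pair_equivalent m n B (pair_sum (map g ts))"
        and ss': "ss' \<in> \<S>" "count (mset ts) (nab s) = count (mset ss') (nab s)"
        using \<open>P B\<close> unfolding P_def by blast
      have "nullity_ge (toeplitz s (pair_sum (map g ts))) (sum_list (map w ts))"
        by (rule nullity_ge_pair_sum[OF carrier ge]) (use ts in auto)
      then have "nullity_ge (toeplitz s B) (count (mset ts) (nab s))"
        using toeplitz_nullity_equivalent(2)[OF ts(2)] by (simp add: w_sum)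
      then show ?thesis
        using nullity_ge_mono least[OF ss'(1)] by (simp add: p_def ss'(2))
    qed
    ultimately show False
      using flexible_toeplitz_contradiction[OF s] by blast
  qed
  have iy: "1 \<le> symbol_index y" using forms(1)[OF ss(1) y] .
  from kind_cases[of y] show ?thesis
  proof (elim disjE exE)
    fix r assume yr: "y = nab r"
    then have r: "1 \<le> r" using iy by (simp add: index)
    have "s \<le> r" using minimal[OF ss(1)] y yr by simp
    moreover have "\<not> s + 2 \<le> r"
    proof
      assume "s + 2 \<le> r"
      from nonzero_cokernel_nabla[OF this] show False
        using cok unfolding yr g sizes[OF r] by blast
    qed
    ultimately show ?thesis using yr by (cases "r = s") (auto simp: not_le less_Suc_eq_le le_Suc_eq)
  next
    fix r assume yr: "y = tri r"
    then have r: "1 \<le> r" using iy by (simp add: index)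
    from nonzero_cokernel_tri[OF r, of s] have False
      using cok unfolding yr g sizes[OF r] by blast
    then show ?thesis ..
  next
    fix e r assume yr: "y = Eig e r"
    then have r: "1 \<le> r" using iy by simp
    from nonzero_cokernel_identity_block[OF g(3)[OF r, of e], of s] have False
      using cok unfolding yr sizes[OF r] by blast
    then show ?thesis ..
  qed
qed

section \<open>Traces of powers\<close>

definition mat_trace :: "complex mat \<Rightarrow> complex" where
  "mat_trace A = (\<Sum>i<dim_row A. A $$ (i, i))"

lemma mat_trace_mult:
  assumes A: "A \<in> carrier_mat n m" and B: "B \<in> carrier_mat m n"
  shows "mat_trace (A * B) = (\<Sum>i<n. \<Sum>j<m. A $$ (i, j) * B $$ (j, i))"
proof -
  have "mat_trace (A * B) = (\<Sum>i<n. (A * B) $$ (i, i))"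
    using A by (simp add: mat_trace_def)
  also have "\<dots> = (\<Sum>i<n. \<Sum>j<m. A $$ (i, j) * B $$ (j, i))"
    using index_mult_mat_sum[OF A B] by (intro sum.cong) auto
  finally show ?thesis .
qed

lemma mat_trace_comm:
  assumes A: "A \<in> carrier_mat n m" and B: "B \<in> carrier_mat m n"
  shows "mat_trace (A * B) = mat_trace (B * A)"
  unfolding mat_trace_mult[OF A B] mat_trace_mult[OF B A]
  by (subst sum.swap) (simp add: mult.commute)

lemma mat_trace_add:
  assumes "A \<in> carrier_mat n n" "B \<in> carrier_mat n n"
  shows "mat_trace (A + B) = mat_trace A + mat_trace B"
  using assms by (auto simp: mat_trace_def sum.distrib)

lemma mat_trace_similar:
  assumes "similar_mat_wit A B P Q" "A \<in> carrier_mat n n"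
  shows "mat_trace A = mat_trace B"
proof -
  note w = similar_mat_witD2[OF assms(2,1)]
  have "mat_trace A = mat_trace (Q * (P * B))"
    unfolding w(3) using w by (intro mat_trace_comm[of _ n n]) auto
  also have "Q * (P * B) = Q * P * B"
    using w by (intro assoc_mult_mat[symmetric, of _ n n _ n _ n]) auto
  finally show ?thesis using w by simp
qed

lemma upper_triangular_pow:
  assumes T: "T \<in> carrier_mat n n" "upper_triangular T"
  shows "upper_triangular (T ^\<^sub>m k) \<and> (\<forall>i<n. (T ^\<^sub>m k) $$ (i, i) = (T $$ (i, i) :: complex) ^ k)"
proof (induction k)
  case 0
  then show ?case using T by auto
next
  case (Suc k)
  have Tk: "T ^\<^sub>m k \<in> carrier_mat n n" using T by auto
  have e: "(T ^\<^sub>m Suc k) $$ (i, j) = (\<Sum>h<n. (T ^\<^sub>m k) $$ (i, h) * T $$ (h, j))" if "i < n" "j < n" for i j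
    using index_mult_mat_sum[OF Tk T(1) that] by simp
  have z: "(T ^\<^sub>m k) $$ (i, h) = 0" if "h < i" "i < n" for i h
    using Suc that T by (intro upper_triangularD) auto
  have z': "T $$ (h, j) = 0" if "j < h" "h < n" for h j
    using that T by (intro upper_triangularD) auto
  have "(T ^\<^sub>m Suc k) $$ (i, j) = 0" if "j < i" "i < n" for i j
    unfolding e[OF that(2) order.strict_trans[OF that]]
    using that z[of _ i] z'[of j] by (intro sum.neutral) (metis lessThan_iff linorder_neqE_nat mult_eq_0_iff order.strict_trans)
  moreover have "(T ^\<^sub>m Suc k) $$ (i, i) = T $$ (i, i) ^ Suc k" if "i < n" for i
  proof -
    have "(T ^\<^sub>m Suc k) $$ (i, i) = (\<Sum>h<n. if h = i then (T ^\<^sub>m k) $$ (i, h) * T $$ (h, i) else 0)"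
      unfolding e[OF that that] using z[of _ i] z'[of i] that
      by (intro sum.cong) (auto simp: not_less_iff_gr_or_eq neq_iff)
    then show ?thesis using Suc that by simp
  qed
  moreover have "dim_row (T ^\<^sub>m Suc k) = n" using T by simp
  ultimately show ?case unfolding upper_triangular_def by auto
qed

text \<open>The entries \<open>es\<close> are the diagonal of a triangular form of \<open>N\<close>, the eigenvalues with multiplicity.\<close>
lemma trace_power_sums:
  assumes N: "N \<in> carrier_mat n n"
  obtains es where "set es = {x. eigenvalue N x}" "\<And>k. mat_trace (N ^\<^sub>m k) = (\<Sum>e\<leftarrow>es. e ^ k)"
proof -
  obtain as where as: "char_poly N = (\<Prod>a\<leftarrow>as. [:- a, 1:])"
    using char_poly_factorized[OF N] by blast
  obtain T where T: "T \<in> carrier_mat n n" "upper_triangular T" "similar_mat N T"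
    using schur_decomposition_exists[OF N as] by blast
  obtain P Q where wit: "similar_mat_wit N T P Q" using T(3) by (auto simp: similar_mat_def)
  define es where "es = diag_mat T"
  have "char_poly N = (\<Prod>a\<leftarrow>es. [:- a, 1:])"
    unfolding es_def char_poly_similar[OF T(3)] by (rule char_poly_upper_triangular[OF T(1,2)])
  then have "poly (char_poly N) x = 0 \<longleftrightarrow> x \<in> set es" for x
    by (auto simp: poly_prod_list prod_list_zero_iff)
  then have "set es = {x. eigenvalue N x}"
    by (auto simp: eigenvalue_root_char_poly[OF N])
  moreover have "mat_trace (N ^\<^sub>m k) = (\<Sum>e\<leftarrow>es. e ^ k)" for k
  proof -
    have Nk: "N ^\<^sub>m k \<in> carrier_mat n n" using N by simp
    have "mat_trace (N ^\<^sub>m k) = mat_trace (T ^\<^sub>m k)"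
      by (rule mat_trace_similar[OF similar_mat_wit_pow[OF wit] Nk])
    also have "\<dots> = (\<Sum>i<n. T $$ (i, i) ^ k)"
      using upper_triangular_pow[OF T(1,2), of k] T(1) by (simp add: mat_trace_def)
    also have "\<dots> = (\<Sum>e\<leftarrow>es. e ^ k)"
      using T(1) by (simp add: es_def diag_mat_def sum_list_sum_nth lessThan_atLeast0)
    finally show ?thesis .
  qed
  ultimately show ?thesis using that by blast
qed

section \<open>Derivatives of powers\<close>

text \<open>The derivative of \<open>N(t)\<^sup>k\<close> at a point where \<open>N\<close> has the value \<open>N\<close> and the derivative \<open>N'\<close>, which need
not commute with each other.\<close>
primrec pow_deriv :: "complex mat \<Rightarrow> complex mat \<Rightarrow> nat \<Rightarrow> complex mat" where
  "pow_deriv N N' 0 = 0\<^sub>m (dim_row N) (dim_row N)"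
| "pow_deriv N N' (Suc k) = pow_deriv N N' k * N + (N ^\<^sub>m k) * N'"

lemma pow_deriv_carrier:
  assumes "N \<in> carrier_mat n n" "N' \<in> carrier_mat n n"
  shows "pow_deriv N N' k \<in> carrier_mat n n"
  using assms by (induction k) auto

lemma mat_DERIV_pow:
  assumes N: "mat_DERIV n n N N'"
  shows "mat_DERIV n n (\<lambda>t. N t ^\<^sub>m k) (pow_deriv (N 0) N' k)"
proof (induction k)
  case 0
  show ?case
    using mat_DERIV_const[OF one_carrier_mat[of n]] by (simp add: mat_DERIV_dim[OF N])
next
  case (Suc k)
  show ?case using mat_DERIV_mult[OF Suc N] by simp
qed

text \<open>Under the trace the factors can be permuted cyclically, as if \<open>N\<close> and \<open>N'\<close> commuted. The induction needs
the additional factor \<open>N\<^sup>h\<close>.\<close>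
lemma trace_pow_deriv:
  assumes N: "N \<in> carrier_mat n n" "N' \<in> carrier_mat n n"
  shows "mat_trace (pow_deriv N N' k) = of_nat k * mat_trace (N ^\<^sub>m (k - 1) * N')"
proof -
  have "mat_trace (pow_deriv N N' k * N ^\<^sub>m h) = of_nat k * mat_trace (N ^\<^sub>m (k - 1 + h) * N')" for h
  proof (induction k arbitrary: h)
    case 0
    have "0\<^sub>m n n * N ^\<^sub>m h = 0\<^sub>m n n" using N by auto
    then show ?case using N by (simp add: mat_trace_def)
  next
    case (Suc k)
    define P where "P = pow_deriv N N' k"
    have P: "P \<in> carrier_mat n n" unfolding P_def by (rule pow_deriv_carrier[OF N])
    have pow: "N ^\<^sub>m j \<in> carrier_mat n n" for j using N by simp
    have comm: "N * N ^\<^sub>m h = N ^\<^sub>m Suc h"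
    proof (induction h)
      case (Suc h)
      have "N * N ^\<^sub>m Suc h = N * N ^\<^sub>m h * N"
        using assoc_mult_mat[OF N(1) pow N(1)] by simp
      then show ?case using Suc by simp
    qed (use N in simp)
    have add: "N ^\<^sub>m h * N ^\<^sub>m k = N ^\<^sub>m (k + h)"
    proof (induction k)
      case (Suc k)
      have "N ^\<^sub>m h * N ^\<^sub>m Suc k = N ^\<^sub>m h * N ^\<^sub>m k * N"
        using assoc_mult_mat[OF pow[of h] pow[of k] N(1)] by simp
      then show ?case using Suc by simp
    qed (use N in simp)
    have "mat_trace (pow_deriv N N' (Suc k) * N ^\<^sub>m h) = mat_trace (P * N * N ^\<^sub>m h) + mat_trace (N ^\<^sub>m k * N' * N ^\<^sub>m h)"
    proof -
      have c: "P * N \<in> carrier_mat n n" "N ^\<^sub>m k * N' \<in> carrier_mat n n"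
        using P N pow[of k] by (auto intro: mult_carrier_mat)
      show ?thesis
        unfolding pow_deriv.simps P_def[symmetric] add_mult_distrib_mat[OF c pow]
        by (rule mat_trace_add[OF mult_carrier_mat[OF c(1) pow] mult_carrier_mat[OF c(2) pow]])
    qed
    also have "P * N * N ^\<^sub>m h = P * N ^\<^sub>m Suc h"
      unfolding comm[symmetric] by (rule assoc_mult_mat[OF P N(1) pow])
    also have "mat_trace (P * N ^\<^sub>m Suc h) = of_nat k * mat_trace (N ^\<^sub>m (k - 1 + Suc h) * N')"
      unfolding P_def by (rule Suc)
    also have "mat_trace (N ^\<^sub>m k * N' * N ^\<^sub>m h) = mat_trace (N ^\<^sub>m h * (N ^\<^sub>m k * N'))"
      using N pow by (intro mat_trace_comm[of _ n n]) auto
    also have "N ^\<^sub>m h * (N ^\<^sub>m k * N') = N ^\<^sub>m (k + h) * N'"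
      using assoc_mult_mat[OF pow pow N(2), of h k] add by simp
    finally show ?case by (cases k) (simp_all add: algebra_simps del: pow_mat.simps)
  qed
  from this[of 0] show ?thesis
    using right_mult_one_mat[OF pow_deriv_carrier[OF N, of k]] N by simp
qed

lemma DERIV_trace_pow:
  assumes N: "mat_DERIV n n N N'"
  shows "((\<lambda>t. mat_trace (N t ^\<^sub>m k)) has_field_derivative of_nat k * mat_trace (N 0 ^\<^sub>m (k - 1) * N')) (at 0)"
proof -
  note P = mat_DERIV_pow[OF N, of k]
  have "((\<lambda>t. \<Sum>i<n. (N t ^\<^sub>m k) $$ (i, i)) has_field_derivative (\<Sum>i<n. pow_deriv (N 0) N' k $$ (i, i))) (at 0)"
    using P by (intro DERIV_sum) (auto simp: mat_DERIV_def)
  moreover have "(\<Sum>i<n. pow_deriv (N 0) N' k $$ (i, i)) = of_nat k * mat_trace (N 0 ^\<^sub>m (k - 1) * N')"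
    using trace_pow_deriv[OF mat_DERIV_carrier[OF N], of 0 k] by (simp add: mat_trace_def mat_DERIV_dim[OF P])
  moreover have "mat_trace (N t ^\<^sub>m k) = (\<Sum>i<n. (N t ^\<^sub>m k) $$ (i, i))" for t
    by (simp only: mat_trace_def mat_DERIV_dim[OF P])
  ultimately show ?thesis by simp
qed

lemma DERIV_scalar_prod_mult_vec:
  assumes F: "mat_DERIV m n F F'" and p: "p \<in> carrier_vec m" and q: "q \<in> carrier_vec n"
  shows "((\<lambda>t. p \<bullet> (F t *\<^sub>v q)) has_field_derivative p \<bullet> (F' *\<^sub>v q)) (at 0)"
proof -
  have eq: "p \<bullet> (G *\<^sub>v q) = (\<Sum>i<m. p $ i * (\<Sum>j<n. G $$ (i, j) * q $ j))" if "G \<in> carrier_mat m n" for G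
    using that index_mult_mat_vec_sum[OF that q] by (auto simp: scalar_prod_def lessThan_atLeast0)
  show ?thesis
    unfolding eq[OF mat_DERIV_carrier(1)[OF F]] eq[OF mat_DERIV_carrier(2)[OF F]]
    using F by (intro DERIV_sum DERIV_cmult DERIV_cmult_right) (auto simp: mat_DERIV_def)
qed

lemma pow_mult_eigenvector:
  assumes N: "N \<in> carrier_mat n n" and q: "q \<in> carrier_vec n" "N *\<^sub>v q = a \<cdot>\<^sub>v q"
  shows "N ^\<^sub>m k *\<^sub>v q = (a :: complex) ^ k \<cdot>\<^sub>v q"
proof (induction k)
  case 0
  then show ?case using N q by simp
next
  case (Suc k)
  have Nk: "N ^\<^sub>m k \<in> carrier_mat n n" using N by simp
  have "N ^\<^sub>m Suc k *\<^sub>v q = N ^\<^sub>m k *\<^sub>v (a \<cdot>\<^sub>v q)"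
    using assoc_mult_mat_vec[OF Nk N q(1)] q(2) by simp
  also have "\<dots> = a \<cdot>\<^sub>v (a ^ k \<cdot>\<^sub>v q)"
    using mult_mat_vec[OF Nk q(1), of a] Suc by simp
  finally show ?case by (simp add: smult_smult_assoc)
qed

lemma pow_deriv_eigenvectors:
  assumes N: "N \<in> carrier_mat n n" "N' \<in> carrier_mat n n"
    and p: "p \<in> carrier_vec n" "transpose_mat N *\<^sub>v p = a \<cdot>\<^sub>v p"
    and q: "q \<in> carrier_vec n" "N *\<^sub>v q = a \<cdot>\<^sub>v q"
  shows "p \<bullet> (pow_deriv N N' k *\<^sub>v q) = of_nat k * a ^ (k - 1) * (p \<bullet> (N' *\<^sub>v q))"
proof (induction k)
  case 0
  then show ?case using N p q zero_mat_mult_vec[OF q(1)] by simp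
next
  case (Suc k)
  define P where "P = pow_deriv N N' k"
  have P: "P \<in> carrier_mat n n" unfolding P_def by (rule pow_deriv_carrier[OF N])
  have Nk: "N ^\<^sub>m k \<in> carrier_mat n n" using N by simp
  have Nq: "N' *\<^sub>v q \<in> carrier_vec n" using N q by simp
  have Pq: "P *\<^sub>v q \<in> carrier_vec n" using P q by simp
  have "transpose_mat (N ^\<^sub>m k) *\<^sub>v p = a ^ k \<cdot>\<^sub>v p"
  proof -
    have tN: "transpose_mat N \<in> carrier_mat n n" using N by simp
    have "transpose_mat (N ^\<^sub>m k) = transpose_mat N ^\<^sub>m k"
    proof (induction k)
      case (Suc k)
      have Nk: "N ^\<^sub>m k \<in> carrier_mat n n" using N by simp
      have comm: "M * M ^\<^sub>m k = M ^\<^sub>m k * M" if "M \<in> carrier_mat n n" for M :: "complex mat"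
      proof (induction k)
        case (Suc k)
        have "M * M ^\<^sub>m Suc k = M * M ^\<^sub>m k * M"
          using assoc_mult_mat[OF that pow_carrier_mat[OF that] that] by simp
        then show ?case using Suc by simp
      qed (use that in simp)
      show ?case
        using transpose_mult[OF Nk N(1)] Suc comm[OF tN] by simp
    qed (use N in simp)
    then show ?thesis using pow_mult_eigenvector[OF tN p] by simp
  qed
  then have left: "p \<bullet> (N ^\<^sub>m k *\<^sub>v x) = a ^ k * (p \<bullet> x)" if "x \<in> carrier_vec n" for x
    using transpose_vec_mult_scalar[OF Nk that p(1)] p that by simp
  have "pow_deriv N N' (Suc k) *\<^sub>v q = (P * N) *\<^sub>v q + (N ^\<^sub>m k * N') *\<^sub>v q"
    unfolding pow_deriv.simps P_def[symmetric] using P N Nk q by (intro add_mult_distrib_mat_vec[of _ n n]) auto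
  also have "(P * N) *\<^sub>v q = a \<cdot>\<^sub>v (P *\<^sub>v q)"
    using assoc_mult_mat_vec[OF P N(1) q(1)] mult_mat_vec[OF P q(1)] q(2) by simp
  also have "(N ^\<^sub>m k * N') *\<^sub>v q = N ^\<^sub>m k *\<^sub>v (N' *\<^sub>v q)"
    by (rule assoc_mult_mat_vec[OF Nk N(2) q(1)])
  finally have "p \<bullet> (pow_deriv N N' (Suc k) *\<^sub>v q) = a * (p \<bullet> (P *\<^sub>v q)) + a ^ k * (p \<bullet> (N' *\<^sub>v q))"
    using left[OF Nq] p Pq mult_mat_vec_carrier[OF Nk Nq] by (simp add: scalar_prod_add_distrib[of _ n])
  then show ?case
    unfolding P_def Suc by (cases k) (simp_all add: algebra_simps)
qed

lemma scalar_prod_pow_jordan_chain: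
  assumes N: "N \<in> carrier_mat n n"
    and p: "p \<in> carrier_vec n" "p' \<in> carrier_vec n"
      "transpose_mat N *\<^sub>v p = a \<cdot>\<^sub>v p + p'" "transpose_mat N *\<^sub>v p' = a \<cdot>\<^sub>v p'"
    and q: "q \<in> carrier_vec n"
  shows "p \<bullet> (N ^\<^sub>m k *\<^sub>v q) = a ^ k * (p \<bullet> q) + of_nat k * a ^ (k - 1) * (p' \<bullet> (q :: complex vec))"
  using q
proof (induction k arbitrary: q)
  case 0
  then show ?case using N by simp
next
  case (Suc k)
  have Nk: "N ^\<^sub>m k \<in> carrier_mat n n" using N by simp
  have Nq: "N *\<^sub>v q \<in> carrier_vec n" using N Suc.prems by simp
  have "p \<bullet> (N *\<^sub>v q) = a * (p \<bullet> q) + p' \<bullet> q"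
    using transpose_vec_mult_scalar[OF N Suc.prems p(1)] p Suc.prems by (simp add: add_scalar_prod_distrib[of _ n])
  moreover have "p' \<bullet> (N *\<^sub>v q) = a * (p' \<bullet> q)"
    using transpose_vec_mult_scalar[OF N Suc.prems p(2)] p Suc.prems by simp
  ultimately show ?case
    using Suc.IH[OF Nq] assoc_mult_mat_vec[OF Nk N Suc.prems]
    by (cases k) (simp_all add: algebra_simps)
qed

section \<open>Hankel matrices of power sums\<close>

abbreviation spec :: "complex mat \<Rightarrow> complex set" where
  "spec N \<equiv> {x. eigenvalue N x}"

definition root_poly :: "complex set \<Rightarrow> complex poly" where
  "root_poly S = (\<Prod>x\<in>S. [:- x, 1:])"

lemma root_poly_monic_roots:
  assumes S: "finite S"
  shows "degree (root_poly S) = card S" "coeff (root_poly S) (card S) = 1"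
    "poly (root_poly S) x = 0 \<longleftrightarrow> x \<in> S"
proof -
  show deg: "degree (root_poly S) = card S"
    unfolding root_poly_def by (subst degree_prod_eq_sum_degree) auto
  have "lead_coeff (root_poly S) = 1"
    unfolding root_poly_def by (subst lead_coeff_prod) auto
  then show "coeff (root_poly S) (card S) = 1" by (simp add: deg)
  show "poly (root_poly S) x = 0 \<longleftrightarrow> x \<in> S"
    using S by (auto simp: root_poly_def poly_prod)
qed

lemma root_poly_simple_root:
  assumes S: "finite S" "a \<in> S"
  shows "poly (pderiv (root_poly S)) a \<noteq> 0"
proof -
  have "root_poly S = [:- a, 1:] * root_poly (S - {a})"
    unfolding root_poly_def using S by (rule prod.remove)
  moreover have "poly (pderiv ([:- a, 1:] * g)) a = poly g a" for g
    unfolding pderiv_mult by (simp add: pderiv_pCons)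
  ultimately have "poly (pderiv (root_poly S)) a = poly (root_poly (S - {a})) a"
    by simp
  then show ?thesis using root_poly_monic_roots(3)[of "S - {a}" a] S by simp
qed

lemma finite_spec:
  assumes "N \<in> carrier_mat n n"
  shows "finite (spec N)"
  using trace_power_sums[OF assms] by (metis List.finite_set)

lemma poly_eq_sum_lessThan:
  assumes "degree f \<le> l"
  shows "poly f (x :: complex) = (\<Sum>j<Suc l. coeff f j * x ^ j)"
proof -
  have "poly f x = (\<Sum>j\<le>degree f. coeff f j * x ^ j)" by (rule poly_altdef)
  also have "\<dots> = (\<Sum>j<Suc l. coeff f j * x ^ j)"
    using assms by (intro sum.mono_neutral_left) (auto simp: coeff_eq_0)
  finally show ?thesis .
qed

lemma sum_list_sum: "(\<Sum>e\<leftarrow>es. \<Sum>i\<in>I. f e i) = (\<Sum>i\<in>I. \<Sum>e\<leftarrow>es. (f e i :: complex))"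
  by (induction es) (auto simp: sum.distrib)

lemma sum_list_single:
  assumes "\<And>e. e \<in> set es \<Longrightarrow> e \<noteq> x \<Longrightarrow> h e = 0"
  shows "(\<Sum>e\<leftarrow>es. h e) = of_nat (count_list es x) * (h x :: complex)"
  using assms by (induction es) (auto simp: algebra_simps)

text \<open>Combining the equations with the coefficients of the polynomial that vanishes at all points except
\<open>x\<close> isolates a nonzero multiple of \<open>f(x)\<close>. So \<open>f\<close> has more roots than its degree permits.\<close>
lemma power_sum_hankel_kernel:
  fixes f :: "complex poly"
  assumes deg: "degree f < card (set es)"
    and eqs: "\<And>i. i \<le> card (set es) \<Longrightarrow> (\<Sum>e\<leftarrow>es. e ^ i * poly f e) = 0"
  shows "f = 0"
proof (rule ccontr)
  assume f: "f \<noteq> 0"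
  have "poly f x = 0" if x: "x \<in> set es" for x
  proof -
    define g where "g = root_poly (set es - {x})"
    have deg_g: "degree g \<le> card (set es)"
      using root_poly_monic_roots(1)[of "set es - {x}"] x by (simp add: g_def card_Diff_subset)
    have "(\<Sum>e\<leftarrow>es. poly g e * poly f e) = (\<Sum>e\<leftarrow>es. \<Sum>i<Suc (card (set es)). coeff g i * (e ^ i * poly f e))"
      unfolding poly_eq_sum_lessThan[OF deg_g] sum_distrib_right by (simp add: mult.assoc)
    also have "\<dots> = (\<Sum>i<Suc (card (set es)). coeff g i * (\<Sum>e\<leftarrow>es. e ^ i * poly f e))"
      unfolding sum_list_sum by (simp add: sum_list_const_mult)
    also have "\<dots> = 0" using eqs by simp
    finally have "of_nat (count_list es x) * (poly g x * poly f x) = 0"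
      using sum_list_single[of es x "\<lambda>e. poly g e * poly f e"] root_poly_monic_roots(3)[of "set es - {x}"]
      by (simp add: g_def)
    moreover have "poly g x \<noteq> 0" using root_poly_monic_roots(3)[of "set es - {x}" x] by (simp add: g_def)
    moreover have "count_list es x \<noteq> 0" using x by (simp add: count_list_0_iff)
    ultimately show ?thesis by simp
  qed
  then have "set es \<subseteq> {x. poly f x = 0}" by auto
  then have "card (set es) \<le> card {x. poly f x = 0}"
    by (intro card_mono poly_roots_finite[OF f])
  also have "\<dots> \<le> degree f" by (rule card_poly_roots_bound[OF f])
  finally show False using deg by simp
qed

text \<open>The Hankel matrix of the power sums with the row \<open>p N\<^sup>j q\<close> below it; with \<open>p = q = 0\<close> it is the plain Hankel
matrix.\<close>
definition bordered_hankel :: "nat \<Rightarrow> complex vec \<Rightarrow> complex vec \<Rightarrow> complex mat \<Rightarrow> complex mat" where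
  "bordered_hankel l p q N = mat (Suc (Suc l)) (Suc l)
     (\<lambda>(i, j). if i \<le> l then mat_trace (N ^\<^sub>m (i + j)) else p \<bullet> (N ^\<^sub>m j *\<^sub>v q))"

lemma bordered_hankel_carrier: "bordered_hankel l p q N \<in> carrier_mat (Suc (Suc l)) (Suc l)"
  by (simp add: bordered_hankel_def)

lemma trace_power_sum_poly:
  assumes "\<And>k. mat_trace (N ^\<^sub>m k) = (\<Sum>e\<leftarrow>es. e ^ k)" "degree f \<le> l"
  shows "(\<Sum>j<Suc l. mat_trace (N ^\<^sub>m (i + j)) * coeff f j) = (\<Sum>e\<leftarrow>es. e ^ i * poly f e)"
  unfolding poly_eq_sum_lessThan[OF assms(2)] assms(1) sum_distrib_left sum_list_sum
  by (intro sum.cong refl) (simp add: sum_list_const_mult[symmetric] power_add mult_ac)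

text \<open>A kernel vector is a polynomial \<open>f\<close> of degree at most \<open>l\<close>; once its leading coefficient vanishes, it has too many
roots. The leading coefficient is thus the one functional that is needed.\<close>
lemma nullity_le_bordered_hankel:
  assumes N: "N \<in> carrier_mat n n" and l: "card (spec N) = l"
  shows "nullity_le (bordered_hankel l p q N) 1"
proof -
  obtain es where es: "set es = spec N" "\<And>k. mat_trace (N ^\<^sub>m k) = (\<Sum>e\<leftarrow>es. e ^ k)"
    using trace_power_sums[OF N] by blast
  note H = bordered_hankel_carrier[of l p q N]
  define L where "L = mat 1 (Suc l) (\<lambda>(i, j). if j = l then 1 else 0 :: complex)"
  have L: "L \<in> carrier_mat 1 (Suc l)" by (simp add: L_def)
  show ?thesis
  proof (rule nullity_leI[OF H L])
    fix z assume z: "z \<in> carrier_vec (Suc l)" and Hz: "bordered_hankel l p q N *\<^sub>v z = 0\<^sub>v (Suc (Suc l))"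
      and Lz: "L *\<^sub>v z = 0\<^sub>v 1"
    have "(L *\<^sub>v z) $ 0 = (\<Sum>k<Suc l. L $$ (0, k) * z $ k)"
      by (rule index_mult_mat_vec_sum[OF L z]) simp
    also have "\<dots> = z $ l" by (simp add: L_def)
    finally have zl: "z $ l = 0" using Lz by simp
    define f where "f = (\<Sum>j<Suc l. monom (z $ j) j)"
    have cf: "coeff f k = (if k < Suc l then z $ k else 0)" for k
      unfolding f_def coeff_sum coeff_monom by (simp del: sum.lessThan_Suc)
    have deg: "degree f \<le> l" by (rule degree_le) (auto simp: cf)
    have "f = 0"
    proof (cases "l = 0")
      case True
      then show ?thesis using zl by (intro poly_eqI) (auto simp: cf)
    next
      case False
      have "coeff f i = 0" if "l - 1 < i" for i
        using that zl by (cases "i = l") (auto simp: cf)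
      then have "degree f \<le> l - 1" by (intro degree_le) auto
      then have "degree f < card (set es)" using False l es by simp
      then show ?thesis
      proof (rule power_sum_hankel_kernel)
        fix i assume "i \<le> card (set es)"
        then have i: "i \<le> l" using l es by simp
        have "(\<Sum>e\<leftarrow>es. e ^ i * poly f e) = (\<Sum>j<Suc l. mat_trace (N ^\<^sub>m (i + j)) * z $ j)"
          unfolding trace_power_sum_poly[OF es(2) deg, symmetric] by (intro sum.cong) (auto simp: cf)
        also have "\<dots> = (bordered_hankel l p q N *\<^sub>v z) $ i"
          using i unfolding index_mult_mat_vec_sum[OF H z less_SucI[OF le_imp_less_Suc[OF i]]]
          by (intro sum.cong) (auto simp: bordered_hankel_def)
        finally show "(\<Sum>e\<leftarrow>es. e ^ i * poly f e) = 0" using Hz i by simp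
      qed
    qed
    then have "z $ k = 0" if "k < Suc l" for k using cf[of k] that by simp
    then show "z = 0\<^sub>v (Suc l)" using z by (intro eq_vecI) auto
  qed
qed

definition root_vec :: "complex mat \<Rightarrow> complex vec" where
  "root_vec N = vec (Suc (card (spec N))) (coeff (root_poly (spec N)))"

lemma power_sum_root_poly:
  assumes N: "N \<in> carrier_mat n n"
  shows "(\<Sum>j<Suc (card (spec N)). mat_trace (N ^\<^sub>m (i + j)) * coeff (root_poly (spec N)) j) = 0"
proof -
  obtain es where es: "set es = spec N" "\<And>k. mat_trace (N ^\<^sub>m k) = (\<Sum>e\<leftarrow>es. e ^ k)"
    using trace_power_sums[OF N] by blast
  note root = root_poly_monic_roots[OF finite_spec[OF N]]
  have "(\<Sum>e\<leftarrow>es. e ^ i * poly (root_poly (spec N)) e) = (\<Sum>e\<leftarrow>es. 0)"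
    using root(3) es(1) by (intro arg_cong[where f = sum_list] map_cong) auto
  then show ?thesis
    using trace_power_sum_poly[OF es(2) eq_imp_le[OF root(1)], of i] by simp
qed

lemma bordered_hankel_root_vec:
  assumes N: "N \<in> carrier_mat n n" and l: "card (spec N) = l"
    and border: "(\<Sum>j<Suc l. (p \<bullet> (N ^\<^sub>m j *\<^sub>v q)) * coeff (root_poly (spec N)) j) = 0"
  shows "bordered_hankel l p q N *\<^sub>v root_vec N = 0\<^sub>v (Suc (Suc l))"
proof (rule eq_vecI)
  note H = bordered_hankel_carrier[of l p q N]
  have v: "root_vec N \<in> carrier_vec (Suc l)" by (simp add: root_vec_def l)
  fix i assume "i < dim_vec (0\<^sub>v (Suc (Suc l)))"
  then have i: "i < Suc (Suc l)" by simp
  have "(bordered_hankel l p q N *\<^sub>v root_vec N) $ i = (\<Sum>j<Suc l.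
    (if i \<le> l then mat_trace (N ^\<^sub>m (i + j)) else p \<bullet> (N ^\<^sub>m j *\<^sub>v q)) * coeff (root_poly (spec N)) j)"
    using i unfolding index_mult_mat_vec_sum[OF H v i]
    by (intro sum.cong) (auto simp: bordered_hankel_def root_vec_def l)
  also have "\<dots> = 0"
    using border power_sum_root_poly[OF N, unfolded l, of i] by (cases "i \<le> l") simp_all
  finally show "(bordered_hankel l p q N *\<^sub>v root_vec N) $ i = 0\<^sub>v (Suc (Suc l)) $ i" using i by simp
qed (simp add: bordered_hankel_def)

lemma nullity_ge_bordered_hankel:
  assumes N: "N \<in> carrier_mat n n" and l: "card (spec N) = l"
    and border: "(\<Sum>j<Suc l. (p \<bullet> (N ^\<^sub>m j *\<^sub>v q)) * coeff (root_poly (spec N)) j) = 0"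
  shows "nullity_ge (bordered_hankel l p q N) 1"
proof (rule nullity_ge_1I[OF bordered_hankel_carrier _ bordered_hankel_root_vec[OF N l border]])
  show "root_vec N \<in> carrier_vec (Suc l)" by (simp add: root_vec_def l)
  have "root_vec N $ l = 1"
    using root_poly_monic_roots(2)[OF finite_spec[OF N]] by (simp add: root_vec_def l)
  then show "root_vec N \<noteq> 0\<^sub>v (Suc l)" by auto
qed

text \<open>\<open>constant_rank_tangent\<close> for the bordered Hankel matrix: the kernel at \<open>t = 0\<close> is a line, and near \<open>0\<close>
it stays nonzero because the number of distinct eigenvalues does not change. \<open>(x, y)\<close> is a vector that annihilates
the matrix from the left.\<close>
lemma constant_spectrum_tangent:
  assumes N: "mat_DERIV n n N N'" and p: "p \<in> carrier_vec n" and q: "q \<in> carrier_vec n"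
    and card: "card (spec (N 0)) = l"
    and const: "\<forall>\<^sub>F t in nhds 0. card (spec (N t)) = l \<and>
      (\<Sum>j<Suc l. (p \<bullet> (N t ^\<^sub>m j *\<^sub>v q)) * coeff (root_poly (spec (N t))) j) = 0"
    and left: "\<And>j. j \<le> l \<Longrightarrow> (\<Sum>i<Suc l. x i * mat_trace (N 0 ^\<^sub>m (i + j))) + y * (p \<bullet> (N 0 ^\<^sub>m j *\<^sub>v q)) = 0"
    and w: "w = coeff (root_poly (spec (N 0)))"
  shows "(\<Sum>i<Suc l. \<Sum>j<Suc l. x i * (of_nat (i + j) * mat_trace (N 0 ^\<^sub>m (i + j - 1) * N')) * w j) +
    y * (\<Sum>j<Suc l. (p \<bullet> (pow_deriv (N 0) N' j *\<^sub>v q)) * w j) = 0"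
proof -
  define H' where "H' = mat (Suc (Suc l)) (Suc l) (\<lambda>(i, j).
    if i \<le> l then of_nat (i + j) * mat_trace (N 0 ^\<^sub>m (i + j - 1) * N') else p \<bullet> (pow_deriv (N 0) N' j *\<^sub>v q))"
  note N0 = mat_DERIV_carrier(1)[OF N]
  have DH: "mat_DERIV (Suc (Suc l)) (Suc l) (\<lambda>t. bordered_hankel l p q (N t)) H'"
    unfolding mat_DERIV_def
  proof (intro conjI allI impI)
    fix i j assume ij: "i < Suc (Suc l)" "j < Suc l"
    show "((\<lambda>t. bordered_hankel l p q (N t) $$ (i, j)) has_field_derivative H' $$ (i, j)) (at 0)"
      using ij DERIV_trace_pow[OF N, of "i + j"] DERIV_scalar_prod_mult_vec[OF mat_DERIV_pow[OF N] p q, of j]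
      by (cases "i \<le> l") (simp_all add: bordered_hankel_def H'_def)
  qed (simp_all add: bordered_hankel_def H'_def)
  define u where "u = vec (Suc (Suc l)) (\<lambda>i. if i \<le> l then x i else y)"
  define v where "v = root_vec (N 0)"
  have u: "u \<in> carrier_vec (Suc (Suc l))" by (simp add: u_def)
  have v: "v \<in> carrier_vec (Suc l)" by (simp add: v_def root_vec_def card)
  have vj: "v $ j = w j" if "j < Suc l" for j
    using that by (simp add: v_def root_vec_def card w)
  have split: "(\<Sum>i<Suc (Suc l). u $ i * h i) = (\<Sum>i<Suc l. x i * h i) + y * h (Suc l)" for h
    by (simp add: u_def)
  have const0: "(\<Sum>j<Suc l. (p \<bullet> (N 0 ^\<^sub>m j *\<^sub>v q)) * coeff (root_poly (spec (N 0))) j) = 0"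
    using eventually_nhds_x_imp_x[OF const] by simp
  have ge: "\<forall>\<^sub>F t in nhds 0. nullity_ge (bordered_hankel l p q (N t)) 1"
    using const by eventually_elim (use nullity_ge_bordered_hankel[OF N0] in auto)
  have "u \<bullet> (H' *\<^sub>v v) = 0"
  proof (rule constant_rank_tangent[OF DH ge nullity_le_bordered_hankel[OF N0 card] u _ v])
    show "bordered_hankel l p q (N 0) *\<^sub>v v = 0\<^sub>v (Suc (Suc l))"
      unfolding v_def by (rule bordered_hankel_root_vec[OF N0 card const0])
    define H where "H = bordered_hankel l p q (N 0)"
    have H: "transpose_mat H \<in> carrier_mat (Suc l) (Suc (Suc l))"
      using bordered_hankel_carrier[of l p q "N 0"] by (simp add: H_def)
    have "transpose_mat H *\<^sub>v u = 0\<^sub>v (Suc l)"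
    proof (rule eq_vecI)
      fix j assume "j < dim_vec (0\<^sub>v (Suc l))"
      then have j: "j < Suc l" by simp
      have "(transpose_mat H *\<^sub>v u) $ j = (\<Sum>i<Suc (Suc l). u $ i * H $$ (i, j))"
        unfolding index_mult_mat_vec_sum[OF H u j] using H j by (intro sum.cong) (auto simp: mult.commute)
      also have "\<dots> = (\<Sum>i<Suc l. x i * mat_trace (N 0 ^\<^sub>m (i + j))) + y * (p \<bullet> (N 0 ^\<^sub>m j *\<^sub>v q))"
        unfolding split using j by (intro arg_cong2[where f = "(+)"] sum.cong) (auto simp: H_def bordered_hankel_def)
      finally show "(transpose_mat H *\<^sub>v u) $ j = 0\<^sub>v (Suc l) $ j" using left[of j] j by simp
    qed (use H in auto)
    then show "transpose_mat (bordered_hankel l p q (N 0)) *\<^sub>v u = 0\<^sub>v (Suc l)" by (simp add: H_def)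
  qed
  moreover have "u \<bullet> (H' *\<^sub>v v) = (\<Sum>i<Suc (Suc l). u $ i * (\<Sum>j<Suc l. H' $$ (i, j) * w j))"
  proof -
    have H': "H' \<in> carrier_mat (Suc (Suc l)) (Suc l)" by (simp add: H'_def)
    have "u \<bullet> (H' *\<^sub>v v) = (\<Sum>i<Suc (Suc l). u $ i * (H' *\<^sub>v v) $ i)"
      using H' by (auto simp: scalar_prod_def lessThan_atLeast0 simp del: sum.op_ivl_Suc)
    also have "\<dots> = (\<Sum>i<Suc (Suc l). u $ i * (\<Sum>j<Suc l. H' $$ (i, j) * w j))"
      using index_mult_mat_vec_sum[OF H' v] vj by (intro sum.cong) (auto simp del: sum.lessThan_Suc)
    finally show ?thesis .
  qed
  moreover have "(\<Sum>i<Suc l. x i * (\<Sum>j<Suc l. H' $$ (i, j) * w j)) =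
    (\<Sum>i<Suc l. \<Sum>j<Suc l. x i * (of_nat (i + j) * mat_trace (N 0 ^\<^sub>m (i + j - 1) * N')) * w j)"
    unfolding sum_distrib_left by (intro sum.cong) (auto simp: H'_def)
  moreover have "(\<Sum>j<Suc l. H' $$ (Suc l, j) * w j) = (\<Sum>j<Suc l. (p \<bullet> (pow_deriv (N 0) N' j *\<^sub>v q)) * w j)"
    by (intro sum.cong) (auto simp: H'_def)
  ultimately show ?thesis unfolding split by simp
qed

text \<open>Leibniz' rule for the second derivative of \<open>X\<^sup>i X\<^sup>j\<close> at \<open>a\<close>.\<close>
lemma second_derivative_power_add:
  fixes a :: complex
  shows "of_nat (i + j) * (of_nat (i + j - 1) * a ^ (i + j - 1 - 1)) =
    of_nat i * of_nat (i - 1) * a ^ (i - 1 - 1) * a ^ j + 2 * (of_nat i * a ^ (i - 1)) * (of_nat j * a ^ (j - 1)) +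
    a ^ i * (of_nat j * of_nat (j - 1) * a ^ (j - 1 - 1))"
proof -
  have "k = 0 \<or> k = Suc 0 \<or> (\<exists>k'. k = Suc (Suc k'))" for k :: nat
    by (metis not0_implies_Suc)
  from this[of i] this[of j] show ?thesis
    by (elim disjE exE) (simp_all add: algebra_simps power_add)
qed

lemma poly_pderiv_eq_sum_lessThan:
  assumes "degree f \<le> l"
  shows "poly (pderiv f) (a :: complex) = (\<Sum>j<Suc l. coeff f j * (of_nat j * a ^ (j - 1)))"
proof -
  have "((\<lambda>x. poly f x) has_field_derivative (\<Sum>j<Suc l. coeff f j * (of_nat j * a ^ (j - 1)))) (at a)"
    unfolding poly_eq_sum_lessThan[OF assms]
    by (intro DERIV_sum DERIV_cmult) (auto intro!: derivative_eq_intros)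
  then show ?thesis using poly_DERIV DERIV_unique by blast
qed

definition rank_one :: "nat \<Rightarrow> complex vec \<Rightarrow> complex vec \<Rightarrow> complex mat" where
  "rank_one n q p = mat n n (\<lambda>(i, j). q $ i * p $ j)"

lemma trace_mult_rank_one:
  assumes M: "M \<in> carrier_mat n n" and p: "p \<in> carrier_vec n" and q: "q \<in> carrier_vec n"
  shows "mat_trace (M * rank_one n q p) = p \<bullet> (M *\<^sub>v q)"
proof -
  have "p \<bullet> (M *\<^sub>v q) = (\<Sum>i<n. p $ i * (M *\<^sub>v q) $ i)"
    using M by (auto simp: scalar_prod_def lessThan_atLeast0)
  also have "\<dots> = (\<Sum>i<n. \<Sum>j<n. M $$ (i, j) * (q $ j * p $ i))"
    using index_mult_mat_vec_sum[OF M q] by (intro sum.cong) (auto simp: sum_distrib_left mult_ac)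
  also have "\<dots> = mat_trace (M * rank_one n q p)"
    by (subst mat_trace_mult[OF M]) (auto simp: rank_one_def)
  finally show ?thesis ..
qed

text \<open>In the direction \<open>q p\<^sup>T\<close> the trace of \<open>N\<^sup>k N'\<close> is \<open>p N\<^sup>k q = k a\<^sup>k\<^sup>-\<^sup>1\<close>, so the derivative of the
power sum \<open>tr N\<^sup>k\<close> is \<open>k (k - 1) a\<^sup>k\<^sup>-\<^sup>2\<close>, the value at \<open>a\<close> of the second derivative of \<open>X\<^sup>k\<close>. Applied
to the coefficients of \<open>w\<close> from both sides, the tangency condition becomes
\<open>(w\<^sup>2)''(a) = 2 w'(a)\<^sup>2 = 0\<close>, but \<open>a\<close> is a simple root of \<open>w\<close>.\<close>
lemma constant_spectrum_no_jordan_chain: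
  assumes N: "mat_DERIV n n N (rank_one n q p)"
    and const: "\<forall>\<^sub>F t in nhds 0. card (spec (N t)) = card (spec (N 0))"
    and p: "p \<in> carrier_vec n" "p' \<in> carrier_vec n"
      "transpose_mat (N 0) *\<^sub>v p = a \<cdot>\<^sub>v p + p'" "transpose_mat (N 0) *\<^sub>v p' = a \<cdot>\<^sub>v p'"
    and q: "q \<in> carrier_vec n" "p \<bullet> q = 0" "p' \<bullet> q = 1"
  shows False
proof -
  define l where "l = card (spec (N 0))"
  define w where "w = coeff (root_poly (spec (N 0)))"
  note N0 = mat_DERIV_carrier(1)[OF N, of 0]
  note root = root_poly_monic_roots[OF finite_spec[OF N0]]
  have deg: "degree (root_poly (spec (N 0))) \<le> l" by (simp add: root l_def)
  have a: "a \<in> spec (N 0)"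
  proof -
    have "p' \<noteq> 0\<^sub>v n" using q by auto
    then have "eigenvector (transpose_mat (N 0)) p' a"
      using p N0 by (simp add: eigenvector_def)
    then have "eigenvalue (transpose_mat (N 0)) a" by (auto simp: eigenvalue_def)
    then show ?thesis
      using eigenvalue_root_char_poly[of "transpose_mat (N 0)" n a] eigenvalue_root_char_poly[OF N0, of a] N0
      by (simp add: char_poly_transpose_mat[OF N0])
  qed
  have tr: "mat_trace (N 0 ^\<^sub>m k * rank_one n q p) = of_nat k * a ^ (k - 1)" for k
    using trace_mult_rank_one[OF pow_carrier_mat[OF N0] p(1) q(1)]
      scalar_prod_pow_jordan_chain[OF N0 p q(1), of k] q by simp
  have zero: "\<forall>\<^sub>F t in nhds 0. card (spec (N t)) = l \<and>
      (\<Sum>j<Suc l. (0\<^sub>v n \<bullet> (N t ^\<^sub>m j *\<^sub>v 0\<^sub>v n)) * coeff (root_poly (spec (N t))) j) = 0"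
    using const
  proof eventually_elim
    case (elim t)
    have "0\<^sub>v n \<bullet> (N t ^\<^sub>m j *\<^sub>v 0\<^sub>v n) = 0" for j
      using mult_mat_vec_carrier[OF pow_carrier_mat[OF mat_DERIV_carrier(1)[OF N]] zero_carrier_vec]
      by simp
    then show ?case using elim by (simp add: l_def)
  qed
  have "(\<Sum>i<Suc l. \<Sum>j<Suc l. w i * (of_nat (i + j) * mat_trace (N 0 ^\<^sub>m (i + j - 1) * rank_one n q p)) * w j) = 0"
  proof -
    have "(\<Sum>i<Suc l. w i * mat_trace (N 0 ^\<^sub>m (i + j))) = 0" for j
      using power_sum_root_poly[OF N0, of j] by (simp add: w_def l_def mult.commute add.commute)
    then show ?thesis
      using constant_spectrum_tangent[OF N zero_carrier_vec zero_carrier_vec l_def[symmetric] zero _ w_def, of w 0]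
      by simp
  qed
  then have "0 = (\<Sum>i<Suc l. \<Sum>j<Suc l. w i * (of_nat (i + j) * (of_nat (i + j - 1) * a ^ (i + j - 1 - 1))) * w j)"
    by (simp only: tr)
  also have "\<dots> = (\<Sum>i<Suc l. \<Sum>j<Suc l.
      (w i * (of_nat i * of_nat (i - 1) * a ^ (i - 1 - 1))) * (w j * a ^ j) +
      2 * (w i * (of_nat i * a ^ (i - 1))) * (w j * (of_nat j * a ^ (j - 1))) +
      (w i * a ^ i) * (w j * (of_nat j * of_nat (j - 1) * a ^ (j - 1 - 1))))"
    unfolding second_derivative_power_add by (intro sum.cong refl) (simp only: algebra_simps)
  also have "\<dots> = (\<Sum>i<Suc l. w i * (of_nat i * of_nat (i - 1) * a ^ (i - 1 - 1))) * (\<Sum>j<Suc l. w j * a ^ j) +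
      2 * (\<Sum>i<Suc l. w i * (of_nat i * a ^ (i - 1))) * (\<Sum>j<Suc l. w j * (of_nat j * a ^ (j - 1))) +
      (\<Sum>i<Suc l. w i * a ^ i) * (\<Sum>j<Suc l. w j * (of_nat j * of_nat (j - 1) * a ^ (j - 1 - 1)))"
    unfolding sum.distrib sum_product[symmetric] sum_distrib_left by (simp only: sum_product)
  also have "(\<Sum>i<Suc l. w i * a ^ i) = 0"
    using poly_eq_sum_lessThan[OF deg, of a] root(3)[of a] a by (simp only: w_def)
  also have "(\<Sum>i<Suc l. w i * (of_nat i * a ^ (i - 1))) = poly (pderiv (root_poly (spec (N 0)))) a"
    using poly_pderiv_eq_sum_lessThan[OF deg, of a] by (simp only: w_def)
  finally show False
    using root_poly_simple_root[OF finite_spec[OF N0] a] by simp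
qed

text \<open>The border row pairs with the derivative of \<open>w(N)\<close>: between eigenvectors \<open>p\<close>, \<open>q\<close> for the same \<open>a\<close> the
derivative of \<open>p N\<^sup>j q\<close> is \<open>j a\<^sup>j\<^sup>-\<^sup>1\<close>, so the tangency condition reads \<open>w'(a) = 0\<close>.\<close>
lemma constant_spectrum_no_double_eigenvalue:
  assumes N: "mat_DERIV n n N N'"
    and p: "p \<in> carrier_vec n" "transpose_mat (N 0) *\<^sub>v p = a \<cdot>\<^sub>v p"
    and q: "q \<in> carrier_vec n" "N 0 *\<^sub>v q = a \<cdot>\<^sub>v q"
    and pq: "p \<bullet> q = 0" "p \<bullet> (N' *\<^sub>v q) = 1" and a: "a \<in> spec (N 0)"
    and const: "\<forall>\<^sub>F t in nhds 0. card (spec (N t)) = card (spec (N 0)) \<and>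
      (\<Sum>j<Suc (card (spec (N t))). (p \<bullet> (N t ^\<^sub>m j *\<^sub>v q)) * coeff (root_poly (spec (N t))) j) = 0"
  shows False
proof -
  define l where "l = card (spec (N 0))"
  define w where "w = coeff (root_poly (spec (N 0)))"
  note N0 = mat_DERIV_carrier(1)[OF N, of 0]
  note root = root_poly_monic_roots[OF finite_spec[OF N0]]
  have deg: "degree (root_poly (spec (N 0))) \<le> l" by (simp add: root l_def)
  have const': "\<forall>\<^sub>F t in nhds 0. card (spec (N t)) = l \<and>
      (\<Sum>j<Suc l. (p \<bullet> (N t ^\<^sub>m j *\<^sub>v q)) * coeff (root_poly (spec (N t))) j) = 0"
    using const
  proof eventually_elim
    case (elim t)
    then have "card (spec (N t)) = l" by (simp add: l_def)
    with elim show ?case by metis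
  qed
  have "p \<bullet> (N 0 ^\<^sub>m j *\<^sub>v q) = 0" for j
    using pow_mult_eigenvector[OF N0 q, of j] p q pq by simp
  then have "(\<Sum>j<Suc l. (p \<bullet> (pow_deriv (N 0) N' j *\<^sub>v q)) * w j) = 0"
    using constant_spectrum_tangent[OF N p(1) q(1) l_def[symmetric] const' _ w_def, of "\<lambda>i. 0" 1]
    by (simp del: sum.lessThan_Suc)
  moreover have "p \<bullet> (pow_deriv (N 0) N' j *\<^sub>v q) = of_nat j * a ^ (j - 1)" for j
    using pow_deriv_eigenvectors[OF N0 mat_DERIV_carrier(2)[OF N] p q, of j] pq by simp
  ultimately have "poly (pderiv (root_poly (spec (N 0)))) a = 0"
    unfolding poly_pderiv_eq_sum_lessThan[OF deg] by (simp add: w_def mult.commute del: sum.lessThan_Suc)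
  then show False
    using root_poly_simple_root[OF finite_spec[OF N0] a] by simp
qed

section \<open>Regular pencils\<close>

definition mix :: "complex \<Rightarrow> mat_pair \<Rightarrow> complex mat" where
  "mix c B = c \<cdot>\<^sub>m fst B + snd B"

lemma mix_carrier: "B \<in> mat_pairs m n \<Longrightarrow> mix c B \<in> carrier_mat m n"
  by (auto simp: mix_def mat_pairs_def)

lemma det_nonzero_inverse:
  assumes M: "M \<in> carrier_mat n n" and det: "det M \<noteq> (0 :: complex)"
  obtains W where "W \<in> carrier_mat n n" "W * M = 1\<^sub>m n" "M * W = 1\<^sub>m n"
proof -
  define W where "W = (1 / det M) \<cdot>\<^sub>m adj_mat M"
  note adj = adj_mat[OF M]
  have "W * M = (1 / det M) \<cdot>\<^sub>m (adj_mat M * M)"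
    unfolding W_def by (rule mult_smult_assoc_mat[OF adj(1) M])
  moreover have "M * W = (1 / det M) \<cdot>\<^sub>m (M * adj_mat M)"
    unfolding W_def by (rule mult_smult_distrib[OF M adj(1)])
  ultimately have "W * M = 1\<^sub>m n" "M * W = 1\<^sub>m n"
    unfolding adj(2,3) using det by (auto intro!: eq_matI)
  then show ?thesis using that[of W] adj(1) by (simp add: W_def)
qed

lemma det_nonzero_cancel:
  fixes M X Y :: "complex mat"
  assumes M: "M \<in> carrier_mat n n" "det M \<noteq> 0" and X: "X \<in> carrier_mat n k" and Y: "Y \<in> carrier_mat n k"
    and eq: "M * X = M * Y"
  shows "X = Y"
proof -
  obtain W where W: "W \<in> carrier_mat n n" "W * M = 1\<^sub>m n"
    using det_nonzero_inverse[OF M] by blast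
  have "Z = W * (M * Z)" if "Z \<in> carrier_mat n k" for Z
    using assoc_mult_mat[OF W(1) M(1) that] W that by simp
  then show ?thesis using X Y eq by metis
qed

text \<open>Along directions with \<open>D\<^sub>2 = - c D\<^sub>1\<close> the matrix \<open>c \<gamma>\<^sub>1 + \<gamma>\<^sub>2\<close> is stationary to first order, so the derivative
of the quotient is \<open>(c A\<^sub>1 + A\<^sub>2)\<^sup>-\<^sup>1 D\<^sub>1\<close>, and this can be made any matrix.\<close>
lemma flexible_quotient:
  assumes flex: "flexible n n A P" and A: "A \<in> mat_pairs n n" and det: "det (mix c A) \<noteq> 0"
    and N0: "N0 \<in> carrier_mat n n" "mix c A * N0 = fst A" and N': "N' \<in> carrier_mat n n"
  obtains N where "mat_DERIV n n N N'" "N 0 = N0"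
    "\<forall>\<^sub>F t in nhds 0. \<exists>B \<in> mat_pairs n n. P B \<and> det (mix c B) \<noteq> 0 \<and> mix c B * N t = fst B"
proof -
  define D where "D = mix c A * N'"
  have MA: "mix c A \<in> carrier_mat n n" by (rule mix_carrier[OF A])
  have D: "D \<in> carrier_mat n n" using MA N' by (simp add: D_def)
  then have "(- c) \<cdot>\<^sub>m D \<in> carrier_mat n n" by simp
  then obtain \<gamma>1 \<gamma>2 where \<gamma>: "mat_DERIV n n \<gamma>1 D" "mat_DERIV n n \<gamma>2 ((- c) \<cdot>\<^sub>m D)" "(\<gamma>1 0, \<gamma>2 0) = A"
    "\<And>t. P (\<gamma>1 t, \<gamma>2 t)"
    using flex D unfolding flexible_def by blast
  define M where "M t = mix c (\<gamma>1 t, \<gamma>2 t)" for t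
  define N where "N t = (1 / det (M t)) \<cdot>\<^sub>m (adj_mat (M t) * \<gamma>1 t)" for t
  have "c \<cdot>\<^sub>m D + (- c) \<cdot>\<^sub>m D = 0\<^sub>m n n"
    using D by (intro eq_matI) auto
  then have MD: "mat_DERIV n n M (0\<^sub>m n n)"
    using mat_DERIV_add[OF mat_DERIV_smult[OF \<gamma>(1), of c] \<gamma>(2)] unfolding M_def mix_def by simp
  note Mc = mat_DERIV_carrier(1)[OF MD] and \<gamma>c = mat_DERIV_carrier(1)[OF \<gamma>(1)]
  have M0: "M 0 = mix c A" using \<gamma>(3) by (simp add: M_def)
  have adj: "adj_mat (M t) \<in> carrier_mat n n" for t by (rule adj_mat(1)[OF Mc])
  have Nc: "N t \<in> carrier_mat n n" for t
    using mult_carrier_mat[OF adj[of t] \<gamma>c[of t]] by (simp add: N_def)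
  have MN: "M t * N t = \<gamma>1 t" if "det (M t) \<noteq> 0" for t
  proof -
    have "M t * N t = (1 / det (M t)) \<cdot>\<^sub>m (M t * (adj_mat (M t) * \<gamma>1 t))"
      unfolding N_def by (rule mult_smult_distrib[OF Mc mult_carrier_mat[OF adj \<gamma>c]])
    also have "M t * (adj_mat (M t) * \<gamma>1 t) = M t * adj_mat (M t) * \<gamma>1 t"
      using assoc_mult_mat[OF Mc adj \<gamma>c] by simp
    also have "\<dots> = (det (M t) \<cdot>\<^sub>m 1\<^sub>m n) * \<gamma>1 t" unfolding adj_mat(2)[OF Mc] ..
    also have "\<dots> = det (M t) \<cdot>\<^sub>m \<gamma>1 t"
      using mult_smult_assoc_mat[OF one_carrier_mat \<gamma>c] \<gamma>c[of t] by simp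
    finally show ?thesis using that \<gamma>c[of t] by (auto intro!: eq_matI)
  qed
  have det0: "det (M 0) \<noteq> 0" using det M0 by simp
  have "\<exists>d. ((\<lambda>t. N t $$ (i, j)) has_field_derivative d) (at 0)" if ij: "i < n" "j < n" for i j
  proof -
    have dims: "dim_row (adj_mat (M t)) = n" "dim_col (\<gamma>1 t) = n" for t
      using adj[of t] \<gamma>c[of t] by auto
    have "(\<lambda>t. 1 / det (M t) * (\<Sum>k<n. adj_mat (M t) $$ (i, k) * \<gamma>1 t $$ (k, j))) field_differentiable (at 0)"
      using ij det0 by (intro field_differentiable_mult field_differentiable_divide field_differentiable_sum
        det_field_differentiable[OF Mc] adj_mat_field_differentiable[OF Mc]
        mat_DERIV_field_differentiable[OF MD] mat_DERIV_field_differentiable[OF \<gamma>(1)]) auto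
    moreover have "N t $$ (i, j) = 1 / det (M t) * (\<Sum>k<n. adj_mat (M t) $$ (i, k) * \<gamma>1 t $$ (k, j))" for t
      using index_mult_mat_sum[OF adj \<gamma>c ij, of t t] ij unfolding N_def
      by (subst index_smult_mat(1)) (simp_all add: dims)
    ultimately show ?thesis by (simp add: field_differentiable_def)
  qed
  then obtain d where d: "\<And>i j. i < n \<Longrightarrow> j < n \<Longrightarrow> ((\<lambda>t. N t $$ (i, j)) has_field_derivative d i j) (at 0)"
    by metis
  define Nd where "Nd = mat n n (\<lambda>(i, j). d i j)"
  have Nd: "Nd \<in> carrier_mat n n" by (simp add: Nd_def)
  have ND: "mat_DERIV n n N Nd"
    using d Nc by (auto simp: mat_DERIV_def Nd_def)
  have ev: "\<forall>\<^sub>F t in nhds 0. det (M t) \<noteq> 0" by (rule mat_DERIV_det_nonzero[OF MD det0])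
  have "M 0 * Nd = D"
  proof (rule eq_matI)
    fix i j assume "i < dim_row D" "j < dim_col D"
    then have ij: "i < n" "j < n" using D by auto
    have "mat_DERIV n n (\<lambda>t. M t * N t) (M 0 * Nd)"
      using mat_DERIV_mult[OF MD ND] Nc[of 0] Mc[of 0] Nd by simp
    then have "((\<lambda>t. (M t * N t) $$ (i, j)) has_field_derivative (M 0 * Nd) $$ (i, j)) (at 0)"
      using ij by (simp add: mat_DERIV_def)
    moreover have "\<forall>\<^sub>F t in nhds 0. (M t * N t) $$ (i, j) = \<gamma>1 t $$ (i, j)"
      using ev by eventually_elim (simp add: MN)
    ultimately have "((\<lambda>t. \<gamma>1 t $$ (i, j)) has_field_derivative (M 0 * Nd) $$ (i, j)) (at 0)"
      using DERIV_cong_ev[OF refl _ refl, of "\<lambda>t. (M t * N t) $$ (i, j)" "\<lambda>t. \<gamma>1 t $$ (i, j)" 0] by simp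
    moreover have "((\<lambda>t. \<gamma>1 t $$ (i, j)) has_field_derivative D $$ (i, j)) (at 0)"
      using \<gamma>(1) ij by (simp add: mat_DERIV_def)
    ultimately show "(M 0 * Nd) $$ (i, j) = D $$ (i, j)" by (rule DERIV_unique)
  qed (use Mc[of 0] Nd D in auto)
  then have "Nd = N'"
    using det_nonzero_cancel[OF Mc det0 Nd N'] by (simp add: M0 D_def)
  moreover have "N 0 = N0"
    using det_nonzero_cancel[OF Mc det0 Nc N0(1)] MN[OF det0] N0(2) \<gamma>(3) by (auto simp: M0)
  moreover have "\<forall>\<^sub>F t in nhds 0. \<exists>B \<in> mat_pairs n n. P B \<and> det (mix c B) \<noteq> 0 \<and> mix c B * N t = fst B"
    using ev
  proof eventually_elim
    case (elim t)
    have "(\<gamma>1 t, \<gamma>2 t) \<in> mat_pairs n n"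
      using \<gamma>c mat_DERIV_carrier(1)[OF \<gamma>(2)] by (simp add: mat_pairs_def)
    then show ?case using elim MN[OF elim] \<gamma>(4) by (intro bexI[of _ "(\<gamma>1 t, \<gamma>2 t)"]) (simp_all add: M_def)
  qed
  ultimately show ?thesis using that ND by simp
qed

subsection \<open>The spectrum of the quotient\<close>

fun symbol_det :: "complex \<Rightarrow> complex \<Rightarrow> eigval symbol \<Rightarrow> complex" where
  "symbol_det \<alpha> \<beta> (Eig (FinEV l) r) = (\<alpha> + \<beta> * l) ^ r"
| "symbol_det \<alpha> \<beta> (Eig InfEV r) = \<beta> ^ r"
| "symbol_det \<alpha> \<beta> _ = 1"

definition only_eigs :: "'e symbol list \<Rightarrow> bool" where
  "only_eigs ss \<longleftrightarrow> (\<forall>y \<in> set ss. \<exists>e r. y = Eig e r \<and> 1 \<le> r)"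

lemma eig_pair_carrier: "symbol_pair (Eig e r) \<in> mat_pairs r r"
  by (cases e) (auto simp: mat_pairs_def)

lemma direct_sum_pair_sum: "direct_sum ss = pair_sum (map symbol_pair ss)"
  by (simp add: direct_sum_def pair_sum_def)

lemma direct_sum_carrier:
  assumes "only_eigs ss"
  shows "direct_sum ss \<in> mat_pairs (sum_list (map symbol_index ss)) (sum_list (map symbol_index ss))"
  unfolding direct_sum_pair_sum using assms
  by (intro pair_sum_carrier) (auto simp: only_eigs_def eig_pair_carrier simp del: symbol_pair.simps)

lemma det_symbol_pair: 
  "det (\<alpha> \<cdot>\<^sub>m fst (symbol_pair (Eig e r)) + \<beta> \<cdot>\<^sub>m snd (symbol_pair (Eig e r))) = symbol_det \<alpha> \<beta> (Eig e r)"
proof -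
  define X where "X = \<alpha> \<cdot>\<^sub>m fst (symbol_pair (Eig e r)) + \<beta> \<cdot>\<^sub>m snd (symbol_pair (Eig e r))"
  have X: "X \<in> carrier_mat r r"
    using mat_pairsD[OF eig_pair_carrier[of e r]] by (simp add: X_def)
  have "upper_triangular X"
    by (cases e) (auto simp: X_def upper_triangular_def)
  then have "det X = (\<Prod>i\<in>{0..<r}. X $$ (i, i))"
    using det_upper_triangular[OF _ X] X by (simp add: prod_list_diag_prod)
  also have "\<dots> = (\<Prod>i\<in>{0..<r}. symbol_det \<alpha> \<beta> (Eig e 1))"
    by (intro prod.cong refl, cases e) (auto simp: X_def)
  also have "\<dots> = symbol_det \<alpha> \<beta> (Eig e r)"
    by (cases e) auto
  finally show ?thesis by (simp only: X_def)
qed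

lemma det_direct_sum:
  assumes "only_eigs ss"
  shows "det (\<alpha> \<cdot>\<^sub>m fst (direct_sum ss) + \<beta> \<cdot>\<^sub>m snd (direct_sum ss)) = (\<Prod>y\<leftarrow>ss. symbol_det \<alpha> \<beta> y)"
  using assms
proof (induction ss)
  case Nil
  have "det (\<alpha> \<cdot>\<^sub>m 0\<^sub>m 0 0 + \<beta> \<cdot>\<^sub>m 0\<^sub>m 0 0) = (1 :: complex)" by (rule det_dim_zero) auto
  then show ?case by (simp add: direct_sum_def)
next
  case (Cons y ss)
  then obtain e r where y: "y = Eig e r" by (auto simp: only_eigs_def)
  have ss: "only_eigs ss" using Cons.prems by (simp add: only_eigs_def)
  define d where "d = sum_list (map symbol_index ss)"
  have C: "direct_sum ss \<in> mat_pairs d d" unfolding d_def by (rule direct_sum_carrier[OF ss])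
  note B = eig_pair_carrier[of e r]
  note c = mat_pairsD[OF B] mat_pairsD[OF C]
  have eq: "direct_sum (y # ss) = pair_oplus r r d d (symbol_pair y) (direct_sum ss)"
    using pair_sum_Cons[OF B C[unfolded direct_sum_pair_sum]] by (simp add: direct_sum_pair_sum y)
  have sm: "k \<cdot>\<^sub>m four_block_mat X (0\<^sub>m r d) (0\<^sub>m d r) Y = four_block_mat (k \<cdot>\<^sub>m X) (0\<^sub>m r d) (0\<^sub>m d r) (k \<cdot>\<^sub>m Y)"
    if "X \<in> carrier_mat r r" "Y \<in> carrier_mat d d" for k and X Y :: "complex mat"
    using smult_four_block_mat[OF that(1) zero_carrier_mat zero_carrier_mat that(2)] by simp
  have "\<alpha> \<cdot>\<^sub>m fst (direct_sum (y # ss)) + \<beta> \<cdot>\<^sub>m snd (direct_sum (y # ss)) =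
    four_block_mat (\<alpha> \<cdot>\<^sub>m fst (symbol_pair y) + \<beta> \<cdot>\<^sub>m snd (symbol_pair y)) (0\<^sub>m r d) (0\<^sub>m d r)
      (\<alpha> \<cdot>\<^sub>m fst (direct_sum ss) + \<beta> \<cdot>\<^sub>m snd (direct_sum ss))"
    unfolding y eq[unfolded y] pair_oplus_def fst_conv snd_conv sm[OF c(1,3)] sm[OF c(2,4)]
    using c by (subst add_four_block_mat[of _ r r _ d _ d]) auto
  also have "det \<dots> = det (\<alpha> \<cdot>\<^sub>m fst (symbol_pair y) + \<beta> \<cdot>\<^sub>m snd (symbol_pair y)) *
      det (\<alpha> \<cdot>\<^sub>m fst (direct_sum ss) + \<beta> \<cdot>\<^sub>m snd (direct_sum ss))"
    unfolding y using c by (intro det_four_block_mat_lower_left_zero[of _ r _ d]) auto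
  finally show ?case
    using Cons.IH[OF ss] det_symbol_pair[of \<alpha> e r \<beta>] by (simp add: y)
qed

lemma det_equivalent:
  assumes "pair_equivalent n n A B"
  shows "det (\<alpha> \<cdot>\<^sub>m fst A + \<beta> \<cdot>\<^sub>m snd A) = 0 \<longleftrightarrow> det (\<alpha> \<cdot>\<^sub>m fst B + \<beta> \<cdot>\<^sub>m snd B) = 0"
proof -
  obtain R S where RS: "R \<in> carrier_mat n n" "S \<in> carrier_mat n n" "invertible_mat R" "invertible_mat S"
    and B: "B = (R * fst A * S, R * snd A * S)" and A: "A \<in> mat_pairs n n"
    using assms by (auto simp: pair_equivalent_def prod_eq_iff)
  note c = mat_pairsD[OF A]
  have nz: "det X \<noteq> 0" if X: "invertible_mat X" "X \<in> carrier_mat n n" for X :: "complex mat"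
  proof -
    obtain X' where "X' \<in> carrier_mat n n" "X * X' = 1\<^sub>m n"
      using invertible_matE[OF X] by blast
    then show ?thesis using det_mult[OF X(2), of X'] by auto
  qed
  define Y where "Y = \<alpha> \<cdot>\<^sub>m fst A + \<beta> \<cdot>\<^sub>m snd A"
  have Y: "Y \<in> carrier_mat n n" using c by (simp add: Y_def)
  have "R * Y * S = \<alpha> \<cdot>\<^sub>m (R * fst A * S) + \<beta> \<cdot>\<^sub>m (R * snd A * S)"
  proof -
    have s: "R * (k \<cdot>\<^sub>m X) * S = k \<cdot>\<^sub>m (R * X * S)" if "X \<in> carrier_mat n n" for k X
      using mult_smult_distrib[OF RS(1) that] mult_smult_assoc_mat[OF mult_carrier_mat[OF RS(1) that] RS(2)] by simp
    have "R * Y = R * (\<alpha> \<cdot>\<^sub>m fst A) + R * (\<beta> \<cdot>\<^sub>m snd A)"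
      unfolding Y_def using c RS by (intro mult_add_distrib_mat[of _ n n _ n]) auto
    also have "\<dots> * S = R * (\<alpha> \<cdot>\<^sub>m fst A) * S + R * (\<beta> \<cdot>\<^sub>m snd A) * S"
      using c RS by (intro add_mult_distrib_mat[of _ n n _ _ n]) auto
    finally show ?thesis unfolding s[OF c(1)] s[OF c(2)] .
  qed
  then have "det (\<alpha> \<cdot>\<^sub>m fst B + \<beta> \<cdot>\<^sub>m snd B) = det (R * Y * S)" by (simp add: B)
  also have "\<dots> = det R * det Y * det S"
    using det_mult[OF mult_carrier_mat[OF RS(1) Y] RS(2)] det_mult[OF RS(1) Y] by simp
  finally show ?thesis using nz[OF RS(3,1)] nz[OF RS(4,2)] by (simp add: Y_def)
qed

text \<open>The eigenvalue of \<open>(c B\<^sub>1 + B\<^sub>2)\<^sup>-\<^sup>1 B\<^sub>1\<close> on a cell of \<open>B\<close> with the given eigenvalue. It treats \<open>\<infinity>\<close> like any other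
eigenvalue.\<close>
fun mobius :: "complex \<Rightarrow> eigval \<Rightarrow> complex" where
  "mobius c (FinEV l) = 1 / (c + l)"
| "mobius c InfEV = 0"

lemma smult_one_mat: "(1 :: complex) \<cdot>\<^sub>m A = A"
  by (intro eq_matI) auto

text \<open>Otherwise \<open>c B\<^sub>1 + B\<^sub>2\<close> would be singular on the cell of \<open>l\<close>.\<close>
lemma regular_pole:
  assumes eq: "pair_equivalent n n B (direct_sum ts)" and ts: "only_eigs ts" and det: "det (mix c B) \<noteq> 0"
    and l: "FinEV l \<in> eigvals ts"
  shows "c + l \<noteq> 0"
proof -
  have "(\<Prod>y\<leftarrow>ts. symbol_det c 1 y) \<noteq> 0"
    using det det_equivalent[OF eq, of c 1] det_direct_sum[OF ts, of c 1] by (simp add: mix_def smult_one_mat)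
  then have "symbol_det c 1 y \<noteq> 0" if "y \<in> set ts" for y
    using that by (auto simp: prod_list_zero_iff)
  moreover obtain r where "Eig (FinEV l) r \<in> set ts" "1 \<le> r"
    using l ts by (auto simp: eigvals_def only_eigs_def)
  ultimately have "symbol_det c 1 (Eig (FinEV l) r) \<noteq> 0" by blast
  then show ?thesis using \<open>1 \<le> r\<close> by auto
qed

text \<open>\<open>x\<close> is an eigenvalue of \<open>N\<close> when \<open>(1 - x c) B\<^sub>1 - x B\<^sub>2\<close> is singular, which is decided cell by cell.\<close>
lemma regular_spec:
  assumes eq: "pair_equivalent n n B (direct_sum ts)" and ts: "only_eigs ts" and det: "det (mix c B) \<noteq> 0"
    and N: "N \<in> carrier_mat n n" "mix c B * N = fst B"
  shows "spec N = mobius c ` eigvals ts" "card (spec N) = card (eigvals ts)"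
proof -
  have B: "B \<in> mat_pairs n n" using eq by (simp add: pair_equivalent_def)
  note c = mat_pairsD[OF B] mix_carrier[OF B, of c]
  have "eigenvalue N x \<longleftrightarrow> x \<in> mobius c ` eigvals ts" for x
  proof -
    have "mix c B * char_matrix N x = (1 - x * c) \<cdot>\<^sub>m fst B + (- x) \<cdot>\<^sub>m snd B"
    proof -
      have "mix c B * char_matrix N x = mix c B * N + mix c B * ((- x) \<cdot>\<^sub>m 1\<^sub>m n)"
        unfolding char_matrix_def using c N by (subst mult_add_distrib_mat[of _ n n _ n]) auto
      also have "mix c B * ((- x) \<cdot>\<^sub>m 1\<^sub>m n) = (- x) \<cdot>\<^sub>m mix c B"
        using mult_smult_distrib[OF c(3) one_carrier_mat] c by simp
      also note N(2)
      finally show ?thesis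
        using c(1,2) by (intro eq_matI) (auto simp: mix_def algebra_simps)
    qed
    then have "det (char_matrix N x) = 0 \<longleftrightarrow> det ((1 - x * c) \<cdot>\<^sub>m fst B + (- x) \<cdot>\<^sub>m snd B) = 0"
      using det_mult[OF c(3), of "char_matrix N x"] N det by simp
    also have "\<dots> \<longleftrightarrow> (\<Prod>y\<leftarrow>ts. symbol_det (1 - x * c) (- x) y) = 0"
      unfolding det_equivalent[OF eq] det_direct_sum[OF ts] ..
    also have "\<dots> \<longleftrightarrow> (\<exists>y \<in> set ts. symbol_det (1 - x * c) (- x) y = 0)"
      by (auto simp: prod_list_zero_iff)
    also have "\<dots> \<longleftrightarrow> (\<exists>e \<in> eigvals ts. symbol_det (1 - x * c) (- x) (Eig e 1) = 0)"
    proof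
      assume "\<exists>y \<in> set ts. symbol_det (1 - x * c) (- x) y = 0"
      then obtain y where y: "y \<in> set ts" "symbol_det (1 - x * c) (- x) y = 0" by blast
      then obtain e r where "y = Eig e r" using ts by (auto simp: only_eigs_def)
      then show "\<exists>e \<in> eigvals ts. symbol_det (1 - x * c) (- x) (Eig e 1) = 0"
        using y by (cases e) (auto simp: eigvals_def)
    next
      assume "\<exists>e \<in> eigvals ts. symbol_det (1 - x * c) (- x) (Eig e 1) = 0"
      then obtain e r where "Eig e r \<in> set ts" "symbol_det (1 - x * c) (- x) (Eig e 1) = 0"
        by (auto simp: eigvals_def)
      moreover from this have "1 \<le> r" using ts by (auto simp: only_eigs_def)
      ultimately show "\<exists>y \<in> set ts. symbol_det (1 - x * c) (- x) y = 0"
        by (intro bexI[of _ "Eig e r"]) (cases e, auto)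
    qed
    also have "\<dots> \<longleftrightarrow> (\<exists>e \<in> eigvals ts. x = mobius c e)"
    proof (intro bex_cong refl)
      fix e assume e: "e \<in> eigvals ts"
      show "symbol_det (1 - x * c) (- x) (Eig e 1) = 0 \<longleftrightarrow> x = mobius c e"
      proof (cases e)
        case (FinEV l)
        then have "c + l \<noteq> 0" using regular_pole[OF eq ts det] e by simp
        then show ?thesis by (auto simp: FinEV field_simps)
      qed simp
    qed
    finally show ?thesis unfolding eigenvalue_det[OF N(1)] by auto
  qed
  then show spec: "spec N = mobius c ` eigvals ts" by auto
  have "inj_on (mobius c) (eigvals ts)"
  proof (rule inj_onI)
    fix d e assume "d \<in> eigvals ts" "e \<in> eigvals ts" "mobius c d = mobius c e"
    then show "d = e" using regular_pole[OF eq ts det] by (cases d; cases e) auto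
  qed
  then show "card (spec N) = card (eigvals ts)" unfolding spec by (rule card_image)
qed

section \<open>Jordan chains and double eigenvalues of a regular pencil\<close>

text \<open>The entry \<open>k\<close> of the row \<open>x X\<close>, with \<open>x\<close> a function so that it can be padded with zeros.\<close>
definition left_mult :: "nat \<Rightarrow> (nat \<Rightarrow> complex) \<Rightarrow> complex mat \<Rightarrow> nat \<Rightarrow> complex" where
  "left_mult m x X k = (\<Sum>i<m. x i * X $$ (i, k))"

text \<open>With \<open>M = c B\<^sub>1 + B\<^sub>2\<close> this says \<open>x B\<^sub>1 = a x M + x' M\<close> and \<open>x' B\<^sub>1 = a x' M\<close>: a left Jordan chain of length two for
the quotient, expressed without an inverse, so that it makes sense for every
summand. The vector \<open>y\<close> distinguishes \<open>x\<close> from \<open>x'\<close>.\<close>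
definition pencil_chain :: "complex \<Rightarrow> nat \<Rightarrow> nat \<Rightarrow> mat_pair \<Rightarrow> bool" where
  "pencil_chain c m n B \<longleftrightarrow> (\<exists>a x x' y.
     (\<forall>k<n. left_mult m x (fst B) k = a * (c * left_mult m x (fst B) k + left_mult m x (snd B) k) +
        (c * left_mult m x' (fst B) k + left_mult m x' (snd B) k)) \<and>
     (\<forall>k<n. left_mult m x' (fst B) k = a * (c * left_mult m x' (fst B) k + left_mult m x' (snd B) k)) \<and>
     (\<Sum>i<m. x i * y i) = 0 \<and> (\<Sum>i<m. x' i * y i) = 1)"

lemma pencil_chainI:
  assumes "\<And>k. k < n \<Longrightarrow> left_mult m x (fst B) k = a * (c * left_mult m x (fst B) k + left_mult m x (snd B) k) +
        (c * left_mult m x' (fst B) k + left_mult m x' (snd B) k)"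
    and "\<And>k. k < n \<Longrightarrow> left_mult m x' (fst B) k = a * (c * left_mult m x' (fst B) k + left_mult m x' (snd B) k)"
    and "(\<Sum>i<m. x i * y i) = 0" "(\<Sum>i<m. x' i * y i) = 1"
  shows "pencil_chain c m n B"
  using assms unfolding pencil_chain_def by blast

lemma sum_lessThan_add: "(\<Sum>i<a + b. f i) = (\<Sum>i<a. f i) + (\<Sum>i<b. f (a + i))" for f :: "nat \<Rightarrow> complex"
  by (induction b) (simp_all add: add.assoc)

lemma left_mult_block_diag:
  assumes "X \<in> carrier_mat a b" "Y \<in> carrier_mat c d" "k < b + d"
  shows "left_mult (a + c) (\<lambda>i. if i < a then x i else 0) (four_block_mat X (0\<^sub>m a d) (0\<^sub>m c b) Y) k =
      (if k < b then left_mult a x X k else 0)"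
    and "left_mult (a + c) (\<lambda>i. if i < a then 0 else x (i - a)) (four_block_mat X (0\<^sub>m a d) (0\<^sub>m c b) Y) k =
      (if k < b then 0 else left_mult c x Y (k - b))"
  using assms by (auto simp: left_mult_def sum_lessThan_add intro!: sum.cong sum.neutral)

lemma pencil_chain_oplus:
  assumes B: "B \<in> mat_pairs a b" and C: "C \<in> mat_pairs d e"
    and "pencil_chain c a b B \<or> pencil_chain c d e C"
  shows "pencil_chain c (a + d) (b + e) (pair_oplus a b d e B C)"
  using assms(3)
proof
  note cm = mat_pairsD[OF B] mat_pairsD[OF C]
  note lm = left_mult_block_diag[OF cm(1,3)] left_mult_block_diag[OF cm(2,4)]
  {
    assume "pencil_chain c a b B"
    then obtain \<mu> x x' y where
      h: "\<And>k. k < b \<Longrightarrow> left_mult a x (fst B) k = \<mu> * (c * left_mult a x (fst B) k + left_mult a x (snd B) k) +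
        (c * left_mult a x' (fst B) k + left_mult a x' (snd B) k)"
      "\<And>k. k < b \<Longrightarrow> left_mult a x' (fst B) k = \<mu> * (c * left_mult a x' (fst B) k + left_mult a x' (snd B) k)"
      "(\<Sum>i<a. x i * y i) = 0" "(\<Sum>i<a. x' i * y i) = 1"
      unfolding pencil_chain_def by blast
    show ?thesis
      unfolding pair_oplus_def
      by (rule pencil_chainI[where a = \<mu> and x = "\<lambda>i. if i < a then x i else 0"
        and x' = "\<lambda>i. if i < a then x' i else 0" and y = "\<lambda>i. if i < a then y i else 0"]) (use h in \<open>auto simp: lm sum_lessThan_add\<close>)
  next
    assume "pencil_chain c d e C"
    then obtain \<mu> x x' y where
      h: "\<And>k. k < e \<Longrightarrow> left_mult d x (fst C) k = \<mu> * (c * left_mult d x (fst C) k + left_mult d x (snd C) k) +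
        (c * left_mult d x' (fst C) k + left_mult d x' (snd C) k)"
      "\<And>k. k < e \<Longrightarrow> left_mult d x' (fst C) k = \<mu> * (c * left_mult d x' (fst C) k + left_mult d x' (snd C) k)"
      "(\<Sum>i<d. x i * y i) = 0" "(\<Sum>i<d. x' i * y i) = 1"
      unfolding pencil_chain_def by blast
    have k: "\<not> k < b \<Longrightarrow> k < b + e \<Longrightarrow> k - b < e" for k by linarith
    show ?thesis
      unfolding pair_oplus_def
      by (rule pencil_chainI[where a = \<mu> and x = "\<lambda>i. if i < a then 0 else x (i - a)"
        and x' = "\<lambda>i. if i < a then 0 else x' (i - a)" and y = "\<lambda>i. if i < a then 0 else y (i - a)"]) (use h k in \<open>auto simp: lm sum_lessThan_add\<close>)
  }
qed

lemma left_mult_single: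
  assumes "i < m"
  shows "left_mult m (\<lambda>j. if j = i then \<beta> else 0) X k = \<beta> * X $$ (i, k)"
proof -
  have "left_mult m (\<lambda>j. if j = i then \<beta> else 0) X k = (\<Sum>j<m. if j = i then \<beta> * X $$ (j, k) else 0)"
    unfolding left_mult_def by (intro sum.cong) auto
  then show ?thesis using assms by simp
qed

text \<open>The last two unit rows. For a finite eigenvalue the last one is rescaled by \<open>-a\<^sup>2\<close>, the derivative
of \<open>1 / (c + l)\<close> with respect to \<open>l\<close>.\<close>
lemma pencil_chain_jordan_block:
  assumes r: "2 \<le> r" and e: "\<And>l. e = FinEV l \<Longrightarrow> c + l \<noteq> 0"
  shows "pencil_chain c r r (symbol_pair (Eig e r))"
proof -
  have i: "r - 2 < r" "r - 1 < r" "r - 2 \<noteq> r - 1" "Suc (r - 2) = r - 1" using r by auto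
  have sums: "(\<Sum>j<r. (if j = r - 2 then 1 else 0) * (if j = r - 1 then \<beta> else 0 :: complex)) = 0"
    "(\<Sum>j<r. (if j = r - 1 then \<alpha> else 0) * (if j = r - 1 then \<beta> else 0)) = \<alpha> * \<beta>" for \<alpha> \<beta> :: complex
  proof -
    show "(\<Sum>j<r. (if j = r - 2 then 1 else 0) * (if j = r - 1 then \<beta> else 0 :: complex)) = 0"
      using i by (intro sum.neutral) auto
    have "(\<Sum>j<r. (if j = r - 1 then \<alpha> else 0) * (if j = r - 1 then \<beta> else 0)) = (\<Sum>j<r. if j = r - 1 then \<alpha> * \<beta> else 0)"
      by (intro sum.cong) auto
    then show "(\<Sum>j<r. (if j = r - 1 then \<alpha> else 0) * (if j = r - 1 then \<beta> else 0)) = \<alpha> * \<beta>"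
      using i by simp
  qed
  show ?thesis
  proof (cases e)
    case InfEV
    show ?thesis
    proof (rule pencil_chainI[where a = 0 and x = "\<lambda>j. if j = r - 2 then 1 else 0"
        and x' = "\<lambda>j. if j = r - 1 then 1 else 0" and y = "\<lambda>j. if j = r - 1 then 1 else 0"])
      show "(\<Sum>j<r. (if j = r - 1 then 1 else 0) * (if j = r - 1 then 1 else 0)) = (1 :: complex)"
        by (simp only: sums mult_1)
    qed (use i sums in \<open>auto simp: InfEV left_mult_single\<close>)
  next
    case (FinEV l)
    define a where "a = 1 / (c + l)"
    have a: "a * (c + l) = 1" using e[OF FinEV] by (simp add: a_def)
    then have "a * c + a * l = 1" by (simp add: distrib_left)
    then have ac: "a * c = 1 - a * l" by (simp add: algebra_simps)
    have a2: "a\<^sup>2 * (c + l) = a" using a by (simp add: power2_eq_square mult.assoc)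
    have a3: "a * (a * (a * c)) + a * (a * (a * l)) = a * a"
      using arg_cong[OF a, of "\<lambda>x. a * a * x"] by (simp add: algebra_simps)
    have a0: "a \<noteq> 0" using a by auto
    show ?thesis
    proof (rule pencil_chainI[where a = a and x = "\<lambda>j. if j = r - 2 then 1 else 0"
        and x' = "\<lambda>j. if j = r - 1 then - a\<^sup>2 else 0" and y = "\<lambda>j. if j = r - 1 then - (1 / a\<^sup>2) else 0"])
      fix k assume k: "k < r"
      have one: "fst (symbol_pair (Eig e r)) $$ (j, k) = (if j = k then 1 else 0)" if "j < r" for j
        using that k by (simp add: FinEV)
      have jb: "snd (symbol_pair (Eig e r)) $$ (j, k) = (if j = k then l else if Suc j = k then 1 else 0)" if "j < r" for j
        using that k by (simp add: FinEV)
      have last: "Suc (r - 1) \<noteq> k" using k by simp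
      show "left_mult r (\<lambda>j. if j = r - 1 then - a\<^sup>2 else 0) (fst (symbol_pair (Eig e r))) k =
        a * (c * left_mult r (\<lambda>j. if j = r - 1 then - a\<^sup>2 else 0) (fst (symbol_pair (Eig e r))) k +
          left_mult r (\<lambda>j. if j = r - 1 then - a\<^sup>2 else 0) (snd (symbol_pair (Eig e r))) k)"
        unfolding left_mult_single[OF i(2)] one[OF i(2)] jb[OF i(2)]
        using a3 last by (auto simp: algebra_simps power2_eq_square)
      show "left_mult r (\<lambda>j. if j = r - 2 then 1 else 0) (fst (symbol_pair (Eig e r))) k =
        a * (c * left_mult r (\<lambda>j. if j = r - 2 then 1 else 0) (fst (symbol_pair (Eig e r))) k +
          left_mult r (\<lambda>j. if j = r - 2 then 1 else 0) (snd (symbol_pair (Eig e r))) k) +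
        (c * left_mult r (\<lambda>j. if j = r - 1 then - a\<^sup>2 else 0) (fst (symbol_pair (Eig e r))) k +
          left_mult r (\<lambda>j. if j = r - 1 then - a\<^sup>2 else 0) (snd (symbol_pair (Eig e r))) k)"
        unfolding left_mult_single[OF i(2)] left_mult_single[OF i(1)] one[OF i(2)] jb[OF i(2)] one[OF i(1)] jb[OF i(1)] i(4)
        using a a2 last i(3) by (auto simp: algebra_simps)
    next
      show "(\<Sum>j<r. (if j = r - 1 then - a\<^sup>2 else 0) * (if j = r - 1 then - (1 / a\<^sup>2) else 0)) = 1"
        using a0 by (simp only: sums) simp
    qed (rule sums)
  qed
qed

lemma mix_index:
  assumes "B \<in> mat_pairs m n" "i < m" "k < n"
  shows "mix c B $$ (i, k) = c * fst B $$ (i, k) + snd B $$ (i, k)"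
  using mat_pairsD[OF assms(1)] assms(2,3) by (simp add: mix_def)

lemma transpose_mult_vec_left_mult:
  assumes X: "X \<in> carrier_mat m n" and k: "k < n"
  shows "(transpose_mat X *\<^sub>v vec m x) $ k = left_mult m x X k"
proof -
  have "(transpose_mat X *\<^sub>v vec m x) $ k = (\<Sum>i<m. transpose_mat X $$ (k, i) * vec m x $ i)"
    using X k by (intro index_mult_mat_vec_sum) auto
  also have "\<dots> = left_mult m x X k"
    unfolding left_mult_def using X k by (intro sum.cong) auto
  finally show ?thesis .
qed

text \<open>Multiplication by \<open>M\<close> turns the rows \<open>x\<close>, \<open>x'\<close> into a chain of \<open>N = M\<^sup>-\<^sup>1 B\<^sub>1\<close>, and \<open>q = M\<^sup>-\<^sup>1 y\<close> keeps the
pairings.\<close>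
lemma pencil_chain_quotient:
  assumes B: "B \<in> mat_pairs n n" and det: "det (mix c B) \<noteq> 0"
    and N: "N \<in> carrier_mat n n" "mix c B * N = fst B" and chain: "pencil_chain c n n B"
  obtains a p p' q where "p \<in> carrier_vec n" "p' \<in> carrier_vec n" "q \<in> carrier_vec n"
    "transpose_mat N *\<^sub>v p = a \<cdot>\<^sub>v p + p'" "transpose_mat N *\<^sub>v p' = a \<cdot>\<^sub>v p'" "p \<bullet> q = 0" "p' \<bullet> q = 1"
proof -
  obtain a x x' y where
    h: "\<And>k. k < n \<Longrightarrow> left_mult n x (fst B) k = a * (c * left_mult n x (fst B) k + left_mult n x (snd B) k) +
      (c * left_mult n x' (fst B) k + left_mult n x' (snd B) k)"
    "\<And>k. k < n \<Longrightarrow> left_mult n x' (fst B) k = a * (c * left_mult n x' (fst B) k + left_mult n x' (snd B) k)"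
    "(\<Sum>i<n. x i * y i) = 0" "(\<Sum>i<n. x' i * y i) = 1"
    using chain unfolding pencil_chain_def by blast
  note cm = mat_pairsD[OF B] mix_carrier[OF B, of c]
  obtain W where W: "W \<in> carrier_mat n n" "mix c B * W = 1\<^sub>m n"
    using det_nonzero_inverse[OF cm(3) det] by blast
  define p where "p = transpose_mat (mix c B) *\<^sub>v vec n x"
  define p' where "p' = transpose_mat (mix c B) *\<^sub>v vec n x'"
  define q where "q = W *\<^sub>v vec n y"
  have carr: "p \<in> carrier_vec n" "p' \<in> carrier_vec n" "q \<in> carrier_vec n"
    using cm W by (auto simp: p_def p'_def q_def intro!: mult_mat_vec_carrier)
  have mixlm: "left_mult n z (mix c B) k = c * left_mult n z (fst B) k + left_mult n z (snd B) k" if "k < n" for z k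
    unfolding left_mult_def sum_distrib_left sum.distrib[symmetric]
    using that by (intro sum.cong) (auto simp: mix_index[OF B] algebra_simps)
  have trN: "transpose_mat N *\<^sub>v (transpose_mat (mix c B) *\<^sub>v v) = transpose_mat (fst B) *\<^sub>v v"
    if "v \<in> carrier_vec n" for v
  proof -
    have "transpose_mat (fst B) = transpose_mat N * transpose_mat (mix c B)"
      using transpose_mult[OF cm(3) N(1)] N(2) by simp
    then show ?thesis
      using assoc_mult_mat_vec[of "transpose_mat N" n n "transpose_mat (mix c B)" n v] cm N that by simp
  qed
  have "transpose_mat N *\<^sub>v p = a \<cdot>\<^sub>v p + p'"
  proof (rule eq_vecI)
    fix k assume "k < dim_vec (a \<cdot>\<^sub>v p + p')"
    then have k: "k < n" using carr by simp
    have "(transpose_mat N *\<^sub>v p) $ k = left_mult n x (fst B) k"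
      unfolding p_def trN[OF vec_carrier] by (rule transpose_mult_vec_left_mult[OF cm(1) k])
    also have "\<dots> = a * p $ k + p' $ k"
      unfolding p_def p'_def transpose_mult_vec_left_mult[OF cm(3) k] mixlm[OF k] by (rule h(1)[OF k])
    finally show "(transpose_mat N *\<^sub>v p) $ k = (a \<cdot>\<^sub>v p + p') $ k" using carr k by simp
  qed (use carr N in auto)
  moreover have "transpose_mat N *\<^sub>v p' = a \<cdot>\<^sub>v p'"
  proof (rule eq_vecI)
    fix k assume "k < dim_vec (a \<cdot>\<^sub>v p')"
    then have k: "k < n" using carr by simp
    have "(transpose_mat N *\<^sub>v p') $ k = left_mult n x' (fst B) k"
      unfolding p'_def trN[OF vec_carrier] by (rule transpose_mult_vec_left_mult[OF cm(1) k])
    also have "\<dots> = a * p' $ k"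
      unfolding p'_def transpose_mult_vec_left_mult[OF cm(3) k] mixlm[OF k] by (rule h(2)[OF k])
    finally show "(transpose_mat N *\<^sub>v p') $ k = (a \<cdot>\<^sub>v p') $ k" using carr k by simp
  qed (use carr N in auto)
  moreover have pq: "(transpose_mat (mix c B) *\<^sub>v vec n z) \<bullet> q = (\<Sum>i<n. z i * y i)" for z
  proof -
    have "(transpose_mat (mix c B) *\<^sub>v vec n z) \<bullet> q = vec n z \<bullet> (mix c B *\<^sub>v q)"
      using transpose_vec_mult_scalar[OF cm(3) carr(3)] by simp
    also have "mix c B *\<^sub>v q = vec n y"
      unfolding q_def using assoc_mult_mat_vec[OF cm(3) W(1) vec_carrier[of n y]] W(2) by simp
    finally show ?thesis by (simp add: scalar_prod_def lessThan_atLeast0)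
  qed
  have "p \<bullet> q = 0" "p' \<bullet> q = 1"
    unfolding p_def p'_def pq by (rule h)+
  ultimately show ?thesis using that[OF carr] by blast
qed

subsection \<open>Diagonal pencils\<close>

fun fst_entry snd_entry :: "eigval \<Rightarrow> complex" where
  "fst_entry (FinEV l) = 1"
| "fst_entry InfEV = 0"
| "snd_entry (FinEV l) = l"
| "snd_entry InfEV = 1"

abbreviation simple_eigs :: "eigval list \<Rightarrow> eigval symbol list" where
  "simple_eigs ls \<equiv> map (\<lambda>l. Eig l 1) ls"

lemma direct_sum_simple_eigs:
  "direct_sum (simple_eigs ls) =
    (mat (length ls) (length ls) (\<lambda>(i, j). if i = j then fst_entry (ls ! i) else 0),
     mat (length ls) (length ls) (\<lambda>(i, j). if i = j then snd_entry (ls ! i) else 0))"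
proof (induction ls)
  case Nil
  then show ?case by (auto simp: direct_sum_def)
next
  case (Cons e ls)
  have "only_eigs (simple_eigs ls)" by (simp add: only_eigs_def)
  then have C: "direct_sum (simple_eigs ls) \<in> mat_pairs (length ls) (length ls)"
    using direct_sum_carrier[of "simple_eigs ls"] by (simp add: comp_def sum_list_triv)
  have "direct_sum (simple_eigs (e # ls)) =
      pair_oplus 1 1 (length ls) (length ls) (symbol_pair (Eig e 1)) (direct_sum (simple_eigs ls))"
    using pair_sum_Cons[OF eig_pair_carrier[of e 1] C[unfolded direct_sum_pair_sum]] by (simp add: direct_sum_pair_sum)
  then show ?case
    unfolding Cons.IH pair_oplus_def
    by (cases e) (auto intro!: eq_matI simp: nth_Cons split: nat.splits)
qed

lemma mix_simple_eigs_mult: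
  assumes "N \<in> carrier_mat n n" "length ls = n" "i < n" "j < n"
  shows "(mix c (direct_sum (simple_eigs ls)) * N) $$ (i, j) =
    (c * fst_entry (ls ! i) + snd_entry (ls ! i)) * N $$ (i, j)"
proof -
  define M where "M = mix c (direct_sum (simple_eigs ls))"
  have M: "M \<in> carrier_mat n n" "\<And>k. k < n \<Longrightarrow> M $$ (i, k) = (if k = i then c * fst_entry (ls ! i) + snd_entry (ls ! i) else 0)"
    using assms unfolding M_def mix_def direct_sum_simple_eigs by auto
  have "(M * N) $$ (i, j) = (\<Sum>k<n. if k = i then (c * fst_entry (ls ! i) + snd_entry (ls ! i)) * N $$ (k, j) else 0)"
    unfolding index_mult_mat_sum[OF M(1) assms(1,3,4)] by (intro sum.cong) (auto simp: M(2))
  then show ?thesis using assms by (simp add: M_def)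
qed

lemma quotient_simple_eigs:
  assumes N: "N \<in> carrier_mat n n" "mix c (direct_sum (simple_eigs ls)) * N = fst (direct_sum (simple_eigs ls))"
    and ls: "length ls = n" and pole: "\<And>l. FinEV l \<in> set ls \<Longrightarrow> c + l \<noteq> 0" and ij: "i < n" "j < n"
  shows "N $$ (i, j) = (if i = j then mobius c (ls ! i) else 0)"
proof -
  have "(c * fst_entry (ls ! i) + snd_entry (ls ! i)) * N $$ (i, j) = (if i = j then fst_entry (ls ! i) else 0)"
    using mix_simple_eigs_mult[OF N(1) ls ij, of c] ij ls unfolding N(2) unfolding direct_sum_simple_eigs by simp
  moreover have "c + l \<noteq> 0" if "ls ! i = FinEV l" for l
    using pole[of l] nth_mem[of i ls] ij ls that by simp
  ultimately show ?thesis
    by (cases "ls ! i") (auto simp: nonzero_eq_divide_eq mult.commute split: if_splits)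
qed

section \<open>Regular generic pairs\<close>

text \<open>The relation between canonical forms that underlies equality of Kronecker types.\<close>
definition same_symbols :: "eigval symbol list \<Rightarrow> eigval symbol list \<Rightarrow> bool" where
  "same_symbols ss ts \<longleftrightarrow> (\<exists>f. bij_betw f (eigvals ss) (eigvals ts) \<and>
     mset ts = image_mset (map_symbol f) (mset ss))"

lemma same_symbols_set:
  assumes "same_symbols ss ts" "y \<in> set ts"
  obtains f x where "x \<in> set ss" "y = map_symbol f x"
proof -
  obtain f where "mset ts = image_mset (map_symbol f) (mset ss)"
    using assms(1) by (auto simp: same_symbols_def)
  then have "set ts = map_symbol f ` set ss" by (metis set_image_mset set_mset_mset)
  then show ?thesis using assms(2) that by auto
qed

lemma same_symbols_only_eigs:
  assumes "same_symbols ss ts" "only_eigs ss"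
  shows "only_eigs ts"
  unfolding only_eigs_def
proof
  fix y assume "y \<in> set ts"
  then obtain f x where x: "x \<in> set ss" "y = map_symbol f x"
    using same_symbols_set[OF assms(1)] by blast
  then obtain e r where "x = Eig e r" "1 \<le> r" using assms(2) by (auto simp: only_eigs_def)
  then show "\<exists>e r. y = Eig e r \<and> 1 \<le> r" using x by auto
qed

lemma same_symbols_card: "same_symbols ss ts \<Longrightarrow> card (eigvals ts) = card (eigvals ss)"
  by (auto simp: same_symbols_def bij_betw_same_card)

lemma same_symbols_count:
  assumes "same_symbols ss ts"
  shows "count (mset ts) (Nabla r) = count (mset ss) (Nabla r)" "count (mset ts) (Tri r) = count (mset ss) (Tri r)"
proof -
  obtain f where f: "mset ts = image_mset (map_symbol f) (mset ss)"
    using assms by (auto simp: same_symbols_def)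
  have "count (image_mset (map_symbol f) M) (Nabla r) = count M (Nabla r)" for M
  proof (induction M)
    case (add y M)
    then show ?case by (cases y) auto
  qed simp
  moreover have "count (image_mset (map_symbol f) M) (Tri r) = count M (Tri r)" for M
  proof (induction M)
    case (add y M)
    then show ?case by (cases y) auto
  qed simp
  ultimately show "count (mset ts) (Nabla r) = count (mset ss) (Nabla r)" "count (mset ts) (Tri r) = count (mset ss) (Tri r)"
    unfolding f by auto
qed

lemma mult_mat_unit_vec:
  assumes "A \<in> carrier_mat m n" "i < n"
  shows "A *\<^sub>v unit_vec n i = (col A i :: complex vec)"
  using assms by (intro eq_vecI) auto

definition regular_class :: "nat \<Rightarrow> eigval symbol list set \<Rightarrow> mat_pair \<Rightarrow> bool" where
  "regular_class n \<S> B \<longleftrightarrow> (\<exists>ss \<in> \<S>. \<exists>ts. same_symbols ss ts \<and> pair_equivalent n n B (direct_sum ts))"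

lemma finite_eigvals: "finite (eigvals ss)"
proof (rule finite_subset)
  show "eigvals ss \<subseteq> (\<lambda>y. case y of Eig l r \<Rightarrow> l | _ \<Rightarrow> undefined) ` set ss"
    by (force simp: eigvals_def)
qed simp

text \<open>Passing to the direct sum itself and choosing \<open>c\<close> off finitely many poles. Whichever canonical form a
nearby pair of the class has, it has as many distinct eigenvalues as \<open>N0\<close>.\<close>
lemma regular_normalization:
  assumes eigs: "\<And>ss. ss \<in> \<S> \<Longrightarrow> only_eigs ss"
    and eq: "\<And>ss. ss \<in> \<S> \<Longrightarrow> pair_equivalent n n A (direct_sum ss)"
    and flex: "flexible n n A (regular_class n \<S>)" and ss: "ss \<in> \<S>"
  obtains c N0 where "flexible n n (direct_sum ss) (regular_class n \<S>)"
    "direct_sum ss \<in> mat_pairs n n" "det (mix c (direct_sum ss)) \<noteq> 0"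
    "N0 \<in> carrier_mat n n" "mix c (direct_sum ss) * N0 = fst (direct_sum ss)"
    "spec N0 = mobius c ` eigvals ss"
    "\<And>l. FinEV l \<in> eigvals ss \<Longrightarrow> c + l \<noteq> 0"
    "\<And>B N. regular_class n \<S> B \<Longrightarrow> det (mix c B) \<noteq> 0 \<Longrightarrow> N \<in> carrier_mat n n \<Longrightarrow>
       mix c B * N = fst B \<Longrightarrow> card (spec N) = card (spec N0)"
proof -
  define \<Lambda> where "\<Lambda> = direct_sum ss"
  have A\<Lambda>: "pair_equivalent n n A \<Lambda>" using eq[OF ss] by (simp add: \<Lambda>_def)
  then have \<Lambda>: "\<Lambda> \<in> mat_pairs n n" by (simp add: pair_equivalent_def)
  have flex\<Lambda>: "flexible n n \<Lambda> (regular_class n \<S>)"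
  proof (rule flexible_equivalent[OF flex A\<Lambda>])
    show "regular_class n \<S> Y" if "regular_class n \<S> X" "pair_equivalent n n X Y" for X Y
      using that pair_equivalent_trans[OF pair_equivalent_sym[OF that(2)]] unfolding regular_class_def by blast
  qed
  have "finite ((\<lambda>e. case e of FinEV l \<Rightarrow> - l | InfEV \<Rightarrow> 0) ` eigvals ss)"
    by (rule finite_imageI[OF finite_eigvals])
  \<comment> \<open>The value at \<open>\<infinity>\<close> is arbitrary: a cell with this eigenvalue excludes no \<open>c\<close>.\<close>
  then obtain c where c: "c \<notin> (\<lambda>e. case e of FinEV l \<Rightarrow> - l | InfEV \<Rightarrow> 0) ` eigvals ss"
    using ex_new_if_finite[OF infinite_UNIV_char_0] by blast
  have pole: "c + l \<noteq> 0" if "FinEV l \<in> eigvals ss" for l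
  proof
    assume "c + l = 0"
    then have "c = - l" by (simp add: eq_neg_iff_add_eq_0)
    then have "c \<in> (\<lambda>e. case e of FinEV l \<Rightarrow> - l | InfEV \<Rightarrow> 0) ` eigvals ss"
      using that by (intro image_eqI[of _ _ "FinEV l"]) auto
    then show False using c by simp
  qed
  have det: "det (mix c \<Lambda>) \<noteq> 0"
  proof -
    have "symbol_det c 1 y \<noteq> 0" if y: "y \<in> set ss" for y
    proof -
      obtain e r where er: "y = Eig e r" using eigs[OF ss] y by (auto simp: only_eigs_def)
      show ?thesis
      proof (cases e)
        case (FinEV l)
        then have "FinEV l \<in> eigvals ss" using y er by (auto simp: eigvals_def)
        then show ?thesis using pole er FinEV by simp
      qed (simp add: er)
    qed
    then have "(\<Prod>y\<leftarrow>ss. symbol_det c 1 y) \<noteq> 0" by (auto simp: prod_list_zero_iff)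
    then show ?thesis
      using det_direct_sum[OF eigs[OF ss], of c 1] by (simp add: \<Lambda>_def mix_def smult_one_mat)
  qed
  obtain W where W: "W \<in> carrier_mat n n" "mix c \<Lambda> * W = 1\<^sub>m n"
    using det_nonzero_inverse[OF mix_carrier[OF \<Lambda>] det] by blast
  define N0 where "N0 = W * fst \<Lambda>"
  have N0: "N0 \<in> carrier_mat n n" using W mat_pairsD[OF \<Lambda>] by (auto simp: N0_def)
  have N0_eq: "mix c \<Lambda> * N0 = fst \<Lambda>"
    using assoc_mult_mat[OF mix_carrier[OF \<Lambda>] W(1) mat_pairsD(1)[OF \<Lambda>], of c] W(2) mat_pairsD[OF \<Lambda>]
    by (simp add: N0_def)
  have card: "card (spec N) = card (spec N0)"
    if cls: "regular_class n \<S> B" and B: "det (mix c B) \<noteq> 0" "N \<in> carrier_mat n n" "mix c B * N = fst B" for B N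
  proof -
    obtain ss' ts where ts: "ss' \<in> \<S>" "same_symbols ss' ts" "pair_equivalent n n B (direct_sum ts)"
      using cls unfolding regular_class_def by blast
    have "card (spec N) = card (eigvals ts)"
      by (rule regular_spec(2)[OF ts(3) same_symbols_only_eigs[OF ts(2) eigs[OF ts(1)]] B])
    also have "\<dots> = card (eigvals ss')" by (rule same_symbols_card[OF ts(2)])
    also have "\<dots> = card (spec N0)"
      by (rule regular_spec(2)[OF pair_equivalent_trans[OF pair_equivalent_sym[OF A\<Lambda>] eq[OF ts(1)]]
        eigs[OF ts(1)] det N0 N0_eq, symmetric])
    finally show ?thesis .
  qed
  have spec: "spec N0 = mobius c ` eigvals ss"
    by (rule regular_spec(1)[OF _ eigs[OF ss] det N0 N0_eq])
      (use pair_equivalent_trans[OF pair_equivalent_sym[OF A\<Lambda>] A\<Lambda>] in \<open>simp add: \<Lambda>_def\<close>)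
  show ?thesis
    by (rule that[of c N0, folded \<Lambda>_def, OF flex\<Lambda> \<Lambda> det N0 N0_eq spec pole card])
qed

text \<open>A cell of size at least two contains a Jordan chain, against \<open>constant_spectrum_no_jordan_chain\<close>.\<close>
lemma regular_no_jordan_block:
  assumes eigs: "\<And>ss. ss \<in> \<S> \<Longrightarrow> only_eigs ss"
    and eq: "\<And>ss. ss \<in> \<S> \<Longrightarrow> pair_equivalent n n A (direct_sum ss)"
    and flex: "flexible n n A (regular_class n \<S>)" and ss: "ss \<in> \<S>"
  shows "\<exists>ls. ss = simple_eigs ls"
proof -
  obtain c N0 where flex\<Lambda>: "flexible n n (direct_sum ss) (regular_class n \<S>)"
    and \<Lambda>: "direct_sum ss \<in> mat_pairs n n" and det: "det (mix c (direct_sum ss)) \<noteq> 0"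
    and N0: "N0 \<in> carrier_mat n n" "mix c (direct_sum ss) * N0 = fst (direct_sum ss)"
    and pole: "\<And>l. FinEV l \<in> eigvals ss \<Longrightarrow> c + l \<noteq> 0"
    and const: "\<And>B N. regular_class n \<S> B \<Longrightarrow> det (mix c B) \<noteq> 0 \<Longrightarrow> N \<in> carrier_mat n n \<Longrightarrow>
       mix c B * N = fst B \<Longrightarrow> card (spec N) = card (spec N0)"
    by (rule regular_normalization[OF eigs eq flex ss]) blast+
  have n: "n = sum_list (map symbol_index ss)"
    using mat_pairs_unique[OF \<Lambda> direct_sum_carrier[OF eigs[OF ss]]] by simp
  have r1: "r = 1" if y: "Eig e r \<in> set ss" for e r
  proof (rule ccontr)
    assume "r \<noteq> 1"
    then have r: "2 \<le> r" using eigs[OF ss] y by (auto simp: only_eigs_def)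
    have "pencil_chain c r r (symbol_pair (Eig e r))"
      using pole y by (intro pencil_chain_jordan_block[OF r]) (auto simp: eigvals_def)
    then have "pencil_chain c (symbol_index (Eig e r)) (symbol_index (Eig e r)) (symbol_pair (Eig e r))"
      by simp
    then have "pencil_chain c n n (direct_sum ss)"
      unfolding n direct_sum_pair_sum
    proof (rule pair_sum_inherit[where Q = "pencil_chain c" and r = symbol_index and c = symbol_index, rotated 2])
      fix y assume "y \<in> set ss"
      then obtain e r where "y = Eig e r" using eigs[OF ss] by (auto simp: only_eigs_def)
      then show "symbol_pair y \<in> mat_pairs (symbol_index y) (symbol_index y)"
        using eig_pair_carrier[of e r] by (simp only: symbol_index.simps)
    qed (use y pencil_chain_oplus in auto)
    then obtain a p p' q where chain: "p \<in> carrier_vec n" "p' \<in> carrier_vec n"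
      "transpose_mat N0 *\<^sub>v p = a \<cdot>\<^sub>v p + p'" "transpose_mat N0 *\<^sub>v p' = a \<cdot>\<^sub>v p'"
      and q: "q \<in> carrier_vec n" "p \<bullet> q = 0" "p' \<bullet> q = 1"
      using pencil_chain_quotient[OF \<Lambda> det N0] by metis
    have "rank_one n q p \<in> carrier_mat n n" by (simp add: rank_one_def)
    then obtain N where N: "mat_DERIV n n N (rank_one n q p)" "N 0 = N0"
      "\<forall>\<^sub>F t in nhds 0. \<exists>B \<in> mat_pairs n n. regular_class n \<S> B \<and> det (mix c B) \<noteq> 0 \<and> mix c B * N t = fst B"
      using flexible_quotient[OF flex\<Lambda> \<Lambda> det N0] by blast
    have "\<forall>\<^sub>F t in nhds 0. card (spec (N t)) = card (spec (N 0))"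
      using N(3)
    proof eventually_elim
      case (elim t)
      then show ?case using const[OF _ _ mat_DERIV_carrier(1)[OF N(1)]] by (auto simp: N(2))
    qed
    then show False
      using constant_spectrum_no_jordan_chain[OF N(1) _ chain(1,2) chain(3,4)[folded N(2)] q] by blast
  qed
  define ls where "ls = map (\<lambda>y. case y of Eig e r \<Rightarrow> e | _ \<Rightarrow> undefined) ss"
  have "Eig (case y of Eig e r \<Rightarrow> e | _ \<Rightarrow> undefined) 1 = y" if "y \<in> set ss" for y
    using eigs[OF ss] r1 that by (auto simp: only_eigs_def)
  then have "ss = simple_eigs ls"
    unfolding ls_def map_map comp_def by (simp add: map_idI)
  then show ?thesis ..
qed

lemma combination_transform:
  assumes X: "X \<in> carrier_mat n n" and Y: "Y \<in> carrier_mat n n" and R: "R \<in> carrier_mat n n" and S: "S \<in> carrier_mat n n"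
  shows "R * (c \<cdot>\<^sub>m X + Y) * S = c \<cdot>\<^sub>m (R * X * S) + (R * Y * S :: complex mat)"
proof -
  have cX: "c \<cdot>\<^sub>m X \<in> carrier_mat n n" using X by simp
  have "R * (c \<cdot>\<^sub>m X + Y) = R * (c \<cdot>\<^sub>m X) + R * Y"
    by (rule mult_add_distrib_mat[OF R cX Y])
  also have "R * (c \<cdot>\<^sub>m X) = c \<cdot>\<^sub>m (R * X)"
    by (rule mult_smult_distrib[OF R X])
  also have "(c \<cdot>\<^sub>m (R * X) + R * Y) * S = c \<cdot>\<^sub>m (R * X) * S + R * Y * S"
    using R X Y S by (intro add_mult_distrib_mat[of _ n n _ _ n]) auto
  also have "c \<cdot>\<^sub>m (R * X) * S = c \<cdot>\<^sub>m (R * X * S)"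
    by (rule mult_smult_assoc_mat[OF mult_carrier_mat[OF R X] S])
  finally show ?thesis .
qed

lemma diagonal_pow_mult_vec:
  assumes K: "K \<in> carrier_mat n n" "\<And>i j. i < n \<Longrightarrow> j < n \<Longrightarrow> K $$ (i, j) = (if i = j then d i else 0)"
    and x: "x \<in> carrier_vec n" and k: "k < n"
  shows "(K ^\<^sub>m j *\<^sub>v x) $ k = d k ^ j * (x $ k :: complex)"
  using x
proof (induction j arbitrary: x)
  case 0
  then show ?case using K k by simp
next
  case (Suc j)
  have Kj: "K ^\<^sub>m j \<in> carrier_mat n n" using K by simp
  have "(K *\<^sub>v x) $ k = (\<Sum>i<n. if i = k then d k * x $ i else 0)"
    unfolding index_mult_mat_vec_sum[OF K(1) Suc.prems k] by (intro sum.cong) (auto simp: K(2) k)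
  then have "(K *\<^sub>v x) $ k = d k * x $ k" using k by simp
  then show ?case
    using Suc.IH[OF mult_mat_vec_carrier[OF K(1) Suc.prems]] assoc_mult_mat_vec[OF Kj K(1) Suc.prems] by simp
qed

text \<open>A pair whose cells all have size one has a diagonalizable quotient \<open>N\<close>, which is annihilated by the squarefree
polynomial of its eigenvalues.\<close>
lemma simple_eigs_root_poly_annihilates:
  assumes eq: "pair_equivalent n n B (direct_sum (simple_eigs ls))" and det: "det (mix c B) \<noteq> 0"
    and N: "N \<in> carrier_mat n n" "mix c B * N = fst B"
    and p: "p \<in> carrier_vec n" and q: "q \<in> carrier_vec n"
  shows "(\<Sum>j<Suc (card (spec N)). (p \<bullet> (N ^\<^sub>m j *\<^sub>v q)) * coeff (root_poly (spec N)) j) = 0"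
proof -
  define \<Lambda> where "\<Lambda> = direct_sum (simple_eigs ls)"
  have eigs: "only_eigs (simple_eigs ls)" by (simp add: only_eigs_def)
  obtain R S where RS: "R \<in> carrier_mat n n" "S \<in> carrier_mat n n" "invertible_mat S"
    and \<Lambda>: "\<Lambda> = (R * fst B * S, R * snd B * S)" and B: "B \<in> mat_pairs n n" and \<Lambda>c: "\<Lambda> \<in> mat_pairs n n"
    using eq unfolding \<Lambda>_def[symmetric] by (auto simp: pair_equivalent_def prod_eq_iff)
  have ls: "length ls = n"
    using mat_pairs_unique[OF \<Lambda>c[unfolded \<Lambda>_def] direct_sum_carrier[OF eigs]] by (simp add: comp_def sum_list_triv)
  obtain S' where S': "S' \<in> carrier_mat n n" "S * S' = 1\<^sub>m n" "S' * S = 1\<^sub>m n"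
    using invertible_matE[OF RS(3,2)] by blast
  note cm = mat_pairsD[OF B] mix_carrier[OF B, of c]
  define K where "K = S' * N * S"
  have K: "K \<in> carrier_mat n n" using S' N RS by (auto simp: K_def)
  have SK: "S * K = N * S"
  proof -
    have "S * K = S * (S' * (N * S))"
      unfolding K_def using S' N RS by (subst assoc_mult_mat[of S' n n N n S n]) auto
    also have "\<dots> = S * S' * (N * S)"
      using S' N RS by (intro assoc_mult_mat[symmetric, of _ n n _ n _ n]) auto
    finally show ?thesis using S' N RS by simp
  qed
  have K_eq: "mix c \<Lambda> * K = fst \<Lambda>"
  proof -
    have mix: "mix c \<Lambda> = R * mix c B * S"
      unfolding mix_def \<Lambda> fst_conv snd_conv by (rule combination_transform[OF cm(1,2) RS(1,2), symmetric])
    have "mix c \<Lambda> * K = R * mix c B * (S * K)"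
      unfolding mix using cm RS K by (intro assoc_mult_mat[of _ n n _ n _ n]) auto
    also have "\<dots> = R * mix c B * N * S"
      unfolding SK using cm RS N by (intro assoc_mult_mat[symmetric, of _ n n _ n _ n]) auto
    also have "R * mix c B * N = R * fst B"
      using assoc_mult_mat[OF RS(1) cm(3) N(1)] N(2) by simp
    finally show ?thesis by (simp add: \<Lambda>)
  qed
  have pole: "c + l \<noteq> 0" if "FinEV l \<in> set ls" for l
    using regular_pole[OF eq eigs det, of l] that by (auto simp: eigvals_def)
  have diag: "K $$ (i, j) = (if i = j then mobius c (ls ! i) else 0)" if "i < n" "j < n" for i j
    by (rule quotient_simple_eigs[OF K K_eq[unfolded \<Lambda>_def] ls pole that])
  have "S * K * S' = N"
  proof -
    have "S * K * S' = N * (S * S')"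
      unfolding SK using S' N RS by (intro assoc_mult_mat[of _ n n _ n _ n]) auto
    then show ?thesis using S' N by simp
  qed
  then have wit: "similar_mat_wit N K S S'"
    using S' N K RS by (intro similar_mat_witI[of _ _ n]) auto
  \<comment> \<open>The coordinates of \<open>p\<close> and \<open>q\<close> in which \<open>N\<close> becomes the diagonal matrix \<open>K\<close>.\<close>
  define u where "u = transpose_mat S *\<^sub>v p"
  define v where "v = S' *\<^sub>v q"
  have uv: "u \<in> carrier_vec n" "v \<in> carrier_vec n" using RS S' p q by (auto simp: u_def v_def intro!: mult_mat_vec_carrier)
  have pow: "p \<bullet> (N ^\<^sub>m j *\<^sub>v q) = (\<Sum>k<n. u $ k * v $ k * mobius c (ls ! k) ^ j)" for j
  proof -
    have Kj: "K ^\<^sub>m j \<in> carrier_mat n n" using K by simp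
    have "N ^\<^sub>m j = S * K ^\<^sub>m j * S'"
      using similar_mat_witD2(3)[OF pow_carrier_mat[OF N(1)] similar_mat_wit_pow[OF wit]] .
    then have "N ^\<^sub>m j *\<^sub>v q = S *\<^sub>v (K ^\<^sub>m j *\<^sub>v v)"
      using assoc_mult_mat_vec[OF mult_carrier_mat[OF RS(2) Kj] S'(1) q] assoc_mult_mat_vec[OF RS(2) Kj uv(2)]
      by (simp add: v_def)
    then have "p \<bullet> (N ^\<^sub>m j *\<^sub>v q) = u \<bullet> (K ^\<^sub>m j *\<^sub>v v)"
      using transpose_vec_mult_scalar[OF RS(2) mult_mat_vec_carrier[OF Kj uv(2)] p] by (simp add: u_def)
    also have "\<dots> = (\<Sum>k<n. u $ k * (K ^\<^sub>m j *\<^sub>v v) $ k)"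
      using Kj by (auto simp: scalar_prod_def lessThan_atLeast0)
    also have "\<dots> = (\<Sum>k<n. u $ k * v $ k * mobius c (ls ! k) ^ j)"
      using diagonal_pow_mult_vec[OF K diag uv(2)] by (intro sum.cong) auto
    finally show ?thesis .
  qed
  note root = root_poly_monic_roots[OF finite_spec[OF N(1)]]
  have "mobius c (ls ! k) \<in> spec N" if "k < n" for k
    unfolding regular_spec(1)[OF eq eigs det N] using that ls by (force simp: eigvals_def)
  then have zero: "poly (root_poly (spec N)) (mobius c (ls ! k)) = 0" if "k < n" for k
    using root(3) that by blast
  have "(\<Sum>j<Suc (card (spec N)). (p \<bullet> (N ^\<^sub>m j *\<^sub>v q)) * coeff (root_poly (spec N)) j) =
    (\<Sum>j<Suc (card (spec N)). \<Sum>k<n. u $ k * v $ k * (coeff (root_poly (spec N)) j * mobius c (ls ! k) ^ j))"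
    unfolding pow sum_distrib_right by (intro sum.cong) (auto simp: mult_ac)
  also have "\<dots> = (\<Sum>k<n. u $ k * v $ k * poly (root_poly (spec N)) (mobius c (ls ! k)))"
    unfolding poly_eq_sum_lessThan[OF eq_imp_le[OF root(1)]] sum_distrib_left by (rule sum.swap)
  also have "\<dots> = 0" by (intro sum.neutral) (simp add: zero)
  finally show ?thesis .
qed

text \<open>By \<open>regular_no_jordan_block\<close> all pairs of the class have diagonalizable quotients, so the border row
vanishes on the coefficients of \<open>w\<close> along the whole curve. Two equal entries of the diagonal matrix \<open>N0\<close> contradict
\<open>constant_spectrum_no_double_eigenvalue\<close> with unit vectors for \<open>p\<close> and \<open>q\<close>.\<close>
lemma regular_distinct:
  assumes eigs: "\<And>ss. ss \<in> \<S> \<Longrightarrow> only_eigs ss"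
    and eq: "\<And>ss. ss \<in> \<S> \<Longrightarrow> pair_equivalent n n A (direct_sum ss)"
    and flex: "flexible n n A (regular_class n \<S>)" and ss: "simple_eigs ls \<in> \<S>"
  shows "distinct ls"
proof (rule ccontr)
  obtain c N0 where flex\<Lambda>: "flexible n n (direct_sum (simple_eigs ls)) (regular_class n \<S>)"
    and \<Lambda>: "direct_sum (simple_eigs ls) \<in> mat_pairs n n" and det: "det (mix c (direct_sum (simple_eigs ls))) \<noteq> 0"
    and N0: "N0 \<in> carrier_mat n n" "mix c (direct_sum (simple_eigs ls)) * N0 = fst (direct_sum (simple_eigs ls))"
    and spec: "spec N0 = mobius c ` eigvals (simple_eigs ls)"
    and pole: "\<And>l. FinEV l \<in> eigvals (simple_eigs ls) \<Longrightarrow> c + l \<noteq> 0"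
    and const: "\<And>B N. regular_class n \<S> B \<Longrightarrow> det (mix c B) \<noteq> 0 \<Longrightarrow> N \<in> carrier_mat n n \<Longrightarrow>
       mix c B * N = fst B \<Longrightarrow> card (spec N) = card (spec N0)"
    by (rule regular_normalization[OF eigs eq flex ss]) blast+
  have ls: "length ls = n"
    using mat_pairs_unique[OF \<Lambda> direct_sum_carrier[OF eigs[OF ss]]] by (simp add: comp_def sum_list_triv)
  assume "\<not> distinct ls"
  then obtain i j where ij: "i < n" "j < n" "i \<noteq> j" "ls ! i = ls ! j"
    using ls by (auto simp: distinct_conv_nth)
  define a where "a = mobius c (ls ! i)"
  define p where "p = (unit_vec n i :: complex vec)"
  define q where "q = (unit_vec n j :: complex vec)"
  have pq: "p \<in> carrier_vec n" "q \<in> carrier_vec n" by (auto simp: p_def q_def)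
  have pole': "c + l \<noteq> 0" if "FinEV l \<in> set ls" for l
    using pole[of l] that by (auto simp: eigvals_def)
  have diag: "N0 $$ (k, h) = (if k = h then mobius c (ls ! k) else 0)" if "k < n" "h < n" for k h
    by (rule quotient_simple_eigs[OF N0 ls pole' that])
  have left: "transpose_mat N0 *\<^sub>v p = a \<cdot>\<^sub>v p"
    unfolding p_def using N0 ij diag by (subst mult_mat_unit_vec[of _ n n]) (auto intro!: eq_vecI simp: a_def)
  have right: "N0 *\<^sub>v q = a \<cdot>\<^sub>v q"
    unfolding q_def using N0 ij diag by (subst mult_mat_unit_vec[of _ n n]) (auto intro!: eq_vecI simp: a_def)
  have "p \<bullet> q = 0" using ij by (simp add: p_def q_def)
  have N'c: "rank_one n p q \<in> carrier_mat n n" by (simp add: rank_one_def)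
  have N'q: "p \<bullet> (rank_one n p q *\<^sub>v q) = 1"
    unfolding q_def using ij N'c[unfolded q_def]
    by (subst mult_mat_unit_vec[of _ n n]) (auto simp: p_def rank_one_def)
  obtain N where N: "mat_DERIV n n N (rank_one n p q)" "N 0 = N0"
    "\<forall>\<^sub>F t in nhds 0. \<exists>B \<in> mat_pairs n n. regular_class n \<S> B \<and> det (mix c B) \<noteq> 0 \<and> mix c B * N t = fst B"
    using flexible_quotient[OF flex\<Lambda> \<Lambda> det N0 N'c] by blast
  have "\<forall>\<^sub>F t in nhds 0. card (spec (N t)) = card (spec (N 0)) \<and>
      (\<Sum>j<Suc (card (spec (N t))). (p \<bullet> (N t ^\<^sub>m j *\<^sub>v q)) * coeff (root_poly (spec (N t))) j) = 0"
    using N(3)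
  proof eventually_elim
    case (elim t)
    then obtain B where B: "regular_class n \<S> B" "det (mix c B) \<noteq> 0" "mix c B * N t = fst B" by blast
    obtain ss' ts where ts: "ss' \<in> \<S>" "same_symbols ss' ts" "pair_equivalent n n B (direct_sum ts)"
      using B(1) unfolding regular_class_def by blast
    have "\<exists>e. y = Eig e 1" if y: "y \<in> set ts" for y
    proof -
      obtain f x where x: "x \<in> set ss'" "y = map_symbol f x"
        using same_symbols_set[OF ts(2) y] by blast
      obtain ls' where "ss' = simple_eigs ls'"
        using regular_no_jordan_block[OF eigs eq flex ts(1)] by blast
      then show ?thesis using x by auto
    qed
    then obtain h where "\<And>y. y \<in> set ts \<Longrightarrow> y = Eig (h y) 1" by metis
    then have "ts = map (\<lambda>y. Eig (h y) 1) ts"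
      by (intro map_idI[symmetric]) simp
    then have "ts = simple_eigs (map h ts)" by (simp add: comp_def)
    then obtain ls' where ls': "ts = simple_eigs ls'" ..
    show ?case
      using simple_eigs_root_poly_annihilates[OF ts(3)[unfolded ls'] B(2) mat_DERIV_carrier(1)[OF N(1)] B(3) pq]
        const[OF B(1,2) mat_DERIV_carrier(1)[OF N(1)] B(3)] unfolding N(2) by (intro conjI)
  qed
  moreover have "a \<in> spec (N 0)"
    unfolding N(2) spec a_def using ij ls by (force simp: eigvals_def)
  ultimately show False
    using constant_spectrum_no_double_eigenvalue[OF N(1) pq(1) left[folded N(2)] pq(2) right[folded N(2)]
      \<open>p \<bullet> q = 0\<close> N'q] by blast
qed

section \<open>From genericity to the canonical forms\<close>

text \<open>Without parameters the span of the first-order coefficients is zero, so the tangent space is everything.\<close>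
lemma generic_flexible:
  assumes gen: "generic_family m n A []"
  shows "flexible m n A (same_kronecker_type m n A)"
  unfolding flexible_def
proof (intro ballI)
  fix D1 D2 :: "complex mat" assume D: "D1 \<in> carrier_mat m n" "D2 \<in> carrier_mat m n"
  define T where "T = tangent_space m n {B. same_kronecker_type m n A B} A"
  have "(D1, D2) \<in> {(fst P + fst Q, snd P + snd Q) | P Q. P \<in> pair_span m n [] \<and> Q \<in> T}"
  proof -
    have "(D1, D2) \<in> mat_pairs m n" using D by (simp add: mat_pairs_def)
    moreover have "mat_pairs m n = {(fst P + fst Q, snd P + snd Q) | P Q. P \<in> pair_span m n [] \<and> Q \<in> T}"
      using gen unfolding generic_family_def T_def by blast
    ultimately show ?thesis by (simp only:)
  qed
  then obtain P Q where PQ: "D1 = fst P + fst Q" "D2 = snd P + snd Q" "P \<in> pair_span m n []" "Q \<in> T"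
    by auto
  have P: "fst P = 0\<^sub>m m n" "snd P = 0\<^sub>m m n"
    using PQ(3) by (auto simp: pair_span_def)
  obtain \<gamma> U where U: "open U" "0 \<in> U" and hol: "holomorphic_curve m n U \<gamma>" and \<gamma>0: "\<gamma> 0 = A"
    and cls: "\<And>t. t \<in> U \<Longrightarrow> same_kronecker_type m n A (\<gamma> t)" and Q: "Q = velocity m n \<gamma>"
    using PQ(4) unfolding T_def tangent_space_def by blast
  have DQ: "D1 = fst Q" "D2 = snd Q"
    using PQ(1,2) P by (simp_all add: Q velocity_def)
  \<comment> \<open>The curve is continued by a constant outside its domain, without effect on the derivative at \<open>0\<close>.\<close>
  define \<beta> where "\<beta> t = (if t \<in> U then \<gamma> t else A)" for t
  have \<beta>0: "\<beta> 0 = A" using \<gamma>0 by (simp add: \<beta>_def)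
  have A: "A \<in> mat_pairs m n" using gen unfolding generic_family_def by (rule conjunct1)
  have carr: "\<beta> t \<in> mat_pairs m n" for t
    using hol A by (auto simp: \<beta>_def holomorphic_curve_def)
  have der: "((\<lambda>t. f (\<beta> t) $$ (i, j)) has_field_derivative deriv (\<lambda>t. f (\<gamma> t) $$ (i, j)) 0) (at 0)"
    if "(\<lambda>t. f (\<gamma> t) $$ (i, j)) holomorphic_on U" for f :: "mat_pair \<Rightarrow> complex mat" and i j
    using holomorphic_derivI[OF that U]
    by (rule has_field_derivative_transform_within_open[OF _ U]) (simp add: \<beta>_def)
  have "mat_DERIV m n (\<lambda>t. fst (\<beta> t)) D1" "mat_DERIV m n (\<lambda>t. snd (\<beta> t)) D2"
    unfolding mat_DERIV_def
    using D carr mat_pairsD[OF carr] der[of fst] der[of snd] hol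
    by (auto simp: DQ Q velocity_def holomorphic_curve_def)
  moreover have "same_kronecker_type m n A (\<beta> t)" for t
    using cls[of t] cls[OF U(2)] \<gamma>0 by (simp add: \<beta>_def)
  ultimately show "\<exists>\<gamma>1 \<gamma>2. mat_DERIV m n \<gamma>1 D1 \<and> mat_DERIV m n \<gamma>2 D2 \<and> (\<gamma>1 0, \<gamma>2 0) = A \<and>
      (\<forall>t. same_kronecker_type m n A (\<gamma>1 t, \<gamma>2 t))"
    using \<beta>0 by (intro exI[of _ "\<lambda>t. fst (\<beta> t)"] exI[of _ "\<lambda>t. snd (\<beta> t)"]) simp
qed

lemma flexible_at_base:
  assumes "flexible m n A P"
  shows "P A"
proof -
  have "(0\<^sub>m m n :: complex mat) \<in> carrier_mat m n" by simp
  then obtain \<gamma>1 \<gamma>2 :: "complex \<Rightarrow> complex mat"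
    where "(\<gamma>1 0, \<gamma>2 0) = A" "\<And>t. P (\<gamma>1 t, \<gamma>2 t)"
    using assms[unfolded flexible_def, rule_format, of "0\<^sub>m m n" "0\<^sub>m m n"] by blast
  then show ?thesis by metis
qed

lemma flexible_mono:
  assumes "flexible m n A P" "\<And>B. P B \<Longrightarrow> Q B"
  shows "flexible m n A Q"
  unfolding flexible_def
proof (intro ballI)
  fix D1 D2 :: "complex mat" assume "D1 \<in> carrier_mat m n" "D2 \<in> carrier_mat m n"
  then obtain \<gamma>1 \<gamma>2 where "mat_DERIV m n \<gamma>1 D1" "mat_DERIV m n \<gamma>2 D2" "(\<gamma>1 0, \<gamma>2 0) = A" "\<And>t. P (\<gamma>1 t, \<gamma>2 t)"
    using assms(1) unfolding flexible_def by blast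
  then show "\<exists>\<gamma>1 \<gamma>2. mat_DERIV m n \<gamma>1 D1 \<and> mat_DERIV m n \<gamma>2 D2 \<and> (\<gamma>1 0, \<gamma>2 0) = A \<and> (\<forall>t. Q (\<gamma>1 t, \<gamma>2 t))"
    using assms(2) by blast
qed

lemma same_kronecker_type_symbols:
  assumes "same_kronecker_type m n A B"
  obtains ss ts where "canonical_form m n A ss" "canonical_form m n B ts" "same_symbols ss ts"
  using assms unfolding same_kronecker_type_def same_symbols_def by blast

lemma pair_equivalent_refl:
  assumes "A \<in> mat_pairs m n"
  shows "pair_equivalent m n A A"
proof -
  have "invertible_mat (1\<^sub>m k :: complex mat)" for k by (intro invertible_matI[of _ k "1\<^sub>m k"]) auto
  then show ?thesis
    using pair_equivalentI[OF assms one_carrier_mat one_carrier_mat] mat_pairsD[OF assms] by simp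
qed

lemma symbol_pair_carrier:
  assumes "1 \<le> symbol_index y"
  shows "symbol_pair y \<in> mat_pairs (dim_row (fst (symbol_pair y))) (dim_col (fst (symbol_pair y)))"
proof -
  have "B \<in> mat_pairs (dim_row (fst B)) (dim_col (fst B))" if "B \<in> mat_pairs a b" for B a b
    using that by (auto simp: mat_pairs_def)
  moreover have "\<exists>a b. symbol_pair y \<in> mat_pairs a b"
    using assms nabla_carrier tri_carrier eig_pair_carrier
    by (cases y) (simp_all del: symbol_pair.simps, blast+)
  ultimately show ?thesis by blast
qed

text \<open>The symbols form a multiset in the definition of the type, so the blocks need not be moved by
permutation matrices.\<close>
lemma has_kronecker_type_permuted:
  assumes form: "canonical_form m n A ss" and perm: "mset rs = mset ss"
  shows "has_kronecker_type m n A rs"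
proof -
  define r c where "r y = dim_row (fst (symbol_pair y))" and "c y = dim_col (fst (symbol_pair y))" for y
  have sets: "set rs = set ss" using perm by (metis set_mset_mset)
  have idx: "1 \<le> symbol_index y" if "y \<in> set ss" for y
    using form that by (auto simp: canonical_form_def)
  have ds: "direct_sum xs \<in> mat_pairs (sum_list (map r xs)) (sum_list (map c xs))" if "set xs = set ss" for xs
    unfolding direct_sum_pair_sum r_def c_def using idx that by (intro pair_sum_carrier symbol_pair_carrier) auto
  have sums: "sum_list (map f rs) = sum_list (map f ss)" for f :: "eigval symbol \<Rightarrow> nat"
    using perm by (metis mset_map sum_mset_sum_list)
  have "direct_sum ss \<in> mat_pairs m n" using form by (simp add: canonical_form_def pair_equivalent_def)
  then have "direct_sum rs \<in> mat_pairs m n"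
    using mat_pairs_unique[OF ds[OF refl]] ds[OF sets] sums by metis
  then have rs: "canonical_form m n (direct_sum rs) rs"
    using idx sets by (auto simp: canonical_form_def pair_equivalent_refl)
  have "eigvals rs = eigvals ss" by (simp add: eigvals_def sets)
  then have "bij_betw id (eigvals ss) (eigvals rs)" by simp
  moreover have "mset rs = image_mset (map_symbol id) (mset ss)" using perm by (simp add: symbol.map_id0)
  ultimately have "same_kronecker_type m n A (direct_sum rs)"
    using form rs unfolding same_kronecker_type_def by blast
  then show ?thesis using idx sets by (simp add: has_kronecker_type_def)
qed

lemma mset_two_symbols:
  assumes "set ss \<subseteq> {x, y}" "x \<noteq> y"
  shows "mset (replicate (count (mset ss) x) x @ replicate (count (mset ss) y) y) = mset ss"
  using assms(1) by (induction ss) (use assms(2) in \<open>auto simp: add.commute\<close>)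

section \<open>Transposition\<close>

definition pair_transpose :: "mat_pair \<Rightarrow> mat_pair" where
  "pair_transpose B = (transpose_mat (fst B), transpose_mat (snd B))"

lemma pair_transpose_simps [simp]:
  "pair_transpose (pair_transpose B) = B" "fst (pair_transpose B) = transpose_mat (fst B)"
  "snd (pair_transpose B) = transpose_mat (snd B)"
  by (simp_all add: pair_transpose_def)

lemma transpose_diag_block_mat:
  "transpose_mat (diag_block_mat As) = diag_block_mat (map transpose_mat (As :: complex mat list))"
proof (induction As)
  case (Cons X As)
  define D where "D = diag_block_mat As"
  have "transpose_mat (four_block_mat X (0\<^sub>m (dim_row X) (dim_col D)) (0\<^sub>m (dim_row D) (dim_col X)) D) =
    four_block_mat (transpose_mat X) (0\<^sub>m (dim_col X) (dim_row D)) (0\<^sub>m (dim_col D) (dim_row X)) (transpose_mat D)"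
    by (subst transpose_four_block_mat[of _ "dim_row X" "dim_col X" _ "dim_col D" _ "dim_row D"]) auto
  then show ?case by (simp add: Let_def D_def Cons[symmetric])
qed simp

lemma pair_transpose_direct_sum:
  "pair_transpose (direct_sum ss) = pair_sum (map (pair_transpose \<circ> symbol_pair) ss)"
  by (simp add: direct_sum_pair_sum pair_sum_def pair_transpose_def transpose_diag_block_mat comp_def)

lemma pair_equivalent_transpose:
  assumes "pair_equivalent m n A B"
  shows "pair_equivalent n m (pair_transpose A) (pair_transpose B)"
proof -
  obtain R S where RS: "R \<in> carrier_mat m m" "S \<in> carrier_mat n n" "invertible_mat R" "invertible_mat S"
    and B: "B = (R * fst A * S, R * snd A * S)" and A: "A \<in> mat_pairs m n"
    using assms by (auto simp: pair_equivalent_def prod_eq_iff)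
  have inv: "invertible_mat (transpose_mat X)" if X: "invertible_mat X" "X \<in> carrier_mat k k" for X :: "complex mat" and k
  proof -
    obtain X' where X': "X' \<in> carrier_mat k k" "X * X' = 1\<^sub>m k" "X' * X = 1\<^sub>m k"
      using invertible_matE[OF X] by blast
    have "transpose_mat X * transpose_mat X' = 1\<^sub>m k" "transpose_mat X' * transpose_mat X = 1\<^sub>m k"
      unfolding transpose_mult[OF X(2) X'(1), symmetric] transpose_mult[OF X'(1) X(2), symmetric] X'(2,3)
      by simp_all
    then show ?thesis
      using X X' by (intro invertible_matI[of _ k "transpose_mat X'"]) auto
  qed
  have t: "transpose_mat (R * X * S) = transpose_mat S * transpose_mat X * transpose_mat R"
    if X: "X \<in> carrier_mat m n" for X
  proof -
    have "transpose_mat (R * X * S) = transpose_mat S * (transpose_mat X * transpose_mat R)"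
      using transpose_mult[OF mult_carrier_mat[OF RS(1) X] RS(2)] transpose_mult[OF RS(1) X] by simp
    then show ?thesis
      using RS X by (subst assoc_mult_mat[of _ n n _ m _ m]) auto
  qed
  have "pair_transpose B = (transpose_mat S * fst (pair_transpose A) * transpose_mat R,
      transpose_mat S * snd (pair_transpose A) * transpose_mat R)"
    using t[OF mat_pairsD(1)[OF A]] t[OF mat_pairsD(2)[OF A]] by (simp add: B pair_transpose_def)
  moreover have "pair_transpose A \<in> mat_pairs n m"
    using A by (auto simp: pair_transpose_def mat_pairs_def)
  ultimately show ?thesis
    using pair_equivalentI[of "pair_transpose A" n m "transpose_mat S" "transpose_mat R"] RS
      inv[OF RS(3,1)] inv[OF RS(4,2)] by simp
qed

lemma flexible_transpose:
  assumes "flexible m n A P"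
  shows "flexible n m (pair_transpose A) (\<lambda>B. P (pair_transpose B))"
  unfolding flexible_def
proof (intro ballI)
  fix D1 D2 :: "complex mat" assume D: "D1 \<in> carrier_mat n m" "D2 \<in> carrier_mat n m"
  then have "transpose_mat D1 \<in> carrier_mat m n" "transpose_mat D2 \<in> carrier_mat m n" by auto
  then obtain \<gamma>1 \<gamma>2 where \<gamma>: "mat_DERIV m n \<gamma>1 (transpose_mat D1)" "mat_DERIV m n \<gamma>2 (transpose_mat D2)"
    "(\<gamma>1 0, \<gamma>2 0) = A" "\<And>t. P (\<gamma>1 t, \<gamma>2 t)"
    using assms unfolding flexible_def by blast
  show "\<exists>\<gamma>1 \<gamma>2. mat_DERIV n m \<gamma>1 D1 \<and> mat_DERIV n m \<gamma>2 D2 \<and> (\<gamma>1 0, \<gamma>2 0) = pair_transpose A \<and>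
      (\<forall>t. P (pair_transpose (\<gamma>1 t, \<gamma>2 t)))"
    using mat_DERIV_transpose[OF \<gamma>(1)] mat_DERIV_transpose[OF \<gamma>(2)] \<gamma>(3,4)
    by (intro exI[of _ "\<lambda>t. transpose_mat (\<gamma>1 t)"] exI[of _ "\<lambda>t. transpose_mat (\<gamma>2 t)"])
      (auto simp: pair_transpose_def)
qed

lemma identity_block_eig: "1 \<le> r \<Longrightarrow> identity_block r (symbol_pair (Eig e r))"
  by (cases e) (auto simp: identity_block_def)

lemma identity_block_transpose: "identity_block r B \<Longrightarrow> identity_block r (pair_transpose B)"
  unfolding identity_block_def pair_transpose_def by (auto intro: bexI[of _ "transpose_mat _"])

section \<open>Generic pairs\<close>

text \<open>The index \<open>s\<close> is taken least over all canonical forms at once, as \<open>singular_summands\<close> requires.\<close>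
lemma generic_nabla:
  assumes gen: "generic_family m n A []" and form: "canonical_form m n A ss" "Nabla r \<in> set ss"
  shows "\<exists>r p q. 1 \<le> r \<and> 1 \<le> p \<and> has_kronecker_type m n A (replicate p (Nabla r) @ replicate q (Nabla (r + 1)))"
proof -
  define \<S> where "\<S> = {ss. canonical_form m n A ss}"
  define s where "s = (LEAST s. \<exists>ss \<in> \<S>. Nabla s \<in> set ss)"
  have "\<exists>ss \<in> \<S>. Nabla s \<in> set ss"
    unfolding s_def by (rule LeastI[of _ r]) (use form in \<open>auto simp: \<S>_def\<close>)
  then obtain ss where ss: "ss \<in> \<S>" "Nabla s \<in> set ss" by blast
  have minimal: "s \<le> r" if "ss \<in> \<S>" "Nabla r \<in> set ss" for ss r
    unfolding s_def by (rule Least_le) (use that in auto)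
  have index: "1 \<le> symbol_index y" if "ss \<in> \<S>" "y \<in> set ss" for ss y
    using that by (auto simp: \<S>_def canonical_form_def)
  have flex: "flexible m n A (\<lambda>B. \<exists>ts. (\<forall>y \<in> set ts. 1 \<le> symbol_index y) \<and>
      pair_equivalent m n B (pair_sum (map symbol_pair ts)) \<and>
      (\<exists>ss \<in> \<S>. \<forall>r. count (mset ts) (Nabla r) = count (mset ss) (Nabla r)))"
  proof (rule flexible_mono[OF generic_flexible[OF gen]])
    fix B assume "same_kronecker_type m n A B"
    then obtain ss ts where "canonical_form m n A ss" "canonical_form m n B ts" "same_symbols ss ts"
      by (rule same_kronecker_type_symbols)
    then show "\<exists>ts. (\<forall>y \<in> set ts. 1 \<le> symbol_index y) \<and> pair_equivalent m n B (pair_sum (map symbol_pair ts)) \<and>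
      (\<exists>ss \<in> \<S>. \<forall>r. count (mset ts) (Nabla r) = count (mset ss) (Nabla r))"
      using same_symbols_count(1)[of ss ts]
      by (intro exI[of _ ts]) (auto simp: \<S>_def canonical_form_def direct_sum_pair_sum)
  qed
  have eq: "pair_equivalent m n A (pair_sum (map symbol_pair ss))" if "ss \<in> \<S>" for ss
    using that by (simp add: \<S>_def canonical_form_def direct_sum_pair_sum)
  have "y = Nabla s \<or> y = Nabla (Suc s)" if "y \<in> set ss" for y
    by (rule singular_summands[where g = symbol_pair and nab = Nabla and tri = Tri,
      OF disjI1[OF conjI[OF refl refl]] refl refl identity_block_eig index eq flex ss minimal that])
  then have "set ss \<subseteq> {Nabla s, Nabla (Suc s)}" by blast
  from mset_two_symbols[OF this] have "has_kronecker_type m n A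
    (replicate (count (mset ss) (Nabla s)) (Nabla s) @ replicate (count (mset ss) (Nabla (Suc s))) (Nabla (s + 1)))"
    using ss by (intro has_kronecker_type_permuted[of _ _ _ ss]) (auto simp: \<S>_def)
  moreover have "1 \<le> s" using index[OF ss] by simp
  moreover have "1 \<le> count (mset ss) (Nabla s)" using ss(2) by (simp add: Suc_le_eq)
  ultimately show ?thesis by blast
qed

text \<open>The argument for \<open>Nabla\<close>, applied to the transposed pair.\<close>
lemma generic_tri:
  assumes gen: "generic_family m n A []" and form: "canonical_form m n A ss" "Tri r \<in> set ss"
  shows "\<exists>r p q. 1 \<le> r \<and> 1 \<le> p \<and> has_kronecker_type m n A (replicate p (Tri r) @ replicate q (Tri (r + 1)))"
proof -
  define \<S> where "\<S> = {ss. canonical_form m n A ss}"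
  define g where "g = pair_transpose \<circ> symbol_pair"
  define s where "s = (LEAST s. \<exists>ss \<in> \<S>. Tri s \<in> set ss)"
  have "\<exists>ss \<in> \<S>. Tri s \<in> set ss"
    unfolding s_def by (rule LeastI[of _ r]) (use form in \<open>auto simp: \<S>_def\<close>)
  then obtain ss where ss: "ss \<in> \<S>" "Tri s \<in> set ss" by blast
  have minimal: "s \<le> r" if "ss \<in> \<S>" "Tri r \<in> set ss" for ss r
    unfolding s_def by (rule Least_le) (use that in auto)
  have index: "1 \<le> symbol_index y" if "ss \<in> \<S>" "y \<in> set ss" for ss y
    using that by (auto simp: \<S>_def canonical_form_def)
  have g: "g (Tri r) = symbol_pair (Nabla r)" "g (Nabla r) = symbol_pair (Tri r)"
    "1 \<le> r \<Longrightarrow> identity_block r (g (Eig e r))" for e r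
    using identity_block_transpose[OF identity_block_eig] by (simp_all add: g_def pair_transpose_def)
  have flex: "flexible n m (pair_transpose A) (\<lambda>B. \<exists>ts. (\<forall>y \<in> set ts. 1 \<le> symbol_index y) \<and>
      pair_equivalent n m B (pair_sum (map g ts)) \<and>
      (\<exists>ss \<in> \<S>. \<forall>r. count (mset ts) (Tri r) = count (mset ss) (Tri r)))"
  proof (rule flexible_mono[OF flexible_transpose[OF generic_flexible[OF gen]]])
    fix B assume "same_kronecker_type m n A (pair_transpose B)"
    then obtain ss ts where ts: "canonical_form m n A ss" "canonical_form m n (pair_transpose B) ts" "same_symbols ss ts"
      by (rule same_kronecker_type_symbols)
    then have "pair_equivalent m n (pair_transpose B) (direct_sum ts)"
      by (simp add: canonical_form_def)
    from pair_equivalent_transpose[OF this] have "pair_equivalent n m B (pair_sum (map g ts))"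
      by (simp only: pair_transpose_simps pair_transpose_direct_sum g_def)
    then show "\<exists>ts. (\<forall>y \<in> set ts. 1 \<le> symbol_index y) \<and> pair_equivalent n m B (pair_sum (map g ts)) \<and>
      (\<exists>ss \<in> \<S>. \<forall>r. count (mset ts) (Tri r) = count (mset ss) (Tri r))"
      using same_symbols_count(2)[of ss ts] ts
      by (intro exI[of _ ts]) (auto simp: \<S>_def canonical_form_def)
  qed
  have eq: "pair_equivalent n m (pair_transpose A) (pair_sum (map g ss))" if "ss \<in> \<S>" for ss
    using that pair_equivalent_transpose[of m n A "direct_sum ss"]
    by (simp add: \<S>_def canonical_form_def pair_transpose_direct_sum g_def)
  have "y = Tri s \<or> y = Tri (Suc s)" if "y \<in> set ss" for y
    by (rule singular_summands[where g = g and nab = Tri and tri = Nabla,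
      OF disjI2[OF conjI[OF refl refl]] g index eq flex ss minimal that])
  then have "set ss \<subseteq> {Tri s, Tri (Suc s)}" by blast
  from mset_two_symbols[OF this] have "has_kronecker_type m n A
    (replicate (count (mset ss) (Tri s)) (Tri s) @ replicate (count (mset ss) (Tri (Suc s))) (Tri (s + 1)))"
    using ss by (intro has_kronecker_type_permuted[of _ _ _ ss]) (auto simp: \<S>_def)
  moreover have "1 \<le> s" using index[OF ss] by simp
  moreover have "1 \<le> count (mset ss) (Tri s)" using ss(2) by (simp add: Suc_le_eq)
  ultimately show ?thesis by blast
qed

text \<open>The two steps for the sizes and for the distinctness of the eigenvalues are combined; a canonical form exists
since the class of a generic pair contains the pair itself.\<close>
lemma generic_regular:
  assumes gen: "generic_family m n A []"
    and eigs: "\<And>ss. canonical_form m n A ss \<Longrightarrow> only_eigs ss"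
  shows "\<exists>ls. distinct ls \<and> has_kronecker_type m n A (simple_eigs ls)"
proof -
  define \<S> where "\<S> = {ss. canonical_form m n A ss}"
  obtain ss where ss: "canonical_form m n A ss"
    using flexible_at_base[OF generic_flexible[OF gen]] same_kronecker_type_symbols by blast
  have eq: "pair_equivalent m n A (direct_sum ss)" if "ss \<in> \<S>" for ss
    using that by (simp add: \<S>_def canonical_form_def)
  have eigs': "only_eigs ss" if "ss \<in> \<S>" for ss using that eigs by (simp add: \<S>_def)
  have ssS: "ss \<in> \<S>" using ss by (simp add: \<S>_def)
  have "direct_sum ss \<in> mat_pairs m n" using eq[OF ssS] by (simp add: pair_equivalent_def)
  then have mn: "m = n"
    using mat_pairs_unique[OF _ direct_sum_carrier[OF eigs'[OF ssS]]] by metis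
  have flex: "flexible n n A (regular_class n \<S>)"
  proof (rule flexible_mono[OF generic_flexible[OF gen, unfolded mn]])
    fix B assume "same_kronecker_type n n A B"
    then obtain ss ts where "canonical_form n n A ss" "canonical_form n n B ts" "same_symbols ss ts"
      by (rule same_kronecker_type_symbols)
    then show "regular_class n \<S> B"
      unfolding regular_class_def \<S>_def mn canonical_form_def by blast
  qed
  obtain ls where ls: "ss = simple_eigs ls"
    using regular_no_jordan_block[OF eigs' eq[unfolded mn] flex ssS] by blast
  have "distinct ls"
    using regular_distinct[OF eigs' eq[unfolded mn] flex] ssS ls by simp
  moreover have "has_kronecker_type m n A (simple_eigs ls)"
    using has_kronecker_type_permuted[OF ss, of "simple_eigs ls"] ls by simp
  ultimately show ?thesis by blast
qed

theorem theorem3p1: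
  fixes m n :: nat and A :: mat_pair
  assumes "A \<in> mat_pairs m n"
    and "generic_family m n A []"
  shows "(\<exists>r p q. 1 \<le> r \<and> 1 \<le> p \<and>
            has_kronecker_type m n A (replicate p (Tri r) @ replicate q (Tri (r + 1)))) \<or>
         (\<exists>r p q. 1 \<le> r \<and> 1 \<le> p \<and>
            has_kronecker_type m n A (replicate p (Nabla r) @ replicate q (Nabla (r + 1)))) \<or>
         (\<exists>ls. distinct ls \<and> has_kronecker_type m n A (map (\<lambda>l. Eig l 1) ls))"
proof (cases "\<exists>ss r. canonical_form m n A ss \<and> (Tri r \<in> set ss \<or> Nabla r \<in> set ss)")
  case True
  then show ?thesis using generic_tri[OF assms(2)] generic_nabla[OF assms(2)] by blast
next
  case False
  have "only_eigs ss" if ss: "canonical_form m n A ss" for ss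
    unfolding only_eigs_def
  proof
    fix y assume y: "y \<in> set ss"
    then have "1 \<le> symbol_index y" using ss by (auto simp: canonical_form_def)
    then show "\<exists>e r. y = Eig e r \<and> 1 \<le> r" using False ss y by (cases y) auto
  qed
  then show ?thesis using generic_regular[OF assms(2)] by blast
qed

end
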